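(* Let $q\in\mathbb{C}$ with $0<|q|<1$ and assume that $\theta=\frac1\pi\arg(q)$ is irrational. Then the Chern character of the even spectral triple $(\mathcal{A}_f,\mathcal{H}\otimes\mathbb{C}^2,\pi_{eq},\mathscr{D},\gamma)$ for $C(U_q(2))$ is non-trivial; that is, there is a projection $P$ in some matrix algebra $M_n(C(U_q(2)))$ such that the $K_0$–$K^0$ index pairing $\langle [P],[(\mathcal{A}_f,\mathcal{H}\otimes\mathbb{C}^2,F,\gamma)]\rangle$, where $F=\mathscr{D}|\mathscr{D}|^{-1}$, is non-zero.
   Context: Here $\mathbb{N}=\{0,1,2,\dots\}$. For non-zero complex $q$, $C(U_q(2))$ denotes the universal unital $C^*$-algebra generated by $a,b,D$ satisfying $$ba=q\,ab,\quad a^*b=q\,ba^*,\quad bb^*=b^*b,\quad aa^*+bb^*=1,$$ $$aD=Da,\quad bD=q^2|q|^{-2}Db,\quad DD^*=D^*D=1,\quad a^*a+|q|^2b^*b=1,$$ and $\mathcal{A}_f$ is the dense unital $*$-subalgebra generated by $a,b,D$. Let $\mathcal{H}=\ell^2(\mathbb{N})\otimes\ell^2(\mathbb{Z})\otimes\ell^2(\mathbb{Z})$ with standard orthonormal basis $\{e_{i,j,k}:i\in\mathbb{N},\ j,k\in\mathbb{Z}\}$. The faithful representation $\pi$ of $C(U_q(2))$ on $\mathcal{H}$ is $$\pi(a)e_{i,j,k}=\sqrt{1-|q|^{2i+2}}\,e_{i+1,j,k},\quad \pi(b)e_{i,j,k}=q^i e_{i,j+1,k},\quad \pi(D)e_{i,j,k}=e^{-2\pi\sqrt{-1}\,\theta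 j}e_{i,j,k+1}.$$ Let $T$ be the unbounded operator on $\mathcal{H}$ with $Te_{i,j,k}=d(i,j,k)e_{i,j,k}$, where $d(i,j,k)=i+j+\sqrt{-1}k$ if $j\ge0$ and $d(i,j,k)=-i+j+\sqrt{-1}k$ if $j<0$. On $\mathcal{H}\otimes\mathbb{C}^2$ put $$\pi_{eq}(x)=\begin{pmatrix} \pi(x) & 0 \\ 0 & \pi(x) \end{pmatrix},\quad \mathscr{D}=\begin{pmatrix} 0 & T^* \\ T & 0 \end{pmatrix},\quad \gamma=\begin{pmatrix} 1 & 0 \\ 0 & -1 \end{pmatrix}$$ ($\mathscr{D}$ being the unique self-adjoint extension from the span of the basis vectors). The kernel of $\mathscr{D}$ is finite dimensional (spanned by $(e_{0,0,0},0)$ and $(0,e_{0,0,0})$); as usual, in forming $F=\mathscr{D}|\mathscr{D}|^{-1}$ one first modifies $\mathscr{D}$ on this kernel so that it becomes invertible, e.g. by replacing $d(0,0,0)=0$ by $1$; the index pairing does not depend on this choice. Index pairing. For an even spectral triple on a Hilbert space $\mathscr{H}$ with grading $\gamma$ and $F=\mathscr{D}|\mathscr{D}|^{-1}$, and a projection $P\in M_n(\mathscr{A})$ (acting on $\mathscr{H}_n=\mathscr{H}\otimes\mathbb{C}^n$), put $\gamma_n=\gamma\otimes I_n$, $F_n=F\otimes I_n$, $P^{\pm}=\frac{1\pm\gamma_n}{2}P$, and let $\mathscr{H}_n=\mathscr{H}_n^+\oplus\mathscr{H}_n^-$ be the decomposition under $\gamma_n$. Then $P^-F_nP^+:P^+\mathscr{H}_n^+\to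 P^-\mathscr{H}_n^-$ is Fredholm, and the pairing $\langle[P],[(\mathcal{A},\mathscr{H},F,\gamma)]\rangle$ is its Fredholm index. *)

theory Defs
  imports "HOL-Analysis.Analysis" "HOL-Library.Function_Algebras"
begin

section \<open>Complex vector spaces and inner products\<close>

class complex_vector = ab_group_add +
  fixes scaleC :: "complex \<Rightarrow> 'a \<Rightarrow> 'a"  (infixr "*\<^sub>C" 75)
  assumes scaleC_add_right: "c *\<^sub>C (x + y) = c *\<^sub>C x + c *\<^sub>C y"
    and scaleC_add_left: "(c + d) *\<^sub>C x = c *\<^sub>C x + d *\<^sub>C x"
    and scaleC_scaleC: "c *\<^sub>C d *\<^sub>C x = (c * d) *\<^sub>C x"
    and scaleC_one: "1 *\<^sub>C x = x"

global_interpretation complex_vector: vector_space "scaleC :: complex \<Rightarrow> 'a \<Rightarrow> 'a :: complex_vector"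
  defines cspan = complex_vector.span
    and cdependent = complex_vector.dependent
    and cdim = complex_vector.dim
  by unfold_locales (auto simp: scaleC_add_right scaleC_add_left scaleC_scaleC scaleC_one)

text \<open>The inner product \<open>cinner\<close> is conjugate linear in its first argument.\<close>

class complex_inner = complex_vector + real_inner +
  fixes cinner :: "'a \<Rightarrow> 'a \<Rightarrow> complex"
  assumes cinner_commute: "cinner x y = cnj (cinner y x)"
    and cinner_add_right: "cinner x (y + z) = cinner x y + cinner x z"
    and cinner_scaleC_right: "cinner x (c *\<^sub>C y) = c * cinner x y"
    and Re_cinner: "Re (cinner x y) = inner x y"
    and scaleR_scaleC: "r *\<^sub>R x = complex_of_real r *\<^sub>C x"

instantiation prod :: (complex_vector, complex_vector) complex_vector
begin
definition "c *\<^sub>C x = (c *\<^sub>C fst x, c *\<^sub>C snd x)"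
instance
  by standard (auto simp: scaleC_prod_def scaleC_add_right scaleC_add_left scaleC_scaleC scaleC_one)
end

instantiation prod :: (complex_inner, complex_inner) complex_inner
begin
definition "cinner x y = cinner (fst x) (fst y) + cinner (snd x) (snd y)"
instance
proof
  fix x y z :: "'a \<times> 'b" and c :: complex and r :: real
  show "cinner x y = cnj (cinner y x)"
    unfolding cinner_prod_def
    using cinner_commute[of "fst x" "fst y"] cinner_commute[of "snd x" "snd y"] by simp
  show "cinner x (y + z) = cinner x y + cinner x z"
    by (simp add: cinner_prod_def cinner_add_right)
  show "cinner x (c *\<^sub>C y) = c * cinner x y"
    by (simp add: cinner_prod_def scaleC_prod_def cinner_scaleC_right distrib_left)
  show "Re (cinner x y) = inner x y"
    by (simp add: cinner_prod_def Re_cinner inner_prod_def)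
  show "r *\<^sub>R x = complex_of_real r *\<^sub>C x"
    by (simp add: scaleC_prod_def scaleR_prod_def scaleR_scaleC)
qed
end

instantiation "fun" :: (type, complex_vector) complex_vector
begin
definition "c *\<^sub>C f = (\<lambda>x. c *\<^sub>C f x)"
instance
  by standard (auto simp: scaleC_fun_def scaleC_add_right scaleC_add_left scaleC_scaleC scaleC_one)
end


section \<open>The Hilbert space of square summable families\<close>

typedef 'i ell2 = "{f :: 'i \<Rightarrow> complex. (\<lambda>i. (cmod (f i))\<^sup>2) summable_on UNIV}"
  morphisms coord Abs_ell2
  by (rule exI[of _ "\<lambda>_. 0"]) simp

setup_lifting type_definition_ell2

lemma coord_summable: "(\<lambda>i. (cmod (coord x i))\<^sup>2) summable_on UNIV"
  using coord[of x] by simp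

lemma ell2_eqI: "(\<And>i. coord x i = coord y i) \<Longrightarrow> x = y"
  by (simp add: coord_inject[symmetric] fun_eq_iff)

lemma square_summable_add:
  assumes "(\<lambda>i. (cmod (f i))\<^sup>2) summable_on UNIV" "(\<lambda>i. (cmod (g i))\<^sup>2) summable_on UNIV"
  shows "(\<lambda>i. (cmod (f i + g i))\<^sup>2) summable_on UNIV"
proof (rule summable_on_comparison_test)
  show "(\<lambda>i. 2 * (cmod (f i))\<^sup>2 + 2 * (cmod (g i))\<^sup>2) summable_on UNIV"
    by (intro summable_on_add summable_on_cmult_right assms)
  show "(cmod (f i + g i))\<^sup>2 \<le> 2 * (cmod (f i))\<^sup>2 + 2 * (cmod (g i))\<^sup>2" for i
  proof -
    have "(cmod (f i + g i))\<^sup>2 \<le> (cmod (f i) + cmod (g i))\<^sup>2"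
      by (intro power_mono norm_triangle_ineq) auto
    also have "\<dots> \<le> 2 * (cmod (f i))\<^sup>2 + 2 * (cmod (g i))\<^sup>2"
      using sum_squares_bound[of "cmod (f i)" "cmod (g i)"] by (simp add: power2_sum)
    finally show ?thesis .
  qed
qed auto

lemma square_summable_scale:
  assumes "(\<lambda>i. (cmod (f i))\<^sup>2) summable_on UNIV"
  shows "(\<lambda>i. (cmod (c * f i))\<^sup>2) summable_on UNIV"
  using summable_on_cmult_right[OF assms, of "(cmod c)\<^sup>2"]
  by (simp add: norm_mult power_mult_distrib)

lemma coord_mult_summable: "(\<lambda>i. cnj (coord x i) * coord y i) summable_on UNIV"
proof -
  have "(\<lambda>i. (cmod (coord x i))\<^sup>2 + (cmod (coord y i))\<^sup>2) summable_on UNIV"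
    by (intro summable_on_add coord_summable)
  moreover have "norm (cnj (coord x i) * coord y i)
      \<le> (cmod (coord x i))\<^sup>2 + (cmod (coord y i))\<^sup>2" for i
  proof -
    have "2 * (u * v) \<le> u\<^sup>2 + v\<^sup>2" "0 \<le> u * v" if "0 \<le> u" "0 \<le> v" for u v :: real
      using sum_squares_bound[of u v] that by (simp_all add: mult.assoc)
    from this[OF norm_ge_zero[of "coord x i"] norm_ge_zero[of "coord y i"]]
    show ?thesis
      unfolding norm_mult complex_mod_cnj by linarith
  qed
  ultimately have "(\<lambda>i. norm (cnj (coord x i) * coord y i)) summable_on UNIV"
    by (rule summable_on_comparison_test) (rule norm_ge_zero)
  then show ?thesis
    by (rule abs_summable_summable)
qed

instantiation ell2 :: (type) complex_vector
begin
lift_definition zero_ell2 :: "'a ell2" is "\<lambda>_. 0" by simp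
lift_definition plus_ell2 :: "'a ell2 \<Rightarrow> 'a ell2 \<Rightarrow> 'a ell2" is "\<lambda>f g i. f i + g i"
  by (rule square_summable_add)
lift_definition scaleC_ell2 :: "complex \<Rightarrow> 'a ell2 \<Rightarrow> 'a ell2" is "\<lambda>c f i. c * f i"
  by (rule square_summable_scale)
lift_definition uminus_ell2 :: "'a ell2 \<Rightarrow> 'a ell2" is "\<lambda>f i. - f i" by simp
lift_definition minus_ell2 :: "'a ell2 \<Rightarrow> 'a ell2 \<Rightarrow> 'a ell2" is "\<lambda>f g i. f i - g i"
  subgoal for f g using square_summable_add[of f "\<lambda>i. - g i"] by simp
  done
instance
  by standard
    (auto intro!: ell2_eqI simp: zero_ell2.rep_eq plus_ell2.rep_eq scaleC_ell2.rep_eq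
      uminus_ell2.rep_eq minus_ell2.rep_eq algebra_simps)
end

instantiation ell2 :: (type) complex_inner
begin
definition "r *\<^sub>R x = complex_of_real r *\<^sub>C x" for x :: "'a ell2"
definition "cinner x y = (\<Sum>\<^sub>\<infinity>i. cnj (coord x i) * coord y i)" for x y :: "'a ell2"
definition "inner x y = Re (cinner x y)" for x y :: "'a ell2"
definition "norm x = sqrt (inner x x)" for x :: "'a ell2"
definition "sgn x = inverse (norm x) *\<^sub>R x" for x :: "'a ell2"
definition "dist x y = norm (x - y)" for x y :: "'a ell2"
definition "uniformity = (INF e\<in>{0<..}. principal {(x :: 'a ell2, y). dist x y < e})"
definition "open U \<longleftrightarrow> (\<forall>x\<in>U. \<forall>\<^sub>F (x', y) in uniformity. x' = x \<longrightarrow> y \<in> U)" for U :: "'a ell2 set"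
instance
proof
  fix x y z :: "'a ell2" and c :: complex and r s :: real and U :: "'a ell2 set"
  show comm: "cinner x y = cnj (cinner y x)" for x y :: "'a ell2"
    unfolding cinner_ell2_def by (simp flip: infsum_cnj add: mult.commute)
  show add: "cinner x (y + z) = cinner x y + cinner x z" for x y z :: "'a ell2"
    unfolding cinner_ell2_def
    by (simp add: plus_ell2.rep_eq distrib_left infsum_add coord_mult_summable)
  show scale: "cinner x (c *\<^sub>C y) = c * cinner x y" for x y :: "'a ell2" and c
    unfolding cinner_ell2_def
    by (simp add: scaleC_ell2.rep_eq mult.left_commute infsum_cmult_right')
  show "Re (cinner x y) = inner x y"
    by (simp add: inner_ell2_def)
  show "r *\<^sub>R x = complex_of_real r *\<^sub>C x"
    by (simp add: scaleR_ell2_def)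
  show "r *\<^sub>R (x + y) = r *\<^sub>R x + r *\<^sub>R y" "(r + s) *\<^sub>R x = r *\<^sub>R x + s *\<^sub>R x"
    "r *\<^sub>R s *\<^sub>R x = (r * s) *\<^sub>R x" "1 *\<^sub>R x = x"
    by (simp_all add: scaleR_ell2_def scaleC_add_right scaleC_add_left scaleC_scaleC scaleC_one)
  have pos: "(\<Sum>\<^sub>\<infinity>i. (cmod (coord x i))\<^sup>2) = inner x x"
  proof -
    have "((\<lambda>i. (cmod (coord x i))\<^sup>2) has_sum (\<Sum>\<^sub>\<infinity>i. (cmod (coord x i))\<^sup>2)) UNIV"
      by (rule has_sum_infsum[OF coord_summable])
    then have "((\<lambda>i. complex_of_real ((cmod (coord x i))\<^sup>2)) has_sum
        complex_of_real (\<Sum>\<^sub>\<infinity>i. (cmod (coord x i))\<^sup>2)) UNIV"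
      by (rule has_sum_of_real)
    then have "((\<lambda>i. cnj (coord x i) * coord x i) has_sum
        complex_of_real (\<Sum>\<^sub>\<infinity>i. (cmod (coord x i))\<^sup>2)) UNIV"
      by (simp add: complex_norm_square mult.commute del: of_real_power)
    then show ?thesis
      unfolding inner_ell2_def cinner_ell2_def by (simp add: infsumI)
  qed
  show "inner x y = inner y x"
    unfolding inner_ell2_def by (subst comm) simp
  have add_left: "cinner (x + y) z = cinner x z + cinner y z"
    by (metis comm add complex_cnj_add)
  show "inner (x + y) z = inner x z + inner y z"
    unfolding inner_ell2_def by (simp add: add_left)
  have "cinner (r *\<^sub>R x) y = of_real r * cinner x y"
    unfolding scaleR_ell2_def by (metis comm scale complex_cnj_mult complex_cnj_complex_of_real)
  then show "inner (r *\<^sub>R x) y = r * inner x y"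
    unfolding inner_ell2_def by simp
  show "0 \<le> inner x x"
    unfolding pos[symmetric] by (intro infsum_nonneg) auto
  show "inner x x = 0 \<longleftrightarrow> x = 0"
  proof
    assume "inner x x = 0"
    then have "(cmod (coord x i))\<^sup>2 = 0" for i
      using nonneg_infsum_le_0D[OF _ coord_summable, of x i] pos by auto
    then show "x = 0"
      by (intro ell2_eqI) (simp add: zero_ell2.rep_eq)
  next
    assume "x = 0"
    then show "inner x x = 0"
      unfolding pos[symmetric] by (simp add: zero_ell2.rep_eq)
  qed
  show "norm x = sqrt (inner x x)" by (rule norm_ell2_def)
  show "sgn x = inverse (norm x) *\<^sub>R x" by (rule sgn_ell2_def)
  show "dist x y = norm (x - y)" by (rule dist_ell2_def)
  show "uniformity = (INF e\<in>{0<..}. principal {(x :: 'a ell2, y). dist x y < e})"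
    by (rule uniformity_ell2_def)
  show "open U \<longleftrightarrow> (\<forall>x\<in>U. \<forall>\<^sub>F (x', y) in uniformity. x' = x \<longrightarrow> y \<in> U)"
    by (rule open_ell2_def)
qed
end

lift_definition ket :: "'i \<Rightarrow> 'i ell2" is "\<lambda>i j. if j = i then 1 else 0"
  by (rule finite_nonzero_values_imp_summable_on) simp


section \<open>Bounded and unbounded operators\<close>

definition bounded_clinear :: "('a::complex_inner \<Rightarrow> 'b::complex_inner) \<Rightarrow> bool" where
  "bounded_clinear A \<longleftrightarrow> bounded_linear A \<and> (\<forall>c x. A (c *\<^sub>C x) = c *\<^sub>C A x)"

definition adj :: "('a::complex_inner \<Rightarrow> 'a) \<Rightarrow> 'a \<Rightarrow> 'a" where
  "adj A = (THE B. \<forall>x y. cinner (A x) y = cinner x (B y))"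

text \<open>The bounded operator with prescribed values on the standard orthonormal basis.\<close>

definition extend_basis :: "('i \<Rightarrow> 'i ell2) \<Rightarrow> 'i ell2 \<Rightarrow> 'i ell2" where
  "extend_basis g = (THE A. bounded_clinear A \<and> (\<forall>m. A (ket m) = g m))"

text \<open>
  An unbounded operator is identified with its graph. Composition of operators is then
  relational composition in reversed order (\<open>G O H\<close> applies \<open>G\<close> first) and inversion of an
  injective operator is \<open>converse\<close>. A single-valued relation that equals its own adjoint
  is automatically linear, closed and densely defined.
\<close>

definition graph_adjoint :: "('a::complex_inner \<times> 'a) set \<Rightarrow> ('a \<times> 'a) set" where
  "graph_adjoint G = {(y, z). \<forall>(x, w)\<in>G. cinner w y = cinner x z}"

definition selfadjoint :: "('a::complex_inner \<times> 'a) set \<Rightarrow> bool" where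
  "selfadjoint G \<longleftrightarrow> single_valued G \<and> graph_adjoint G = G"

definition graph_abs :: "('a::complex_inner \<times> 'a) set \<Rightarrow> ('a \<times> 'a) set" where
  "graph_abs G = (THE A. selfadjoint A \<and> (\<forall>(x, y)\<in>A. 0 \<le> Re (cinner x y)) \<and>
     A O A = G O graph_adjoint G)"

text \<open>\<open>graph_phase G\<close> is the operator \<open>G |G|\<^sup>-\<^sup>1\<close>, for invertible self-adjoint \<open>G\<close>.\<close>

definition graph_phase :: "('a::complex_inner \<times> 'a) set \<Rightarrow> 'a \<Rightarrow> 'a" where
  "graph_phase G x = (THE y. (x, y) \<in> (graph_abs G)\<inverse> O G)"


section \<open>Fredholm operators and the index pairing\<close>

text \<open>\<open>has_codim R W m\<close>: the quotient space \<open>W / R\<close> has dimension \<open>m\<close>.\<close>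

definition has_codim :: "'a::complex_vector set \<Rightarrow> 'a set \<Rightarrow> nat \<Rightarrow> bool" where
  "has_codim R W m \<longleftrightarrow> (\<exists>C. finite C \<and> card C = m \<and> \<not> cdependent C \<and>
     R \<inter> cspan C = {0} \<and> {x + y |x y. x \<in> R \<and> y \<in> cspan C} = W)"

definition kernel_on :: "('a::complex_vector \<Rightarrow> 'a) \<Rightarrow> 'a set \<Rightarrow> 'a set" where
  "kernel_on S V = {v \<in> V. S v = 0}"

text \<open>Boundedness of \<open>S\<close> is not part of the definition: the pairing operator below is a finite
  matrix of bounded operators. Its range is then closed, having finite codimension.\<close>

definition fredholm :: "('a::complex_vector \<Rightarrow> 'a) \<Rightarrow> 'a set \<Rightarrow> 'a set \<Rightarrow> bool" where
  "fredholm S V W \<longleftrightarrow>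
     complex_vector.subspace V \<and> complex_vector.subspace W \<and> S ` V \<subseteq> W \<and>
     (\<forall>x\<in>V. \<forall>y\<in>V. S (x + y) = S x + S y) \<and> (\<forall>c. \<forall>x\<in>V. S (c *\<^sub>C x) = c *\<^sub>C S x) \<and>
     (\<exists>B. finite B \<and> kernel_on S V \<subseteq> cspan B) \<and> (\<exists>m. has_codim (S ` V) W m)"

definition fredholm_index :: "('a::complex_vector \<Rightarrow> 'a) \<Rightarrow> 'a set \<Rightarrow> 'a set \<Rightarrow> int" where
  "fredholm_index S V W = int (cdim (kernel_on S V)) - int (THE m. has_codim (S ` V) W m)"

text \<open>
  Vectors of \<open>H \<otimes> \<complex>\<^sup>n\<close> are families \<open>v :: nat \<Rightarrow> 'h\<close> with \<open>v k = 0\<close> for \<open>k \<ge> n\<close>, and an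
  \<open>n \<times> n\<close> matrix over the algebra is a function of two indices of which only the values at
  \<open>k, l < n\<close> matter.
\<close>

definition amplify :: "nat \<Rightarrow> ('h \<Rightarrow> 'h) \<Rightarrow> (nat \<Rightarrow> 'h) \<Rightarrow> nat \<Rightarrow> 'h::complex_inner" where
  "amplify n S v = (\<lambda>k. if k < n then S (v k) else 0)"

definition matrix_act ::
    "('x \<Rightarrow> 'h \<Rightarrow> 'h) \<Rightarrow> nat \<Rightarrow> (nat \<Rightarrow> nat \<Rightarrow> 'x) \<Rightarrow> (nat \<Rightarrow> 'h) \<Rightarrow> nat \<Rightarrow> 'h::complex_inner" where
  "matrix_act \<rho> n P v = (\<lambda>k. if k < n then \<Sum>l<n. \<rho> (P k l) (v l) else 0)"

text \<open>In the following definitions the sign \<open>s\<close> is \<open>1\<close> or \<open>-1\<close>: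
  \<open>graded_part \<gamma> n s\<close> is the \<open>s\<close>-eigenspace of \<open>\<gamma>\<^sub>n\<close>, and
  \<open>graded_matrix \<rho> \<gamma> n P s\<close> is \<open>(1 + s \<gamma>\<^sub>n)/2 P\<close>.\<close>

definition graded_part :: "('h \<Rightarrow> 'h) \<Rightarrow> nat \<Rightarrow> complex \<Rightarrow> (nat \<Rightarrow> 'h::complex_inner) set" where
  "graded_part \<gamma> n s = {v. (\<forall>k\<ge>n. v k = 0) \<and> amplify n \<gamma> v = s *\<^sub>C v}"

definition graded_matrix :: "('x \<Rightarrow> 'h \<Rightarrow> 'h) \<Rightarrow> ('h \<Rightarrow> 'h) \<Rightarrow> nat \<Rightarrow> (nat \<Rightarrow> nat \<Rightarrow> 'x) \<Rightarrow> complex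
    \<Rightarrow> (nat \<Rightarrow> 'h) \<Rightarrow> nat \<Rightarrow> 'h::complex_inner" where
  "graded_matrix \<rho> \<gamma> n P s v =
     (1/2) *\<^sub>C (matrix_act \<rho> n P v + s *\<^sub>C amplify n \<gamma> (matrix_act \<rho> n P v))"

definition pairing_operator :: "('x \<Rightarrow> 'h \<Rightarrow> 'h) \<Rightarrow> ('h \<Rightarrow> 'h) \<Rightarrow> ('h \<Rightarrow> 'h) \<Rightarrow> nat
    \<Rightarrow> (nat \<Rightarrow> nat \<Rightarrow> 'x) \<Rightarrow> (nat \<Rightarrow> 'h) \<Rightarrow> nat \<Rightarrow> 'h::complex_inner" where
  "pairing_operator \<rho> F \<gamma> n P =
     graded_matrix \<rho> \<gamma> n P (-1) \<circ> amplify n F \<circ> graded_matrix \<rho> \<gamma> n P 1"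

definition pairing_space :: "('x \<Rightarrow> 'h \<Rightarrow> 'h) \<Rightarrow> ('h \<Rightarrow> 'h) \<Rightarrow> nat \<Rightarrow> (nat \<Rightarrow> nat \<Rightarrow> 'x) \<Rightarrow> complex
    \<Rightarrow> (nat \<Rightarrow> 'h::complex_inner) set" where
  "pairing_space \<rho> \<gamma> n P s = graded_matrix \<rho> \<gamma> n P s ` graded_part \<gamma> n s"

definition pairing_fredholm :: "('x \<Rightarrow> 'h \<Rightarrow> 'h::complex_inner) \<Rightarrow> ('h \<Rightarrow> 'h) \<Rightarrow> ('h \<Rightarrow> 'h) \<Rightarrow> nat
    \<Rightarrow> (nat \<Rightarrow> nat \<Rightarrow> 'x) \<Rightarrow> bool" where
  "pairing_fredholm \<rho> F \<gamma> n P \<longleftrightarrow>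
     fredholm (pairing_operator \<rho> F \<gamma> n P) (pairing_space \<rho> \<gamma> n P 1) (pairing_space \<rho> \<gamma> n P (-1))"

definition index_pairing :: "('x \<Rightarrow> 'h \<Rightarrow> 'h::complex_inner) \<Rightarrow> ('h \<Rightarrow> 'h) \<Rightarrow> ('h \<Rightarrow> 'h) \<Rightarrow> nat
    \<Rightarrow> (nat \<Rightarrow> nat \<Rightarrow> 'x) \<Rightarrow> int" where
  "index_pairing \<rho> F \<gamma> n P =
     fredholm_index (pairing_operator \<rho> F \<gamma> n P)
       (pairing_space \<rho> \<gamma> n P 1) (pairing_space \<rho> \<gamma> n P (-1))"


section \<open>The algebra \<open>C(U\<^sub>q(2))\<close>\<close>

type_synonym idx = "nat \<times> int \<times> int"

text \<open>\<open>\<ell>\<^sup>2(\<nat>) \<otimes> \<ell>\<^sup>2(\<int>) \<otimes> \<ell>\<^sup>2(\<int>)\<close>, with \<open>ket (i, j, k)\<close> as the vector \<open>e\<^sub>i\<^sub>,\<^sub>j\<^sub>,\<^sub>k\<close>.\<close>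

type_synonym hilb = "idx ell2"
type_synonym hop = "hilb \<Rightarrow> hilb"

definition uq2_relations :: "complex \<Rightarrow> hop \<Rightarrow> hop \<Rightarrow> hop \<Rightarrow> bool" where
  "uq2_relations q a b D \<longleftrightarrow>
     b \<circ> a = q *\<^sub>C (a \<circ> b) \<and>
     adj a \<circ> b = q *\<^sub>C (b \<circ> adj a) \<and>
     b \<circ> adj b = adj b \<circ> b \<and>
     (a \<circ> adj a) + (b \<circ> adj b) = id \<and>
     a \<circ> D = D \<circ> a \<and>
     b \<circ> D = (q\<^sup>2 / complex_of_real ((cmod q)\<^sup>2)) *\<^sub>C (D \<circ> b) \<and>
     D \<circ> adj D = id \<and> adj D \<circ> D = id \<and>
     (adj a \<circ> a) + complex_of_real ((cmod q)\<^sup>2) *\<^sub>C (adj b \<circ> b) = id"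

definition uq2_reps :: "complex \<Rightarrow> (hop \<times> hop \<times> hop) set" where
  "uq2_reps q = {(a, b, D). bounded_clinear a \<and> bounded_clinear b \<and> bounded_clinear D \<and>
     uq2_relations q a b D}"

text \<open>
  The universal \<open>C\<^sup>*\<close>-algebra on the generators and relations above is the completion of the
  free \<open>*\<close>-algebra on \<open>a, b, D\<close> for the seminorm given by the supremum of the operator norm
  over all representations of the relations. Since every \<open>C\<^sup>*\<close>-algebra with finitely many
  generators has, for each of its elements, a norm-attaining cyclic representation, which is
  separable, it suffices to take representations on one infinite dimensional separable
  Hilbert space (replace a representation by its countable multiple); \<open>hilb\<close> is such a space.
  The completion is realised inside the bounded families of operators indexed by
  \<open>uq2_reps q\<close>, with pointwise operations and the supremum norm. A generator is the
  family whose member at a representation is its value in that representation; families are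
  set to \<open>0\<close> outside \<open>uq2_reps q\<close>, so that equality of families is equality in the algebra.
\<close>

type_synonym uq2 = "hop \<times> hop \<times> hop \<Rightarrow> hop"

definition uq2_elem :: "complex \<Rightarrow> uq2 \<Rightarrow> uq2" where
  "uq2_elem q x = (\<lambda>t. if t \<in> uq2_reps q then x t else 0)"

definition uq2_mult :: "uq2 \<Rightarrow> uq2 \<Rightarrow> uq2" where
  "uq2_mult x y = (\<lambda>t. x t \<circ> y t)"

definition uq2_star :: "uq2 \<Rightarrow> uq2" where
  "uq2_star x = (\<lambda>t. adj (x t))"

text \<open>The unital \<open>*\<close>-subalgebra \<open>\<A>\<^sub>f\<close> generated by \<open>a, b, D\<close>.\<close>

inductive_set uq2_fin :: "complex \<Rightarrow> uq2 set" for q :: complex where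
  gen_a: "uq2_elem q (\<lambda>(a, b, D). a) \<in> uq2_fin q"
| gen_b: "uq2_elem q (\<lambda>(a, b, D). b) \<in> uq2_fin q"
| gen_D: "uq2_elem q (\<lambda>(a, b, D). D) \<in> uq2_fin q"
| unit: "uq2_elem q (\<lambda>_. id) \<in> uq2_fin q"
| add: "x \<in> uq2_fin q \<Longrightarrow> y \<in> uq2_fin q \<Longrightarrow> x + y \<in> uq2_fin q"
| scale: "x \<in> uq2_fin q \<Longrightarrow> c *\<^sub>C x \<in> uq2_fin q"
| mult: "x \<in> uq2_fin q \<Longrightarrow> y \<in> uq2_fin q \<Longrightarrow> uq2_mult x y \<in> uq2_fin q"
| star: "x \<in> uq2_fin q \<Longrightarrow> uq2_star x \<in> uq2_fin q"

text \<open>Its closure in the supremum norm. (Membership forces every \<open>x t\<close> to be bounded and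
  linear.)\<close>

definition C_uq2 :: "complex \<Rightarrow> uq2 set" where
  "C_uq2 q = {x. (\<forall>t. t \<notin> uq2_reps q \<longrightarrow> x t = 0) \<and>
     (\<forall>\<epsilon>>0. \<exists>y\<in>uq2_fin q. \<forall>t\<in>uq2_reps q. \<forall>v. norm (x t v - y t v) \<le> \<epsilon> * norm v)}"

definition uq2_projection :: "complex \<Rightarrow> nat \<Rightarrow> (nat \<Rightarrow> nat \<Rightarrow> uq2) \<Rightarrow> bool" where
  "uq2_projection q n P \<longleftrightarrow> (\<forall>k<n. \<forall>l<n. P k l \<in> C_uq2 q \<and>
     (\<Sum>m<n. uq2_mult (P k m) (P m l)) = P k l \<and> uq2_star (P l k) = P k l)"


section \<open>The representation and the spectral triple\<close>

definition uq2_theta :: "complex \<Rightarrow> real" where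
  "uq2_theta q = Arg q / pi"

definition pi_a :: "complex \<Rightarrow> hop" where
  "pi_a q = extend_basis (\<lambda>(i, j, k).
     complex_of_real (sqrt (1 - cmod q ^ (2 * i + 2))) *\<^sub>C ket (i + 1, j, k))"

definition pi_b :: "complex \<Rightarrow> hop" where
  "pi_b q = extend_basis (\<lambda>(i, j, k). q ^ i *\<^sub>C ket (i, j + 1, k))"

definition pi_D :: "complex \<Rightarrow> hop" where
  "pi_D q = extend_basis (\<lambda>(i, j, k).
     exp (- 2 * of_real pi * \<i> * of_real (uq2_theta q) * of_int j) *\<^sub>C ket (i, j, k + 1))"

text \<open>The \<open>*\<close>-homomorphism \<open>\<pi>\<close> determined by the images of \<open>a, b, D\<close> is evaluation of a family
  at the corresponding representation.\<close>

definition uq2_pi :: "complex \<Rightarrow> uq2 \<Rightarrow> hop" where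
  "uq2_pi q x = x (pi_a q, pi_b q, pi_D q)"

definition uq2_pi_eq :: "complex \<Rightarrow> uq2 \<Rightarrow> hilb \<times> hilb \<Rightarrow> hilb \<times> hilb" where
  "uq2_pi_eq q x = (\<lambda>(u, v). (uq2_pi q x u, uq2_pi q x v))"

definition uq2_gamma :: "hilb \<times> hilb \<Rightarrow> hilb \<times> hilb" where
  "uq2_gamma = (\<lambda>(u, v). (u, - v))"

definition uq2_d :: "idx \<Rightarrow> complex" where
  "uq2_d = (\<lambda>(i, j, k). if j \<ge> 0 then of_nat i + of_int j + \<i> * of_int k
     else - of_nat i + of_int j + \<i> * of_int k)"

text \<open>The closed operator with \<open>T (ket m) = d m *\<^sub>C ket m\<close>, on its maximal domain.\<close>

definition diagonal_graph :: "(idx \<Rightarrow> complex) \<Rightarrow> (hilb \<times> hilb) set" where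
  "diagonal_graph d = {(x, y). \<forall>m. coord y m = d m * coord x m}"

definition dirac :: "(idx \<Rightarrow> complex) \<Rightarrow> ((hilb \<times> hilb) \<times> (hilb \<times> hilb)) set" where
  "dirac d = {((x\<^sub>1, x\<^sub>2), (y\<^sub>1, y\<^sub>2)).
     (x\<^sub>2, y\<^sub>1) \<in> graph_adjoint (diagonal_graph d) \<and> (x\<^sub>1, y\<^sub>2) \<in> diagonal_graph d}"

text \<open>To form \<open>F\<close>, the operator is made invertible by replacing \<open>d(0,0,0) = 0\<close> by \<open>1\<close>.\<close>

definition uq2_F :: "hilb \<times> hilb \<Rightarrow> hilb \<times> hilb" where
  "uq2_F = graph_phase (dirac (uq2_d((0, 0, 0) := 1)))"


section \<open>The operators in coordinates\<close>


lemma norm_ell2_sq: "(norm x)\<^sup>2 = (\<Sum>\<^sub>\<infinity>i. (cmod (coord x i))\<^sup>2)" for x :: "'i ell2"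
proof -
  have "((\<lambda>i. complex_of_real ((cmod (coord x i))\<^sup>2)) has_sum
      complex_of_real (\<Sum>\<^sub>\<infinity>i. (cmod (coord x i))\<^sup>2)) UNIV"
    by (rule has_sum_of_real[OF has_sum_infsum[OF coord_summable]])
  then have "((\<lambda>i. cnj (coord x i) * coord x i) has_sum
      complex_of_real (\<Sum>\<^sub>\<infinity>i. (cmod (coord x i))\<^sup>2)) UNIV"
    by (simp add: complex_norm_square mult.commute del: of_real_power)
  then have "inner x x = (\<Sum>\<^sub>\<infinity>i. (cmod (coord x i))\<^sup>2)"
    unfolding inner_ell2_def cinner_ell2_def by (simp add: infsumI)
  then show ?thesis by (simp add: power2_norm_eq_inner)
qed

lemma coord_ket: "coord (ket m) i = (if i = m then 1 else 0)"
  by (simp add: ket.rep_eq)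

lemma cinner_ket: "cinner (ket m) x = coord x m"
proof -
  have "cinner (ket m) x = (\<Sum>\<^sub>\<infinity>i\<in>{m}. cnj (coord (ket m) i) * coord x i)"
    unfolding cinner_ell2_def by (rule infsum_cong_neutral) (auto simp: coord_ket)
  then show ?thesis by (simp add: coord_ket)
qed

lemma coord_sum: "coord (sum f A) i = (\<Sum>a\<in>A. coord (f a) i)"
  by (induction A rule: infinite_finite_induct) (auto simp: zero_ell2.rep_eq plus_ell2.rep_eq)

lemma bounded_clinear_ket_eqI:
  fixes A B :: "'i ell2 \<Rightarrow> 'b::complex_inner"
  assumes A: "bounded_clinear A" and B: "bounded_clinear B" and eq: "\<And>m. A (ket m) = B (ket m)"
  shows "A = B"
proof
  fix x :: "'i ell2"
  let ?s = "\<lambda>F. \<Sum>m\<in>F. coord x m *\<^sub>C ket m"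
  interpret A: bounded_linear A using A by (simp add: bounded_clinear_def)
  interpret B: bounded_linear B using B by (simp add: bounded_clinear_def)
  have s: "A (?s F) = B (?s F)" for F
    using A B by (simp add: A.sum B.sum bounded_clinear_def eq)
  have co: "coord (x - ?s F) i = (if i \<in> F then 0 else coord x i)" if "finite F" for F i
  proof -
    have "coord (?s F) i = (\<Sum>m\<in>F. if m = i then coord x i else 0)"
      unfolding coord_sum scaleC_ell2.rep_eq coord_ket by (intro sum.cong) auto
    then show ?thesis using that by (simp add: minus_ell2.rep_eq)
  qed
  have nrm: "(norm (x - ?s F))\<^sup>2 = (norm x)\<^sup>2 - (\<Sum>i\<in>F. (cmod (coord x i))\<^sup>2)" if "finite F" for F
  proof -
    have "(norm (x - ?s F))\<^sup>2 = (\<Sum>\<^sub>\<infinity>i\<in>-F. (cmod (coord x i))\<^sup>2)"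
      unfolding norm_ell2_sq by (rule infsum_cong_neutral) (auto simp: co that)
    also have "\<dots> = (norm x)\<^sup>2 - (\<Sum>i\<in>F. (cmod (coord x i))\<^sup>2)"
      unfolding norm_ell2_sq Compl_eq_Diff_UNIV
      using that by (subst infsum_Diff) (auto intro: coord_summable)
    finally show ?thesis .
  qed
  have lim: "((\<lambda>F. \<Sum>i\<in>F. (cmod (coord x i))\<^sup>2) \<longlongrightarrow> (norm x)\<^sup>2) (finite_subsets_at_top UNIV)"
    using has_sum_infsum[OF coord_summable, of x] unfolding has_sum_def norm_ell2_sq .
  have ev: "\<forall>\<^sub>F F in finite_subsets_at_top UNIV. finite (F :: 'i set)"
    by (simp add: eventually_finite_subsets_at_top_weakI)
  have "((\<lambda>F. (norm x)\<^sup>2 - (\<Sum>i\<in>F. (cmod (coord x i))\<^sup>2)) \<longlongrightarrow> 0) (finite_subsets_at_top UNIV)"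
    using tendsto_diff[OF tendsto_const[of "(norm x)\<^sup>2"] lim] by simp
  moreover have "\<forall>\<^sub>F F in finite_subsets_at_top UNIV.
      (norm x)\<^sup>2 - (\<Sum>i\<in>F. (cmod (coord x i))\<^sup>2) = (norm (x - ?s F))\<^sup>2"
    by (rule eventually_mono[OF ev]) (simp add: nrm)
  ultimately have "((\<lambda>F. (norm (x - ?s F))\<^sup>2) \<longlongrightarrow> 0) (finite_subsets_at_top UNIV)"
    by (rule Lim_transform_eventually)
  from tendsto_real_sqrt[OF this]
  have "((\<lambda>F. norm (x - ?s F)) \<longlongrightarrow> 0) (finite_subsets_at_top UNIV)"
    by simp
  then have "((\<lambda>F. dist (?s F) x) \<longlongrightarrow> 0) (finite_subsets_at_top UNIV)"
    by (simp add: dist_norm norm_minus_commute)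
  then have "(?s \<longlongrightarrow> x) (finite_subsets_at_top UNIV)"
    using tendsto_dist_iff by blast
  then have "((\<lambda>F. A (?s F)) \<longlongrightarrow> A x) (finite_subsets_at_top UNIV)"
    "((\<lambda>F. B (?s F)) \<longlongrightarrow> B x) (finite_subsets_at_top UNIV)"
    by (auto intro: A.tendsto B.tendsto)
  then show "A x = B x"
    unfolding s by (rule tendsto_unique[OF finite_subsets_at_top_neq_bot])
qed

lemma adj_eqI:
  fixes A B :: "'a::complex_inner \<Rightarrow> 'a"
  assumes "\<And>x y. cinner (A x) y = cinner x (B y)"
  shows "adj A = B"
  unfolding adj_def
proof (rule the_equality)
  fix C assume C: "\<forall>x y. cinner (A x) y = cinner x (C y)"
  show "C = B"
  proof
    fix y
    have "cinner x (C y) = cinner x (B y)" for x using C assms by metis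
    then have "inner x (C y - B y) = 0" for x by (metis Re_cinner inner_diff_right diff_self)
    then show "C y = B y" by (metis inner_eq_zero_iff eq_iff_diff_eq_0)
  qed
qed (use assms in auto)

locale wshift =
  fixes w :: "'i \<Rightarrow> complex" and f :: "'i \<Rightarrow> 'i"
  assumes inj: "inj f" and le1: "cmod (w i) \<le> 1"
begin

definition op :: "'i ell2 \<Rightarrow> 'i ell2" where
  "op x = Abs_ell2 (\<lambda>y. if y \<in> range f then w (inv f y) * coord x (inv f y) else 0)"

lemma w_sq: "(cmod (w i * z))\<^sup>2 \<le> (cmod z)\<^sup>2"
  using le1[of i] by (intro power_mono) (auto simp: norm_mult mult_left_le_one_le)

lemma summable_w: "(\<lambda>i. (cmod (w i * coord x i))\<^sup>2) summable_on UNIV"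
  by (rule summable_on_comparison_test[OF coord_summable[of x]]) (auto simp: w_sq)

lemma coord_op: "coord (op x) y = (if y \<in> range f then w (inv f y) * coord x (inv f y) else 0)"
proof -
  let ?g = "\<lambda>y. if y \<in> range f then w (inv f y) * coord x (inv f y) else 0"
  have "(\<lambda>y. (cmod (?g y))\<^sup>2) summable_on range f"
    using inj summable_w[of x] by (subst summable_on_reindex) (auto simp: o_def)
  then have "(\<lambda>y. (cmod (?g y))\<^sup>2) summable_on UNIV"
    by (rule summable_on_cong_neutral[THEN iffD1, rotated -1]) auto
  then show ?thesis unfolding op_def by (subst Abs_ell2_inverse) auto
qed

lemma coord_op_f: "coord (op x) (f m) = w m * coord x m"
  using inj by (simp add: coord_op)

lemma norm_op: "norm (op x) \<le> norm x"
proof -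
  have "(norm (op x))\<^sup>2 = (\<Sum>\<^sub>\<infinity>y\<in>range f. (cmod (coord (op x) y))\<^sup>2)"
    unfolding norm_ell2_sq by (rule infsum_cong_neutral) (auto simp: coord_op)
  also have "\<dots> = (\<Sum>\<^sub>\<infinity>m. (cmod (w m * coord x m))\<^sup>2)"
    using inj by (subst infsum_reindex) (auto simp: o_def coord_op_f)
  also have "\<dots> \<le> (norm x)\<^sup>2"
    unfolding norm_ell2_sq by (intro infsum_mono summable_w coord_summable w_sq)
  finally show ?thesis by (simp add: power2_le_iff_abs_le)
qed

lemma bounded_clinear_op: "bounded_clinear op"
proof -
  have sc: "op (c *\<^sub>C x) = c *\<^sub>C op x" for c x
    by (rule ell2_eqI) (simp add: coord_op scaleC_ell2.rep_eq)
  have "bounded_linear op"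
  proof (rule bounded_linear_intro[where K = 1])
    show "op (x + y) = op x + op y" for x y
      by (rule ell2_eqI) (simp add: coord_op plus_ell2.rep_eq distrib_left)
    show "op (r *\<^sub>R x) = r *\<^sub>R op x" for r x
      by (simp add: scaleR_scaleC sc)
  qed (use norm_op in auto)
  then show ?thesis using sc by (simp add: bounded_clinear_def)
qed

lemma op_ket: "op (ket m) = w m *\<^sub>C ket (f m)"
proof (rule ell2_eqI)
  fix y
  show "coord (op (ket m)) y = coord (w m *\<^sub>C ket (f m)) y"
    using inj by (auto simp: coord_op scaleC_ell2.rep_eq coord_ket)
qed

lemma extend_basis_eq: "extend_basis (\<lambda>m. w m *\<^sub>C ket (f m)) = op"
  unfolding extend_basis_def
  by (rule the_equality) (auto simp: bounded_clinear_op op_ket intro: bounded_clinear_ket_eqI)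

lemma coord_adj_op: "coord (adj op y) m = cnj (w m) * coord y (f m)"
proof -
  define B where "B y = Abs_ell2 (\<lambda>m. cnj (w m) * coord y (f m))" for y
  have "(\<lambda>m. (cmod (cnj (w m) * coord y (f m)))\<^sup>2) summable_on UNIV" for y
  proof (rule summable_on_comparison_test)
    have "(\<lambda>i. (cmod (coord y i))\<^sup>2) summable_on range f"
      by (rule summable_on_subset_banach[OF coord_summable]) auto
    then show "(\<lambda>m. (cmod (coord y (f m)))\<^sup>2) summable_on UNIV"
      using inj by (subst (asm) summable_on_reindex) (auto simp: o_def)
    show "(cmod (cnj (w m) * coord y (f m)))\<^sup>2 \<le> (cmod (coord y (f m)))\<^sup>2" for m
      using w_sq[of m "coord y (f m)"] by (simp add: norm_mult)
  qed auto
  then have B: "coord (B y) m = cnj (w m) * coord y (f m)" for y m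
    unfolding B_def by (subst Abs_ell2_inverse) auto
  have "adj op = B"
  proof (rule adj_eqI)
    fix x y
    have "cinner (op x) y = (\<Sum>\<^sub>\<infinity>i\<in>range f. cnj (coord (op x) i) * coord y i)"
      unfolding cinner_ell2_def by (rule infsum_cong_neutral) (auto simp: coord_op)
    also have "\<dots> = (\<Sum>\<^sub>\<infinity>m. cnj (coord x m) * coord (B y) m)"
      using inj by (subst infsum_reindex) (auto simp: o_def coord_op_f B intro!: infsum_cong)
    finally show "cinner (op x) y = cinner x (B y)" by (simp add: cinner_ell2_def)
  qed
  then show ?thesis using B by simp
qed

end

lemma pi_a_wshift:
  assumes "cmod q < 1"
  shows "wshift (\<lambda>(i, j, k). complex_of_real (sqrt (1 - cmod q ^ (2 * i + 2)))) (\<lambda>(i::nat, j::int, k::int). (i + 1, j, k))"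
proof
  fix m :: idx
  obtain i j k where m: "m = (i, j, k)" by (cases m)
  have "0 \<le> 1 - cmod q ^ (2 * i + 2)" using assms by (simp add: power_le_one del: power_Suc add_2_eq_Suc')
  then show "cmod (case m of (i, j, k) \<Rightarrow> complex_of_real (sqrt (1 - cmod q ^ (2 * i + 2)))) \<le> 1"
    unfolding m split norm_of_real by (subst abs_of_nonneg) auto
qed (auto simp: inj_on_def)

lemma pi_b_wshift:
  assumes "cmod q < 1"
  shows "wshift (\<lambda>(i, j, k). q ^ i) (\<lambda>(i::nat, j::int, k::int). (i, j + 1, k))"
  using assms by unfold_locales (auto simp: inj_on_def norm_power power_le_one)

lemma pi_D_wshift:
  "wshift (\<lambda>(i, j, k). exp (- 2 * of_real pi * \<i> * of_real (uq2_theta q) * of_int j))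
     (\<lambda>(i::nat, j::int, k::int). (i, j, k + 1))"
  by unfold_locales (auto simp: inj_on_def)

lemma coord_pi_a:
  assumes "cmod q < 1"
  shows "coord (pi_a q x) (i, j, k) =
      (if i = 0 then 0 else of_real (sqrt (1 - cmod q ^ (2 * i))) * coord x (i - 1, j, k))" (is ?A)
    and "coord (adj (pi_a q) x) (i, j, k) =
      of_real (sqrt (1 - cmod q ^ (2 * i + 2))) * coord x (i + 1, j, k)" (is ?B)
    and "bounded_clinear (pi_a q)" (is ?C)
proof -
  interpret wshift "\<lambda>(i, j, k). complex_of_real (sqrt (1 - cmod q ^ (2 * i + 2)))"
    "\<lambda>(i::nat, j::int, k::int). (i + 1, j, k)" by (rule pi_a_wshift[OF assms])
  have op: "pi_a q = op"
    unfolding pi_a_def extend_basis_eq[symmetric] by (rule arg_cong[where f = extend_basis]) auto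
  show ?A
  proof (cases i)
    case 0
    then have "(i, j, k) \<notin> range (\<lambda>(i::nat, j::int, k::int). (i + 1, j, k))" by auto
    then show ?thesis unfolding op coord_op using 0 by (simp only: if_False if_True simp_thms)
  next
    case (Suc m) then show ?thesis unfolding op using coord_op_f[of x "(m, j, k)"] by simp
  qed
  show ?B unfolding op coord_adj_op by simp
  show ?C unfolding op by (rule bounded_clinear_op)
qed

lemma coord_pi_b:
  assumes "cmod q < 1"
  shows "coord (pi_b q x) (i, j, k) = q ^ i * coord x (i, j - 1, k)" (is ?A)
    and "coord (adj (pi_b q) x) (i, j, k) = cnj q ^ i * coord x (i, j + 1, k)" (is ?B)
    and "bounded_clinear (pi_b q)" (is ?C)
proof -
  interpret wshift "\<lambda>(i, j, k). q ^ i" "\<lambda>(i::nat, j::int, k::int). (i, j + 1, k)"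
    by (rule pi_b_wshift[OF assms])
  have op: "pi_b q = op"
    unfolding pi_b_def extend_basis_eq[symmetric] by (rule arg_cong[where f = extend_basis]) auto
  show ?A unfolding op using coord_op_f[of x "(i, j - 1, k)"] by simp
  show ?B unfolding op coord_adj_op by simp
  show ?C unfolding op by (rule bounded_clinear_op)
qed

lemma coord_pi_D:
  shows "coord (pi_D q x) (i, j, k) = cis (- 2 * pi * uq2_theta q * j) * coord x (i, j, k - 1)" (is ?A)
    and "coord (adj (pi_D q) x) (i, j, k) = cis (2 * pi * uq2_theta q * j) * coord x (i, j, k + 1)" (is ?B)
    and "bounded_clinear (pi_D q)" (is ?C)
proof -
  interpret wshift "\<lambda>(i, j, k). exp (- 2 * of_real pi * \<i> * of_real (uq2_theta q) * of_int j)"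
     "\<lambda>(i::nat, j::int, k::int). (i, j, k + 1)"
    by (rule pi_D_wshift)
  have op: "pi_D q = op"
    unfolding pi_D_def extend_basis_eq[symmetric] by (rule arg_cong[where f = extend_basis]) auto
  have e: "exp (- 2 * of_real pi * \<i> * of_real (uq2_theta q) * of_int j) = cis (- 2 * pi * uq2_theta q * j)"
    by (simp add: cis_conv_exp mult_ac)
  show ?A unfolding op e[symmetric] using coord_op_f[of x "(i, j, k - 1)"] by simp
  show ?B unfolding op coord_adj_op split e by (simp add: cis_cnj)
  show ?C unfolding op by (rule bounded_clinear_op)
qed

text \<open>Hence \<open>uq2_pi\<close> is evaluation at a genuine representation.\<close>

lemma uq2_pi_rep:
  assumes "0 < cmod q" "cmod q < 1"
  shows "(pi_a q, pi_b q, pi_D q) \<in> uq2_reps q"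
proof -
  note co = coord_pi_a[OF assms(2)] coord_pi_b[OF assms(2)] coord_pi_D
    plus_ell2.rep_eq scaleC_ell2.rep_eq
  have eqI: "A = B" if "\<And>x i j k. coord (A x) (i, j, k) = coord (B x) (i, j, k)" for A B :: hop
    using that by (intro ext ell2_eqI) (metis prod_cases3)
  have qq: "q * cnj q = complex_of_real ((cmod q)\<^sup>2)" by (rule complex_norm_square[symmetric])
  have qi: "q ^ i * cnj q ^ i = complex_of_real (cmod q ^ (2 * i))" for i
    by (metis qq power_mult_distrib of_real_power power_mult)
  have qi': "q ^ i * (cnj q ^ i * z) = complex_of_real (cmod q ^ (2 * i)) * z" for i z
    unfolding mult.assoc[symmetric] qi ..
  have sq: "complex_of_real (sqrt (1 - cmod q ^ m)) * (complex_of_real (sqrt (1 - cmod q ^ m)) * z)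
     = (1 - complex_of_real (cmod q ^ m)) * z" for m z
    using assms by (simp add: power_le_one flip: of_real_mult mult.assoc)
  have th: "q\<^sup>2 / complex_of_real ((cmod q)\<^sup>2) = cis (2 * pi * uq2_theta q)"
  proof -
    have "q = of_real (cmod q) * cis (Arg q)" by (metis rcis_cmod_Arg rcis_def)
    then have "q\<^sup>2 = of_real ((cmod q)\<^sup>2) * cis (2 * Arg q)"
      by (metis Complex.DeMoivre of_nat_numeral of_real_power power_mult_distrib)
    then show ?thesis using assms by (simp add: uq2_theta_def)
  qed
  have "uq2_relations q (pi_a q) (pi_b q) (pi_D q)"
    unfolding uq2_relations_def th
  proof (intro conjI eqI)
    fix x i j k
    show "coord ((pi_b q \<circ> pi_a q) x) (i, j, k) = coord ((q *\<^sub>C (pi_a q \<circ> pi_b q)) x) (i, j, k)"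
      by (cases i) (simp_all add: co scaleC_fun_def)
    show "coord ((adj (pi_a q) \<circ> pi_b q) x) (i, j, k) = coord ((q *\<^sub>C (pi_b q \<circ> adj (pi_a q))) x) (i, j, k)"
      by (simp add: co scaleC_fun_def)
    show "coord ((pi_b q \<circ> adj (pi_b q)) x) (i, j, k) = coord ((adj (pi_b q) \<circ> pi_b q) x) (i, j, k)"
      by (simp add: co)
    show "coord (((pi_a q \<circ> adj (pi_a q)) + (pi_b q \<circ> adj (pi_b q))) x) (i, j, k) = coord (id x) (i, j, k)"
    proof -
      have l: "coord (((pi_a q \<circ> adj (pi_a q)) + (pi_b q \<circ> adj (pi_b q))) x) (i, j, k) =
         (if i = 0 then 0 else of_real (sqrt (1 - cmod q ^ (2 * i))) *
           (of_real (sqrt (1 - cmod q ^ (2 * (i - 1) + 2))) * coord x (i - 1 + 1, j, k))) +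
         q ^ i * (cnj q ^ i * coord x (i, j - 1 + 1, k))"
        by (simp only: plus_fun_apply o_apply co)
      have i: "2 * (i - 1) + 2 = 2 * i" "i - 1 + 1 = i" if "i \<noteq> 0" using that by simp_all
      show ?thesis
      proof (cases "i = 0")
        case True then show ?thesis unfolding l by simp
      next
        case False
        show ?thesis
          unfolding l i[OF False] sq qi' using False by (simp add: ring_distribs)
      qed
    qed
    show "coord ((pi_a q \<circ> pi_D q) x) (i, j, k) = coord ((pi_D q \<circ> pi_a q) x) (i, j, k)"
      by (simp add: co)
    show "coord ((pi_b q \<circ> pi_D q) x) (i, j, k) =
        coord ((cis (2 * pi * uq2_theta q) *\<^sub>C (pi_D q \<circ> pi_b q)) x) (i, j, k)"
    proof -
      have "cis (- 2 * pi * uq2_theta q * (j - 1)) =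
          cis (2 * pi * uq2_theta q) * cis (- 2 * pi * uq2_theta q * j)"
        by (simp add: cis_mult algebra_simps)
      then show ?thesis by (simp add: co scaleC_fun_def)
    qed
    show "coord ((pi_D q \<circ> adj (pi_D q)) x) (i, j, k) = coord (id x) (i, j, k)"
      by (simp add: co cis_mult flip: mult.assoc)
    show "coord ((adj (pi_D q) \<circ> pi_D q) x) (i, j, k) = coord (id x) (i, j, k)"
      by (simp add: co cis_mult flip: mult.assoc)
    show "coord (((adj (pi_a q) \<circ> pi_a q) + complex_of_real ((cmod q)\<^sup>2) *\<^sub>C (adj (pi_b q) \<circ> pi_b q)) x) (i, j, k)
        = coord (id x) (i, j, k)"
    proof -
      have l: "coord (((adj (pi_a q) \<circ> pi_a q) + complex_of_real ((cmod q)\<^sup>2) *\<^sub>C (adj (pi_b q) \<circ> pi_b q)) x) (i, j, k) =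
         of_real (sqrt (1 - cmod q ^ (2 * i + 2))) *
           (of_real (sqrt (1 - cmod q ^ (2 * (i + 1)))) * coord x (i, j, k)) +
         complex_of_real ((cmod q)\<^sup>2) * (q ^ i * (cnj q ^ i * coord x (i, j, k)))"
        by (simp add: scaleC_fun_def co mult_ac del: mult_Suc_right)
      have i: "2 * (i + 1) = 2 * i + 2" by simp
      show ?thesis
        unfolding l i sq qi' by (simp add: algebra_simps power_add power2_eq_square)
    qed
  qed
  then show ?thesis by (simp add: uq2_reps_def co(3,6,9))
qed

lemma diagonal_graph_ket: "(ket m, d m *\<^sub>C ket m) \<in> diagonal_graph d"
  by (auto simp: diagonal_graph_def scaleC_ell2.rep_eq coord_ket)

lemma graph_adjoint_diagonal: "graph_adjoint (diagonal_graph d) = diagonal_graph (\<lambda>m. cnj (d m))"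
proof (intro equalityI subsetI; clarify)
  fix y z assume yz: "(y, z) \<in> graph_adjoint (diagonal_graph d)"
  have "cinner (d m *\<^sub>C ket m) y = cinner (ket m) z" for m
    using yz diagonal_graph_ket[of m d] by (auto simp: graph_adjoint_def)
  moreover have "cinner (d m *\<^sub>C ket m) y = cnj (d m) * coord y m" for m
    by (metis cinner_commute cinner_scaleC_right cinner_ket complex_cnj_cnj complex_cnj_mult)
  ultimately show "(y, z) \<in> diagonal_graph (\<lambda>m. cnj (d m))"
    by (simp add: diagonal_graph_def cinner_ket)
next
  fix y z assume a: "(y, z) \<in> diagonal_graph (\<lambda>m. cnj (d m))"
  have "cinner w y = cinner x z" if "(x, w) \<in> diagonal_graph d" for x w
    using a that unfolding cinner_ell2_def diagonal_graph_def by (auto intro!: infsum_cong)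
  then show "(y, z) \<in> graph_adjoint (diagonal_graph d)"
    by (auto simp: graph_adjoint_def)
qed

text \<open>Since self-adjoint graphs are linear, it suffices to prescribe the values on the basis.\<close>

lemma dirac_unique_selfadjoint_extension:
  fixes d :: "idx \<Rightarrow> complex"
  defines "G\<^sub>0 \<equiv> {((ket m, 0), (0, d m *\<^sub>C ket m)) |m. True} \<union> {((0, ket m), (cnj (d m) *\<^sub>C ket m, 0)) |m. True}"
  shows "selfadjoint (dirac d) \<and> G\<^sub>0 \<subseteq> dirac d \<and> (\<forall>G. selfadjoint G \<and> G\<^sub>0 \<subseteq> G \<longrightarrow> G = dirac d)"
proof -
  have dd: "dirac d = {((x1, x2), (y1, y2)). \<forall>m. coord y1 m = cnj (d m) * coord x2 m \<and> coord y2 m = d m * coord x1 m}"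
    unfolding dirac_def graph_adjoint_diagonal by (auto simp: diagonal_graph_def)
  have c1: "cinner (c *\<^sub>C ket m) y = cnj c * coord y m" for c m and y :: hilb
    by (metis cinner_commute cinner_scaleC_right cinner_ket complex_cnj_cnj complex_cnj_mult)
  have z: "cinner (0::hilb) y = 0" for y by (simp add: cinner_ell2_def zero_ell2.rep_eq)
  have G0: "G\<^sub>0 \<subseteq> dirac d"
    by (auto simp: G\<^sub>0_def dd scaleC_ell2.rep_eq coord_ket zero_ell2.rep_eq)
  have sub: "graph_adjoint G \<subseteq> dirac d" if "G\<^sub>0 \<subseteq> G" for G
  proof clarify
    fix y1 y2 z1 z2 assume a: "((y1, y2), (z1, z2)) \<in> graph_adjoint G"
    have "cinner (0, d m *\<^sub>C ket m) (y1, y2) = cinner (ket m, 0) (z1, z2)"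
      "cinner (cnj (d m) *\<^sub>C ket m, 0) (y1, y2) = cinner (0, ket m) (z1, z2)" for m
      using a that unfolding G\<^sub>0_def graph_adjoint_def by blast+
    then show "((y1, y2), (z1, z2)) \<in> dirac d"
      by (simp add: dd cinner_prod_def c1 z cinner_ket)
  qed
  have sym: "dirac d \<subseteq> graph_adjoint (dirac d)"
  proof clarify
    fix x1 x2 y1 y2 assume x: "((x1, x2), (y1, y2)) \<in> dirac d"
    have "cinner (w1, w2) (x1, x2) = cinner (z1, z2) (y1, y2)"
      if z: "((z1, z2), (w1, w2)) \<in> dirac d" for z1 z2 w1 w2
    proof -
      have "cinner w1 x1 = cinner z2 y2" "cinner w2 x2 = cinner z1 y1"
        using x z unfolding dd cinner_ell2_def by (auto intro!: infsum_cong)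
      then show ?thesis by (simp add: cinner_prod_def)
    qed
    then show "((x1, x2), (y1, y2)) \<in> graph_adjoint (dirac d)"
      by (auto simp: graph_adjoint_def)
  qed
  have "single_valued (dirac d)"
    by (auto simp: single_valued_def dd intro!: ell2_eqI)
  then have sa: "selfadjoint (dirac d)"
    unfolding selfadjoint_def using sub[OF G0] sym by auto
  have mono: "graph_adjoint H \<subseteq> graph_adjoint G" if "G \<subseteq> H" for G H :: "((hilb \<times> hilb) \<times> (hilb \<times> hilb)) set"
    using that by (auto simp: graph_adjoint_def)
  show ?thesis
    using sa G0 sub mono unfolding selfadjoint_def by (metis subset_antisym)
qed

lemma ell2_summable_scaled:
  assumes "\<And>i. cmod (g i) \<le> cmod (coord x i)"
  shows "coord (Abs_ell2 g) = g"
proof -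
  have "(\<lambda>i. (cmod (g i))\<^sup>2) summable_on UNIV"
    by (rule summable_on_comparison_test[OF coord_summable[of x]]) (auto intro: power_mono assms)
  then show ?thesis by (simp add: Abs_ell2_inverse)
qed

lemma dirac_eq: "dirac d = {((x1, x2), (y1, y2)). \<forall>m. coord y1 m = cnj (d m) * coord x2 m \<and> coord y2 m = d m * coord x1 m}"
  unfolding dirac_def graph_adjoint_diagonal by (auto simp: diagonal_graph_def)

lemma graph_abs_dirac:
  assumes nz: "\<And>m. d m \<noteq> 0"
  shows "graph_abs (dirac d) = {((x1, x2), (y1, y2)).
     (\<forall>m. coord y1 m = cmod (d m) * coord x1 m) \<and> (\<forall>m. coord y2 m = cmod (d m) * coord x2 m)}" (is "_ = ?M")
  unfolding graph_abs_def
proof (rule the_equality)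
  have adj: "graph_adjoint (dirac d) = dirac d"
    using dirac_unique_selfadjoint_extension[of d] by (simp add: selfadjoint_def)
  have c1: "cinner (c *\<^sub>C ket m) y = cnj c * coord y m" for c m and y :: hilb
    by (metis cinner_commute cinner_scaleC_right cinner_ket complex_cnj_cnj complex_cnj_mult)
  have z: "cinner (0::hilb) y = 0" for y by (simp add: cinner_ell2_def zero_ell2.rep_eq)
  have k: "((ket m, 0), (complex_of_real (cmod (d m)) *\<^sub>C ket m, 0)) \<in> ?M"
    "((0, ket m), (0, complex_of_real (cmod (d m)) *\<^sub>C ket m)) \<in> ?M" for m
    by (auto simp: scaleC_ell2.rep_eq coord_ket zero_ell2.rep_eq)
  have sub: "graph_adjoint G \<subseteq> ?M"
    if G: "\<And>m. ((ket m, 0), (complex_of_real (cmod (d m)) *\<^sub>C ket m, 0)) \<in> G"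
    "\<And>m. ((0, ket m), (0, complex_of_real (cmod (d m)) *\<^sub>C ket m)) \<in> G" for G
  proof clarify
    fix y1 y2 z1 z2 assume a: "((y1, y2), (z1, z2)) \<in> graph_adjoint G"
    have "cinner (complex_of_real (cmod (d m)) *\<^sub>C ket m, 0) (y1, y2) = cinner (ket m, 0) (z1, z2)"
      "cinner (0, complex_of_real (cmod (d m)) *\<^sub>C ket m) (y1, y2) = cinner (0, ket m) (z1, z2)" for m
      using a G[of m] unfolding graph_adjoint_def by blast+
    then show "(\<forall>m. coord z1 m = cmod (d m) * coord y1 m) \<and> (\<forall>m. coord z2 m = cmod (d m) * coord y2 m)"
      by (simp add: cinner_prod_def c1 z cinner_ket)
  qed
  have sym: "?M \<subseteq> graph_adjoint ?M"
  proof clarify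
    fix x1 x2 y1 y2 :: hilb
    assume x: "\<forall>m. coord y1 m = cmod (d m) * coord x1 m" "\<forall>m. coord y2 m = cmod (d m) * coord x2 m"
    have "cinner (w1, w2) (x1, x2) = cinner (z1, z2) (y1, y2)"
      if z: "\<forall>m. coord w1 m = cmod (d m) * coord z1 m" "\<forall>m. coord w2 m = cmod (d m) * coord z2 m" for z1 z2 w1 w2
    proof -
      have "cinner w1 x1 = cinner z1 y1" "cinner w2 x2 = cinner z2 y2"
        using x z unfolding cinner_ell2_def by (auto intro!: infsum_cong)
      then show ?thesis by (simp add: cinner_prod_def)
    qed
    then show "((x1, x2), (y1, y2)) \<in> graph_adjoint ?M"
      by (auto simp: graph_adjoint_def)
  qed
  have sv: "single_valued ?M" by (auto simp: single_valued_def intro!: ell2_eqI)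
  have pos1: "0 \<le> Re (cinner x y)" if "\<forall>m. coord y m = cmod (d m) * coord x m" for x y :: hilb
  proof -
    have "0 \<le> Re (cnj (coord x m) * coord y m)" for m
    proof -
      have "cnj (coord x m) * coord x m = complex_of_real ((cmod (coord x m))\<^sup>2)"
        by (metis complex_norm_square mult.commute)
      then have "cnj (coord x m) * coord y m = complex_of_real (cmod (d m) * (cmod (coord x m))\<^sup>2)"
        using that by (metis mult.left_commute of_real_mult)
      then show ?thesis by simp
    qed
    then show ?thesis
      unfolding cinner_ell2_def by (subst infsum_Re[OF coord_mult_summable, symmetric]) (rule infsum_nonneg)
  qed
  have sq: "?M O ?M = dirac d O graph_adjoint (dirac d)"
  proof (rule set_eqI, clarify)
    fix x1 x2 z1 z2 :: hilb
    have "of_real (cmod (d m)) * (of_real (cmod (d m)) * u) = (d m * cnj (d m)) * u" for m u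
      unfolding complex_norm_square[symmetric] by (simp add: power2_eq_square)
    note h = this
    have cc: "cnj (d m) * (d m * u) = of_real (cmod (d m)) * (of_real (cmod (d m)) * u)"
      "d m * (cnj (d m) * u) = of_real (cmod (d m)) * (of_real (cmod (d m)) * u)" for m u
      unfolding h by (simp_all only: mult_ac)
    show "((x1, x2), (z1, z2)) \<in> ?M O ?M \<longleftrightarrow> ((x1, x2), (z1, z2)) \<in> dirac d O graph_adjoint (dirac d)"
    proof
      assume "((x1, x2), (z1, z2)) \<in> ?M O ?M"
      then obtain y1 y2 where y: "\<forall>m. coord y1 m = cmod (d m) * coord x1 m" "\<forall>m. coord y2 m = cmod (d m) * coord x2 m"
        "\<forall>m. coord z1 m = cmod (d m) * coord y1 m" "\<forall>m. coord z2 m = cmod (d m) * coord y2 m"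
        by auto
      define u1 where "u1 = Abs_ell2 (\<lambda>m. cnj (d m) * coord x2 m)"
      define u2 where "u2 = Abs_ell2 (\<lambda>m. d m * coord x1 m)"
      have u: "coord u1 = (\<lambda>m. cnj (d m) * coord x2 m)" "coord u2 = (\<lambda>m. d m * coord x1 m)"
        unfolding u1_def u2_def
        by (rule ell2_summable_scaled[of _ y2]; simp add: y norm_mult)
           (rule ell2_summable_scaled[of _ y1]; simp add: y norm_mult)
      have "((x1, x2), (u1, u2)) \<in> dirac d" "((u1, u2), (z1, z2)) \<in> dirac d"
        unfolding dirac_eq by (simp_all add: u y cc)
      then show "((x1, x2), (z1, z2)) \<in> dirac d O graph_adjoint (dirac d)" unfolding adj by blast
    next
      assume "((x1, x2), (z1, z2)) \<in> dirac d O graph_adjoint (dirac d)"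
      then obtain y1 y2 where y: "\<forall>m. coord y1 m = cnj (d m) * coord x2 m" "\<forall>m. coord y2 m = d m * coord x1 m"
        "\<forall>m. coord z1 m = cnj (d m) * coord y2 m" "\<forall>m. coord z2 m = d m * coord y1 m"
        unfolding adj unfolding dirac_eq all_conj_distrib by (auto simp del: split_paired_All)
      define u1 where "u1 = Abs_ell2 (\<lambda>m. of_real (cmod (d m)) * coord x1 m)"
      define u2 where "u2 = Abs_ell2 (\<lambda>m. of_real (cmod (d m)) * coord x2 m)"
      have u: "coord u1 = (\<lambda>m. of_real (cmod (d m)) * coord x1 m)" "coord u2 = (\<lambda>m. of_real (cmod (d m)) * coord x2 m)"
        unfolding u1_def u2_def
        by (rule ell2_summable_scaled[of _ y2]; simp add: y norm_mult)
           (rule ell2_summable_scaled[of _ y1]; simp add: y norm_mult)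
      have "((x1, x2), (u1, u2)) \<in> ?M" "((u1, u2), (z1, z2)) \<in> ?M"
        by (simp_all add: u y cc)
      then show "((x1, x2), (z1, z2)) \<in> ?M O ?M" by blast
    qed
  qed
  have MM: "graph_adjoint ?M = ?M" using sub[OF k] sym by auto
  show "selfadjoint ?M \<and> (\<forall>(x, y)\<in>?M. 0 \<le> Re (cinner x y)) \<and> ?M O ?M = dirac d O graph_adjoint (dirac d)"
    using MM sv sq pos1 by (auto simp: selfadjoint_def cinner_prod_def)
  fix A assume A: "selfadjoint A \<and> (\<forall>(x, y)\<in>A. 0 \<le> Re (cinner x y)) \<and> A O A = dirac d O graph_adjoint (dirac d)"
  then have AM: "A O A = ?M O ?M" and Aadj: "graph_adjoint A = A"
    and pos: "\<And>x y. (x, y) \<in> A \<Longrightarrow> 0 \<le> Re (cinner x y)" using sq by (auto simp: selfadjoint_def)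
  have eig: "(v, \<mu> *\<^sub>R v) \<in> A" if "0 < \<mu>" "(v, \<mu> *\<^sub>R v) \<in> ?M" "(\<mu> *\<^sub>R v, \<mu> *\<^sub>R \<mu> *\<^sub>R v) \<in> ?M" for v \<mu>
  proof -
    have "(v, \<mu> *\<^sub>R \<mu> *\<^sub>R v) \<in> A O A" unfolding AM by (rule relcompI[OF that(2,3)])
    then obtain u where u: "(v, u) \<in> A" "(u, \<mu> *\<^sub>R \<mu> *\<^sub>R v) \<in> A" by (rule relcompE) auto
    have "cinner w (u - \<mu> *\<^sub>R v) = cinner x (\<mu> *\<^sub>R \<mu> *\<^sub>R v - \<mu> *\<^sub>R u)" if "(x, w) \<in> A" for x w
    proof -
      have d: "cinner p (r - \<mu> *\<^sub>R s) = cinner p r - \<mu> * cinner p s" for p r s :: "hilb \<times> hilb"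
      proof -
        have "cinner p ((r - \<mu> *\<^sub>R s) + \<mu> *\<^sub>R s) = cinner p (r - \<mu> *\<^sub>R s) + \<mu> * cinner p s"
          by (simp only: cinner_add_right scaleR_scaleC cinner_scaleC_right)
        then show ?thesis by simp
      qed
      have "(v, u) \<in> graph_adjoint A" "(u, \<mu> *\<^sub>R \<mu> *\<^sub>R v) \<in> graph_adjoint A" using u Aadj by auto
      then have "cinner w v = cinner x u" "cinner w u = cinner x (\<mu> *\<^sub>R \<mu> *\<^sub>R v)"
        using that by (auto simp: graph_adjoint_def)
      then show ?thesis unfolding d by simp
    qed
    then have "(u - \<mu> *\<^sub>R v, \<mu> *\<^sub>R \<mu> *\<^sub>R v - \<mu> *\<^sub>R u) \<in> graph_adjoint A" by (auto simp: graph_adjoint_def)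
    then have "(u - \<mu> *\<^sub>R v, - (\<mu> *\<^sub>R (u - \<mu> *\<^sub>R v))) \<in> A" unfolding Aadj by (simp add: scaleR_diff_right)
    from pos[OF this] have "0 \<le> - (\<mu> * inner (u - \<mu> *\<^sub>R v) (u - \<mu> *\<^sub>R v))"
      by (simp only: Re_cinner inner_minus_right inner_scaleR_right)
    then have "inner (u - \<mu> *\<^sub>R v) (u - \<mu> *\<^sub>R v) \<le> 0" using \<open>0 < \<mu>\<close> by (simp add: mult_le_0_iff)
    then have "u - \<mu> *\<^sub>R v = 0" by (metis inner_eq_zero_iff inner_ge_zero order_antisym)
    then have "u = \<mu> *\<^sub>R v" by simp
    then show ?thesis using u by simp
  qed
  have kA: "((ket m, 0), (complex_of_real (cmod (d m)) *\<^sub>C ket m, 0)) \<in> A"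
    "((0, ket m), (0, complex_of_real (cmod (d m)) *\<^sub>C ket m)) \<in> A" for m
    using eig[of "cmod (d m)" "(ket m, 0)"] eig[of "cmod (d m)" "(0, ket m)"] nz[of m]
    by (simp_all add: scaleR_prod_def scaleR_scaleC scaleC_ell2.rep_eq coord_ket zero_ell2.rep_eq)
  have "A \<subseteq> ?M" using sub[OF kA] Aadj by simp
  moreover have "graph_adjoint ?M \<subseteq> graph_adjoint A" using \<open>A \<subseteq> ?M\<close> by (auto simp: graph_adjoint_def)
  ultimately show "A = ?M" using MM Aadj by blast
qed

lemma uq2_d_ge1: "1 \<le> cmod ((uq2_d((0, 0, 0) := 1)) m)"
proof -
  obtain i j k where m: "m = (i, j, k)" by (cases m)
  show ?thesis
  proof (cases "m = (0, 0, 0)")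
    case False
    define a :: int where "a = (if j \<ge> 0 then int i + j else - int i + j)"
    have d: "uq2_d m = Complex (of_int a) (of_int k)"
      by (simp add: m uq2_d_def a_def complex_eq_iff)
    have "a \<noteq> 0 \<or> k \<noteq> 0" using False by (auto simp: m a_def split: if_splits)
    then have "1 \<le> \<bar>real_of_int a\<bar> \<or> 1 \<le> \<bar>real_of_int k\<bar>" by linarith
    then have "1 \<le> cmod (Complex (of_int a) (of_int k))"
      using abs_Re_le_cmod[of "Complex (of_int a) (of_int k)"] abs_Im_le_cmod[of "Complex (of_int a) (of_int k)"]
      by (smt (verit) complex.sel)
    then show ?thesis using False d by simp
  qed (simp add: m)
qed

lemma coord_uq2_F:
  fixes x\<^sub>1 x\<^sub>2 :: hilb
  defines "d \<equiv> uq2_d((0, 0, 0) := 1)"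
  shows "coord (fst (uq2_F (x\<^sub>1, x\<^sub>2))) m = cnj (sgn (d m)) * coord x\<^sub>2 m"
    and "coord (snd (uq2_F (x\<^sub>1, x\<^sub>2))) m = sgn (d m) * coord x\<^sub>1 m"
proof -
  have ge: "1 \<le> cmod (d m)" for m unfolding d_def by (rule uq2_d_ge1)
  then have nz: "d m \<noteq> 0" for m by (metis norm_zero not_one_le_zero)
  define y1 where "y1 = Abs_ell2 (\<lambda>m. cnj (sgn (d m)) * coord x\<^sub>2 m)"
  define y2 where "y2 = Abs_ell2 (\<lambda>m. sgn (d m) * coord x\<^sub>1 m)"
  define u1 where "u1 = Abs_ell2 (\<lambda>m. coord x\<^sub>1 m / of_real (cmod (d m)))"
  define u2 where "u2 = Abs_ell2 (\<lambda>m. coord x\<^sub>2 m / of_real (cmod (d m)))"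
  have y1: "coord y1 = (\<lambda>m. cnj (sgn (d m)) * coord x\<^sub>2 m)"
    unfolding y1_def by (rule ell2_summable_scaled[of _ x\<^sub>2]) (simp add: norm_mult norm_sgn nz)
  have y2: "coord y2 = (\<lambda>m. sgn (d m) * coord x\<^sub>1 m)"
    unfolding y2_def by (rule ell2_summable_scaled[of _ x\<^sub>1]) (simp add: norm_mult norm_sgn nz)
  have le: "r / cmod (d m) \<le> r" if "0 \<le> r" for r m
    using that ge[of m] by (simp add: divide_le_eq mult_left_le mult_le_cancel_left1 nz)
  have u1: "coord u1 = (\<lambda>m. coord x\<^sub>1 m / of_real (cmod (d m)))"
    unfolding u1_def by (rule ell2_summable_scaled[of _ x\<^sub>1]) (simp add: norm_divide le)
  have u2: "coord u2 = (\<lambda>m. coord x\<^sub>2 m / of_real (cmod (d m)))"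
    unfolding u2_def by (rule ell2_summable_scaled[of _ x\<^sub>2]) (simp add: norm_divide le)
  have "uq2_F (x\<^sub>1, x\<^sub>2) = (y1, y2)"
    unfolding uq2_F_def graph_phase_def d_def[symmetric] graph_abs_dirac[of d, OF nz]
  proof (rule the_equality)
    have "((u1, u2), (x\<^sub>1, x\<^sub>2)) \<in> {((x1, x2), (y1, y2)).
     (\<forall>m. coord y1 m = cmod (d m) * coord x1 m) \<and> (\<forall>m. coord y2 m = cmod (d m) * coord x2 m)}"
      by (simp add: u1 u2 nz)
    moreover have "((u1, u2), (y1, y2)) \<in> dirac d"
      unfolding dirac_eq by (simp add: u1 u2 y1 y2 sgn_eq)
    ultimately show "((x\<^sub>1, x\<^sub>2), (y1, y2)) \<in> {((x1, x2), (y1, y2)).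
     (\<forall>m. coord y1 m = cmod (d m) * coord x1 m) \<and> (\<forall>m. coord y2 m = cmod (d m) * coord x2 m)}\<inverse> O dirac d"
      by blast
  next
    fix z assume "((x\<^sub>1, x\<^sub>2), z) \<in> {((x1, x2), (y1, y2)).
     (\<forall>m. coord y1 m = cmod (d m) * coord x1 m) \<and> (\<forall>m. coord y2 m = cmod (d m) * coord x2 m)}\<inverse> O dirac d"
    then obtain v1 v2 z1 z2 where z: "z = (z1, z2)" and
      e: "(\<forall>m. coord x\<^sub>1 m = cmod (d m) * coord v1 m) \<and> (\<forall>m. coord x\<^sub>2 m = cmod (d m) * coord v2 m)"
      and f: "((v1, v2), (z1, z2)) \<in> dirac d"
      by (cases z) (auto simp del: split_paired_All)
    have g: "\<forall>m. coord z1 m = cnj (d m) * coord v2 m \<and> coord z2 m = d m * coord v1 m"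
      using f unfolding dirac_eq by (simp del: split_paired_All)
    have "z1 = y1" "z2 = y2"
      using e g by (auto intro!: ell2_eqI simp: y1 y2 sgn_eq nz simp del: split_paired_All)
    then show "z = (y1, y2)" unfolding z by simp
  qed
  then show "coord (fst (uq2_F (x\<^sub>1, x\<^sub>2))) m = cnj (sgn (d m)) * coord x\<^sub>2 m"
    "coord (snd (uq2_F (x\<^sub>1, x\<^sub>2))) m = sgn (d m) * coord x\<^sub>1 m"
    by (simp_all add: y1 y2)
qed

end

theory Submission
  imports Defs "HOL-Probability.Probability"
begin

text \<open>
  Let \<open>p\<close> be the limit of \<open>(b b\<^sup>*)\<^sup>n\<close>, a projection with \<open>\<pi>(p)\<close> supported on \<open>i = 0\<close>. The unitaries \<open>b p\<close>
  and \<open>D\<^sup>m p\<close> generate a noncommutative torus whose parameter \<open>c\<^sup>2\<close> can be made positive and small by the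
  choice of \<open>m\<close>, since \<open>\<theta>\<close> is irrational. Its Gaussian element \<open>H\<close> (the Gabor frame operator of a
  Gaussian window) is almost idempotent: by Poisson summation, multiplication by \<open>H\<close> maps each translate
  \<open>H w\<close> to itself plus a small superposition of translates. Hence \<open>(1 - H)\<^sup>n H w\<close> tends to \<open>0\<close> geometrically,
  and \<open>P = 1 - lim (1 - H)\<^sup>n\<close> is a projection with \<open>P H w = H w\<close> for all complex \<open>w\<close>. As \<open>H w\<close> depends
  holomorphically on \<open>cnj w\<close>, differentiation shows that multiplication by the holomorphic coordinate
  \<open>z = c (j + \<i> k / m)\<close> preserves the range of \<open>P\<close>.

  Now \<open>F\<close> is multiplication by the phase \<open>u\<close> of \<open>j + \<i> k\<close>, and \<open>z = u f\<close> with \<open>Re f > 0\<close> off the origin. Up to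
  compact operators, \<open>P u P\<close> is \<open>z\<close> followed by the inverse of the accretive operator \<open>P (f + \<kappa>) P\<close>,
  so it is injective but not surjective: \<open>z\<close> vanishes at the origin, while \<open>P\<close> does not.
\<close>

section \<open>Bounded operators on \<open>\<ell>\<^sup>2\<close>\<close>

text \<open>\<open>C_uq2\<close> is a uniform closure over all representations, so spectral
  arguments in the single representation \<open>\<pi>\<close> cannot produce an element of it. Every
  limit needs a rate valid in all representations: \<open>|q|^(2n)\<close> for \<open>p\<close>,
  Gaussian coefficients for \<open>H\<close>, \<open>2^(-n)\<close> for \<open>P\<close>. The last
  rate exists because small \<open>c^2\<close> makes the adjoint lattice sparse: its nonzero points
  carry total weight at most \<open>1/2\<close>. That weight includes a factor
  \<open>1 + |y|\<close>, since commutators with unbounded functions grow linearly in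
  \<open>w\<close>; the same induction then bounds norms, commutators and diagonal coefficients.

  The sign of the torus parameter decides whether \<open>z\<close> or its conjugate preserves the
  range of \<open>P\<close>.

  The index is not computed. The kernel vanishes because \<open><u v, z v>\<close> is the sum of
  \<open>f |v|^2\<close>, whose real part is positive off the origin. Surjectivity would make the
  adjoint compression injective; the Fredholm alternative would then put every vector of the range
  of \<open>P\<close> into the image of \<open>z\<close>, although all vectors of that image vanish
  at the origin. A vector of the range supported at the origin alone is excluded because the
  diagonal coefficient of \<open>P\<close> there is at most \<open>1/4\<close>.\<close>

lemma sum_coord_sq_le: "finite F \<Longrightarrow> (\<Sum>i\<in>F. (cmod (coord x i))\<^sup>2) \<le> (norm x)\<^sup>2"
  unfolding norm_ell2_sq by (rule finite_sum_le_infsum[OF coord_summable]) auto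

lemma cmod_coord_le: "cmod (coord x i) \<le> norm x"
  using sum_coord_sq_le[of "{i}" x] by (simp add: power2_le_iff_abs_le)

lemma coord_simps [simp]:
  "coord 0 i = 0" "coord (x + y) i = coord x i + coord y i" "coord (x - y) i = coord x i - coord y i"
  "coord (- x) i = - coord x i" "coord (c *\<^sub>C x) i = c * coord x i" "coord (r *\<^sub>R x) i = of_real r * coord x i"
  by (simp_all add: zero_ell2.rep_eq plus_ell2.rep_eq minus_ell2.rep_eq uminus_ell2.rep_eq
      scaleC_ell2.rep_eq scaleR_ell2_def)

lemma bounded_linear_coord: "bounded_linear (\<lambda>x. coord x i)"
  by (rule bounded_linear_intro[where K = 1]) (auto simp: cmod_coord_le scaleR_conv_of_real)

text \<open>One bound on the finite partial sums certifies both that a family is square summable and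
  that its norm is at most \<open>B\<close>; operators given by coordinates are constructed this
  way.\<close>

lemma ell2_of_bound:
  assumes "\<And>F. finite F \<Longrightarrow> (\<Sum>i\<in>F. (cmod (f i))\<^sup>2) \<le> B\<^sup>2"
  shows "coord (Abs_ell2 f) = f" "0 \<le> B \<Longrightarrow> norm (Abs_ell2 f) \<le> B"
proof -
  have s: "(\<lambda>i. (cmod (f i))\<^sup>2) summable_on UNIV"
    by (rule nonneg_bdd_above_summable_on) (auto intro!: bdd_aboveI[of _ "B\<^sup>2"] assms)
  then show co: "coord (Abs_ell2 f) = f"
    by (simp add: Abs_ell2_inverse)
  have "(norm (Abs_ell2 f))\<^sup>2 \<le> B\<^sup>2"
    unfolding norm_ell2_sq co by (rule infsum_le_finite_sums[OF s]) (auto intro: assms)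
  then show "0 \<le> B \<Longrightarrow> norm (Abs_ell2 f) \<le> B"
    by (simp add: power2_le_iff_abs_le)
qed

instance ell2 :: (type) banach
proof
  fix X :: "nat \<Rightarrow> 'a ell2"
  assume X: "Cauchy X"
  define f where "f i = lim (\<lambda>n. coord (X n) i)" for i
  have f: "(\<lambda>n. coord (X n) i) \<longlonglongrightarrow> f i" for i
    using bounded_linear.Cauchy[OF bounded_linear_coord X, of i]
    by (simp add: f_def Cauchy_convergent_iff convergent_LIMSEQ_iff)
  have tail: "\<exists>N. \<forall>n\<ge>N. \<forall>F. finite F \<longrightarrow> (\<Sum>i\<in>F. (cmod (f i - coord (X n) i))\<^sup>2) \<le> e\<^sup>2" if "0 < e" for e
  proof -
    obtain N where N: "\<And>m n. m \<ge> N \<Longrightarrow> n \<ge> N \<Longrightarrow> norm (X m - X n) < e"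
      using X \<open>0 < e\<close> by (meson CauchyD)
    have "(\<Sum>i\<in>F. (cmod (f i - coord (X n) i))\<^sup>2) \<le> e\<^sup>2" if "n \<ge> N" "finite F" for n F
    proof (rule LIMSEQ_le_const2)
      show "(\<lambda>m. \<Sum>i\<in>F. (cmod (coord (X m) i - coord (X n) i))\<^sup>2)
          \<longlonglongrightarrow> (\<Sum>i\<in>F. (cmod (f i - coord (X n) i))\<^sup>2)"
        by (intro tendsto_intros f)
      have "(\<Sum>i\<in>F. (cmod (coord (X m) i - coord (X n) i))\<^sup>2) \<le> e\<^sup>2" if "m \<ge> N" for m
      proof -
        have "(\<Sum>i\<in>F. (cmod (coord (X m) i - coord (X n) i))\<^sup>2) \<le> (norm (X m - X n))\<^sup>2"
          using sum_coord_sq_le[OF \<open>finite F\<close>, of "X m - X n"] by simp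
        also have "\<dots> \<le> e\<^sup>2" using N[OF that \<open>n \<ge> N\<close>] by (intro power_mono) auto
        finally show ?thesis .
      qed
      then show "\<exists>N. \<forall>m\<ge>N. (\<Sum>i\<in>F. (cmod (coord (X m) i - coord (X n) i))\<^sup>2) \<le> e\<^sup>2" by blast
    qed
    then show ?thesis by blast
  qed
  obtain N where N: "\<And>n F. n \<ge> N \<Longrightarrow> finite F \<Longrightarrow> (\<Sum>i\<in>F. (cmod (f i - coord (X n) i))\<^sup>2) \<le> 1\<^sup>2"
    using tail[of 1] by auto
  \<comment> \<open>Only the differences from \<open>X N\<close> are known to be square summable, so
    the limit is built as a correction of \<open>X N\<close>.\<close>
  define y where "y = Abs_ell2 (\<lambda>i. f i - coord (X N) i) + X N"
  have y: "coord y i = f i" for i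
    using ell2_of_bound(1)[of "\<lambda>i. f i - coord (X N) i" 1] N[OF order.refl] by (simp add: y_def)
  have "\<exists>N. \<forall>n\<ge>N. dist (X n) y \<le> e" if "0 < e" for e
  proof -
    obtain N where N: "\<And>n F. n \<ge> N \<Longrightarrow> finite F \<Longrightarrow> (\<Sum>i\<in>F. (cmod (f i - coord (X n) i))\<^sup>2) \<le> e\<^sup>2"
      using tail[OF \<open>0 < e\<close>] by auto
    have "dist (X n) y \<le> e" if "n \<ge> N" for n
    proof -
      have "y - X n = Abs_ell2 (\<lambda>i. f i - coord (X n) i)"
        using ell2_of_bound(1)[of "\<lambda>i. f i - coord (X n) i" e] N[OF that]
        by (intro ell2_eqI) (simp add: y)
      then show ?thesis
        using ell2_of_bound(2)[of "\<lambda>i. f i - coord (X n) i" e] N[OF that] \<open>0 < e\<close>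
        by (simp add: dist_norm norm_minus_commute)
    qed
    then show ?thesis by blast
  qed
  then have "X \<longlonglongrightarrow> y"
    by (metis (no_types, opaque_lifting) metric_LIMSEQ_I dense le_less_trans)
  then show "convergent X" by (rule convergentI)
qed

lemma norm_ket [simp]: "norm (ket m) = 1"
  using cinner_ket[of m "ket m"] by (simp add: norm_ell2_def inner_ell2_def coord_ket)

lemma ket_neq_0 [simp]: "ket m \<noteq> 0"
  using norm_ket[of m] by (metis norm_zero zero_neq_one)

text \<open>Bounded real linear maps already carry a norm and completeness. Making the complex
  linear ones a type of their own yields a unital Banach algebra in the sense of the type classes,
  so that geometric series and \<open>has_sum\<close> apply to operators.\<close>

typedef 'i bop = "{A :: 'i ell2 \<Rightarrow>\<^sub>L 'i ell2. \<forall>c x. blinfun_apply A (c *\<^sub>C x) = c *\<^sub>C blinfun_apply A x}"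
  morphisms blin Abs_bop
  by (rule exI[of _ 0]) (auto intro: ell2_eqI)

setup_lifting type_definition_bop

definition app :: "'i bop \<Rightarrow> 'i ell2 \<Rightarrow> 'i ell2" where
  "app A = blinfun_apply (blin A)"

lemma bop_eqI: "(\<And>x. app A x = app B x) \<Longrightarrow> A = B"
  unfolding app_def by (metis blin_inject blinfun_eqI)

lemma app_scaleC [simp]: "app A (c *\<^sub>C x) = c *\<^sub>C app A x"
  unfolding app_def using blin[of A] by simp

lemma bounded_linear_app: "bounded_linear (app A)"
  unfolding app_def by (rule blinfun.bounded_linear_right)

lemma bounded_clinear_app: "bounded_clinear (app A)"
  by (simp add: bounded_clinear_def bounded_linear_app)

lemmas app_add [simp] = linear_add[OF bounded_linear.linear[OF bounded_linear_app]]
  and app_diff [simp] = linear_diff[OF bounded_linear.linear[OF bounded_linear_app]]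
  and app_minus [simp] = linear_neg[OF bounded_linear.linear[OF bounded_linear_app]]
  and app_0 [simp] = linear_0[OF bounded_linear.linear[OF bounded_linear_app]]
  and app_scaleR [simp] = linear_scale[OF bounded_linear.linear[OF bounded_linear_app]]

instantiation bop :: (type) real_normed_algebra_1
begin
lift_definition zero_bop :: "'a bop" is 0 by (auto intro: ell2_eqI)
lift_definition one_bop :: "'a bop" is id_blinfun by simp
lift_definition plus_bop :: "'a bop \<Rightarrow> 'a bop \<Rightarrow> 'a bop" is "(+)"
  by (simp add: plus_blinfun.rep_eq scaleC_add_right)
lift_definition minus_bop :: "'a bop \<Rightarrow> 'a bop \<Rightarrow> 'a bop" is "(-)"
  by (auto simp: minus_blinfun.rep_eq algebra_simps intro!: ell2_eqI)
lift_definition uminus_bop :: "'a bop \<Rightarrow> 'a bop" is "uminus"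
  by (auto simp: uminus_blinfun.rep_eq intro!: ell2_eqI)
lift_definition scaleR_bop :: "real \<Rightarrow> 'a bop \<Rightarrow> 'a bop" is "scaleR"
  by (auto simp: scaleR_blinfun.rep_eq intro!: ell2_eqI)
lift_definition times_bop :: "'a bop \<Rightarrow> 'a bop \<Rightarrow> 'a bop" is "blinfun_compose"
  by simp
lift_definition norm_bop :: "'a bop \<Rightarrow> real" is norm .
definition "sgn x = inverse (norm x) *\<^sub>R x" for x :: "'a bop"
definition "dist x y = norm (x - y)" for x y :: "'a bop"
definition "uniformity = (INF e\<in>{0<..}. principal {(x :: 'a bop, y). dist x y < e})"
definition "open U \<longleftrightarrow> (\<forall>x\<in>U. \<forall>\<^sub>F (x', y) in uniformity. x' = x \<longrightarrow> y \<in> U)" for U :: "'a bop set"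

lemma app_simps [simp]:
  "app 0 x = 0" "app 1 x = x" "app (A + B) x = app A x + app B x" "app (A - B) x = app A x - app B x"
  "app (- A) x = - app A x" "app (r *\<^sub>R A) x = r *\<^sub>R app A x" "app (A * B) x = app A (app B x)"
  by (simp_all add: app_def zero_bop.rep_eq one_bop.rep_eq plus_bop.rep_eq minus_bop.rep_eq
      uminus_bop.rep_eq scaleR_bop.rep_eq times_bop.rep_eq blinfun.bilinear_simps)

instance
proof
  fix x y z :: "'a bop" and r s :: real and U :: "'a bop set"
  show "x + y + z = x + (y + z)" "x + y = y + x" "0 + x = x" "- x + x = 0" "x - y = x + - y"
    "x * y * z = x * (y * z)" "1 * x = x" "x * 1 = x" "(x + y) * z = x * z + y * z"
    "x * (y + z) = x * y + x * z"
    "r *\<^sub>R (x + y) = r *\<^sub>R x + r *\<^sub>R y" "(r + s) *\<^sub>R x = r *\<^sub>R x + s *\<^sub>R x"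
    "r *\<^sub>R s *\<^sub>R x = (r * s) *\<^sub>R x" "1 *\<^sub>R x = x"
    "r *\<^sub>R x * y = r *\<^sub>R (x * y)" "x * r *\<^sub>R y = r *\<^sub>R (x * y)"
    by (auto simp: algebra_simps intro!: bop_eqI)
  show "norm x = 0 \<longleftrightarrow> x = 0"
    by (simp add: norm_bop.rep_eq zero_bop.rep_eq flip: blin_inject)
  show "norm (x + y) \<le> norm x + norm y"
    by (simp add: norm_bop.rep_eq plus_bop.rep_eq norm_triangle_ineq)
  show "norm (r *\<^sub>R x) = \<bar>r\<bar> * norm x"
    by (simp add: norm_bop.rep_eq scaleR_bop.rep_eq)
  show "norm (x * y) \<le> norm x * norm y"
    by (simp add: norm_bop.rep_eq times_bop.rep_eq norm_blinfun_compose)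
  have "app 0 (ket undefined) \<noteq> app (1 :: 'a bop) (ket undefined)" by (metis app_simps(1,2) ket_neq_0)
  then show "(0 :: 'a bop) \<noteq> 1" by metis
  show "norm (1 :: 'a bop) = 1"
    unfolding norm_bop.rep_eq one_bop.rep_eq
    using norm_blinfun[of id_blinfun "ket undefined :: 'a ell2"]
    by (intro order_antisym norm_blinfun_bound) auto
qed (simp_all add: sgn_bop_def dist_bop_def uniformity_bop_def open_bop_def)
end

lemma norm_app: "norm (app A x) \<le> norm A * norm x"
  unfolding app_def norm_bop.rep_eq by (rule norm_blinfun)

lemma norm_bop_le: "0 \<le> b \<Longrightarrow> (\<And>x. norm (app A x) \<le> b * norm x) \<Longrightarrow> norm A \<le> b"
  unfolding app_def norm_bop.rep_eq by (rule norm_blinfun_bound)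

lemma bounded_bilinear_app: "bounded_bilinear app"
  by (rule bounded_bilinear.intro) (auto intro!: exI[of _ 1] norm_app)

lemma bounded_linear_app_left: "bounded_linear (\<lambda>A. app A x)"
  by (rule bounded_bilinear.bounded_linear_left[OF bounded_bilinear_app])

definition bop_of :: "('i ell2 \<Rightarrow> 'i ell2) \<Rightarrow> 'i bop" where
  "bop_of f = Abs_bop (Blinfun f)"

lemma app_bop_of: "bounded_clinear f \<Longrightarrow> app (bop_of f) = f"
  unfolding app_def bop_of_def
  by (subst Abs_bop_inverse) (auto simp: bounded_clinear_def bounded_linear_Blinfun_apply)

instance bop :: (type) banach
proof
  fix X :: "nat \<Rightarrow> 'a bop"
  assume X: "Cauchy X"
  have "Cauchy (\<lambda>n. blin (X n))"
    using X unfolding Cauchy_def dist_norm minus_bop.rep_eq[symmetric] norm_bop.rep_eq[symmetric] .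
  then obtain L where L: "(\<lambda>n. blin (X n)) \<longlonglongrightarrow> L"
    using Cauchy_convergent convergent_def by blast
  have ap: "(\<lambda>n. blinfun_apply (blin (X n)) x) \<longlonglongrightarrow> blinfun_apply L x" for x
    by (intro tendsto_intros L)
  have "blinfun_apply L (c *\<^sub>C x) = c *\<^sub>C blinfun_apply L x" for c x
  proof (rule ell2_eqI)
    fix i
    have "(\<lambda>n. coord (blinfun_apply (blin (X n)) (c *\<^sub>C x)) i) \<longlonglongrightarrow> coord (blinfun_apply L (c *\<^sub>C x)) i"
      by (rule bounded_linear.tendsto[OF bounded_linear_coord ap])
    moreover have "(\<lambda>n. coord (blinfun_apply (blin (X n)) (c *\<^sub>C x)) i) \<longlonglongrightarrow> coord (c *\<^sub>C blinfun_apply L x) i"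
    proof -
      have "coord (blinfun_apply (blin (X n)) (c *\<^sub>C x)) i = c * coord (blinfun_apply (blin (X n)) x) i" for n
        using blin[of "X n"] by simp
      then show ?thesis
        by (simp only: coord_simps)
          (intro tendsto_mult tendsto_const bounded_linear.tendsto[OF bounded_linear_coord ap])
    qed
    ultimately show "coord (blinfun_apply L (c *\<^sub>C x)) i = coord (c *\<^sub>C blinfun_apply L x) i"
      by (rule LIMSEQ_unique)
  qed
  then have "blin (Abs_bop L) = L" by (simp add: Abs_bop_inverse)
  then have "X \<longlonglongrightarrow> Abs_bop L"
    using L unfolding tendsto_iff dist_norm minus_bop.rep_eq[symmetric] norm_bop.rep_eq by (simp add: minus_bop.rep_eq)
  then show "convergent X" by (rule convergentI)
qed

subsection \<open>Adjoints\<close>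

lemma cinner_simps [simp]:
  fixes x y z :: "'a::complex_inner"
  shows "cinner (x + y) z = cinner x z + cinner y z" "cinner (c *\<^sub>C x) z = cnj c * cinner x z"
    "cinner x 0 = 0" "cinner 0 x = 0" "cinner x (- y) = - cinner x y" "cinner (- x) y = - cinner x y"
    "cinner x (y - z) = cinner x y - cinner x z" "cinner (x - y) z = cinner x z - cinner y z"
proof -
  show add: "cinner (x + y) z = cinner x z + cinner y z" for x y z :: 'a
    by (metis cinner_commute cinner_add_right complex_cnj_add)
  show "cinner (c *\<^sub>C x) z = cnj c * cinner x z"
    by (metis cinner_commute cinner_scaleC_right complex_cnj_mult)
  show 0: "cinner x 0 = 0" "cinner 0 x = 0" for x :: 'a
    using cinner_add_right[of x 0 0] add[of 0 0 x] by simp_all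
  show m: "cinner x (- y) = - cinner x y" "cinner (- x) y = - cinner x y" for x y :: 'a
    using cinner_add_right[of x y "- y"] add[of x "-x" y] by (simp_all add: 0 add_eq_0_iff)
  show "cinner x (y - z) = cinner x y - cinner x z" "cinner (x - y) z = cinner x z - cinner y z"
    using cinner_add_right[of x y "- z"] add[of x "- y" z] by (simp_all add: m)
qed
declare cinner_add_right [simp] cinner_scaleC_right [simp]

lemma cinner_self: "cinner x x = of_real ((norm x)\<^sup>2)"
proof (rule complex_eqI)
  have "cinner x x = cnj (cinner x x)" by (rule cinner_commute)
  then show "Im (cinner x x) = Im (of_real ((norm x)\<^sup>2))" by (simp add: complex_eq_iff)
qed (simp add: Re_cinner power2_norm_eq_inner)

lemma norm_scaleC [simp]: "norm (c *\<^sub>C x) = cmod c * norm (x :: 'a::complex_inner)"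
proof -
  have "complex_of_real ((norm (c *\<^sub>C x))\<^sup>2) = (c * cnj c) * complex_of_real ((norm x)\<^sup>2)"
    unfolding cinner_self[symmetric] by simp
  then have "complex_of_real ((norm (c *\<^sub>C x))\<^sup>2) = complex_of_real ((cmod c * norm x)\<^sup>2)"
    by (simp add: complex_norm_square[symmetric] power_mult_distrib)
  then show ?thesis
    by (metis mult_nonneg_nonneg norm_ge_zero of_real_eq_iff power2_eq_imp_eq)
qed

lemma cmod_cinner_le: "cmod (cinner x y) \<le> norm x * norm (y :: 'a::complex_inner)"
proof (cases "cinner x y = 0")
  case False
  define c where "c = cnj (sgn (cinner x y))"
  have "cinner x (c *\<^sub>C y) = of_real (cmod (cinner x y))"
    using False by (simp add: c_def sgn_eq complex_norm_square[symmetric] power2_eq_square field_simps)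
  then have "cmod (cinner x y) = inner x (c *\<^sub>C y)" by (metis Re_cinner Re_complex_of_real)
  also have "\<dots> \<le> norm x * norm (c *\<^sub>C y)" by (rule norm_cauchy_schwarz)
  finally show ?thesis using False by (simp add: c_def norm_sgn)
qed auto

lemma cinner_ext: "(\<And>x. cinner x y = cinner x z) \<Longrightarrow> y = (z :: 'a::complex_inner)"
  by (metis Re_cinner inner_eq_zero_iff inner_diff_right eq_iff_diff_eq_0)

lemma bounded_linear_cinner_right: "bounded_linear (\<lambda>y. cinner x (y :: 'a::complex_inner))"
  by (rule bounded_linear_intro[where K = "norm x"])
    (auto simp: scaleR_scaleC scaleR_conv_of_real intro: cmod_cinner_le[THEN order_trans])

lemma bounded_linear_cinner_left: "bounded_linear (\<lambda>y. cinner (y :: 'a::complex_inner) x)"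
  by (rule bounded_linear_intro[where K = "norm x"])
    (auto simp: scaleR_scaleC scaleR_conv_of_real cmod_cinner_le)

text \<open>A relation instead of a function: adjunctions between known operators pass through sums,
  products and limits without a prior proof that \<open>adj\<close> of the result is a bounded
  operator.\<close>

definition adjoint_pair :: "'i bop \<Rightarrow> 'i bop \<Rightarrow> bool" where
  "adjoint_pair A B \<longleftrightarrow> (\<forall>x y. cinner (app A x) y = cinner x (app B y))"

lemma adjoint_pairD: "adjoint_pair A B \<Longrightarrow> cinner (app A x) y = cinner x (app B y)"
  by (simp add: adjoint_pair_def)

lemma adjoint_pair_sym: "adjoint_pair A B \<Longrightarrow> adjoint_pair B A"
  unfolding adjoint_pair_def by (metis cinner_commute)

lemma adjoint_pair_unique: "adjoint_pair A B \<Longrightarrow> adjoint_pair A C \<Longrightarrow> B = C"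
  unfolding adjoint_pair_def by (metis bop_eqI cinner_ext)

lemma adjoint_pair_adj: "adjoint_pair A B \<Longrightarrow> adj (app A) = app B"
  by (rule adj_eqI) (simp add: adjoint_pair_def)

lemma adjoint_pair_norm_le:
  assumes "adjoint_pair A B" shows "norm B \<le> norm A"
proof (rule norm_bop_le)
  fix y
  have "complex_of_real ((norm (app B y))\<^sup>2) = cinner (app A (app B y)) y"
    using assms by (simp add: adjoint_pair_def cinner_self)
  then have "(norm (app B y))\<^sup>2 \<le> norm (app A (app B y)) * norm y"
    using cmod_cinner_le[of "app A (app B y)" y] by (metis norm_of_real abs_of_nonneg zero_le_power2)
  also have "\<dots> \<le> norm A * norm (app B y) * norm y"
    by (intro mult_right_mono norm_app) auto
  finally have "norm (app B y) * norm (app B y) \<le> (norm A * norm y) * norm (app B y)"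
    by (simp add: power2_eq_square mult_ac)
  then show "norm (app B y) \<le> norm A * norm y"
    by (cases "app B y = 0") auto
qed simp

text \<open>Riesz representation in coordinates: the adjoint must send \<open>y\<close> to the
  family \<open>g y\<close>. Testing \<open>A\<close> on the finite combination \<open>x\<close>
  with coefficients \<open>g y m\<close> gives \<open>norm x ^ 2 = <A x, y>\<close>, which is at
  most \<open>norm A * norm x * norm y\<close>; this bounds all partial sums of
  \<open>g y\<close>.\<close>

lemma adjoint_pair_exists: "\<exists>B. adjoint_pair (A :: 'i bop) B"
proof -
  define g where "g y = (\<lambda>m. cinner (app A (ket m)) y)" for y
  have bound: "(\<Sum>m\<in>F. (cmod (g y m))\<^sup>2) \<le> (norm A * norm y)\<^sup>2" if "finite F" for F y
  proof -
    define x where "x = (\<Sum>m\<in>F. g y m *\<^sub>C ket m)"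
    have co: "coord x i = (if i \<in> F then g y i else 0)" for i
    proof -
      have "coord x i = (\<Sum>m\<in>F. if m = i then g y i else 0)"
        unfolding x_def coord_sum by (intro sum.cong) (auto simp: coord_ket)
      then show ?thesis using that by simp
    qed
    let ?S = "\<Sum>m\<in>F. (cmod (g y m))\<^sup>2"
    have nx: "(norm x)\<^sup>2 = ?S"
    proof -
      have "(norm x)\<^sup>2 = (\<Sum>\<^sub>\<infinity>i\<in>F. (cmod (g y i))\<^sup>2)"
        unfolding norm_ell2_sq by (rule infsum_cong_neutral) (auto simp: co)
      then show ?thesis using that by simp
    qed
    have "cinner (app A x) y = (\<Sum>m\<in>F. cnj (g y m) * g y m)"
      unfolding x_def linear_sum[OF bounded_linear.linear[OF bounded_linear_app]]
        linear_sum[OF bounded_linear.linear[OF bounded_linear_cinner_left]]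
      by (simp add: g_def)
    also have "\<dots> = of_real ?S"
      unfolding of_real_sum by (intro sum.cong refl) (metis complex_norm_square mult.commute)
    finally have "cinner (app A x) y = of_real ?S" .
    then have "\<bar>?S\<bar> \<le> norm (app A x) * norm y" by (metis norm_of_real cmod_cinner_le)
    also have "\<dots> \<le> norm A * norm x * norm y" by (intro mult_right_mono norm_app) auto
    finally have "norm x * norm x \<le> (norm A * norm y) * norm x"
      using nx by (simp add: power2_eq_square mult_ac)
    then have "norm x \<le> norm A * norm y" by (cases "x = 0") auto
    then show ?thesis unfolding nx[symmetric] by (intro power_mono) auto
  qed
  define B where "B y = Abs_ell2 (g y)" for y
  have coB: "coord (B y) m = g y m" and nB: "norm (B y) \<le> norm A * norm y" for y m
    using ell2_of_bound[of "g y" "norm A * norm y"] bound by (auto simp: B_def)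
  have "bounded_linear B"
    by (rule bounded_linear_intro[where K = "norm A"])
      (auto intro!: ell2_eqI simp: coB g_def scaleR_scaleC nB[THEN order_trans] mult.commute)
  then have B: "bounded_clinear B"
    by (auto simp: bounded_clinear_def coB g_def intro!: ell2_eqI)
  have "cinner (app A x) y = cinner x (app (bop_of B) y)" for x y
  proof -
    \<comment> \<open>The two functionals to be compared are turned into operators into the line of
      one basis vector, so that \<open>bounded_clinear_ket_eqI\<close> applies.\<close>
    define f1 where "f1 x = cinner y (app A x) *\<^sub>C ket (undefined :: 'i)" for x
    define f2 where "f2 x = cinner (B y) x *\<^sub>C ket (undefined :: 'i)" for x
    have bl: "bounded_linear (\<lambda>x. c x *\<^sub>C ket (undefined :: 'i))" if "bounded_linear c" for c :: "'i ell2 \<Rightarrow> complex"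
    proof -
      interpret c: bounded_linear c by (rule that)
      obtain K where "\<And>x. norm (c x) \<le> norm x * K" using c.bounded by blast
      then show ?thesis
        by (intro bounded_linear_intro[where K = K])
          (auto simp: c.add c.scaleR scaleR_conv_of_real intro!: ell2_eqI algebra_simps)
    qed
    have "bounded_clinear f1" "bounded_clinear f2"
      unfolding bounded_clinear_def f1_def f2_def
      by (auto intro!: bl bounded_linear_compose[OF bounded_linear_cinner_right bounded_linear_app]
          bounded_linear_cinner_right simp: scaleC_scaleC)
    moreover have "f1 (ket m) = f2 (ket m)" for m
      unfolding f1_def f2_def using coB[of y m] cinner_ket[of m "B y"]
      by (metis cinner_commute g_def)
    ultimately have "f1 = f2" by (rule bounded_clinear_ket_eqI)
    then have "coord (f1 x) undefined = coord (f2 x) undefined" by simp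
    then have "cinner y (app A x) = cinner (B y) x" by (simp add: f1_def f2_def coord_ket)
    then show ?thesis unfolding app_bop_of[OF B] by (metis cinner_commute)
  qed
  then show ?thesis unfolding adjoint_pair_def by blast
qed

lemma adjoint_pair_adj_app: "adjoint_pair A (bop_of (adj (app A)))"
proof -
  obtain B where B: "adjoint_pair A B" using adjoint_pair_exists by blast
  have "bop_of (adj (app A)) = B"
    unfolding adjoint_pair_adj[OF B] by (rule bop_eqI) (simp add: app_bop_of bounded_clinear_app)
  then show ?thesis using B by simp
qed

lemma adjoint_pair_add: "adjoint_pair A B \<Longrightarrow> adjoint_pair C D \<Longrightarrow> adjoint_pair (A + C) (B + D)"
  by (simp add: adjoint_pair_def)

lemma adjoint_pair_diff: "adjoint_pair A B \<Longrightarrow> adjoint_pair C D \<Longrightarrow> adjoint_pair (A - C) (B - D)"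
  by (simp add: adjoint_pair_def)

lemma adjoint_pair_one: "adjoint_pair 1 1"
  by (simp add: adjoint_pair_def)

lemma adjoint_pair_mult: "adjoint_pair A B \<Longrightarrow> adjoint_pair C D \<Longrightarrow> adjoint_pair (A * C) (D * B)"
  by (simp add: adjoint_pair_def)

lemma adjoint_pair_power: "adjoint_pair A B \<Longrightarrow> adjoint_pair (A ^ n) (B ^ n)"
proof (induction n)
  case (Suc n)
  then have "adjoint_pair (A * A ^ n) (B ^ n * B)" by (intro adjoint_pair_mult)
  then show ?case by (simp add: power_commutes)
qed (simp add: adjoint_pair_one)

lemma adjoint_pair_tendsto:
  assumes "\<forall>\<^sub>F n in F. adjoint_pair (A n) (B n)" "(A \<longlongrightarrow> A') F" "(B \<longlongrightarrow> B') F" "F \<noteq> bot"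
  shows "adjoint_pair A' B'"
  unfolding adjoint_pair_def
proof (intro allI)
  fix x y
  have 1: "((\<lambda>n. cinner (app (A n) x) y) \<longlongrightarrow> cinner (app A' x) y) F"
    by (intro bounded_linear.tendsto[OF bounded_linear_cinner_left]
        bounded_linear.tendsto[OF bounded_linear_app_left] assms)
  have 2: "((\<lambda>n. cinner x (app (B n) y)) \<longlongrightarrow> cinner x (app B' y)) F"
    by (intro bounded_linear.tendsto[OF bounded_linear_cinner_right]
        bounded_linear.tendsto[OF bounded_linear_app_left] assms)
  have 3: "\<forall>\<^sub>F n in F. cinner (app (A n) x) y = cinner x (app (B n) y)"
    using assms(1) by eventually_elim (simp add: adjoint_pair_def)
  show "cinner (app A' x) y = cinner x (app B' y)"
    by (rule tendsto_unique[OF \<open>F \<noteq> bot\<close> Lim_transform_eventually[OF 1 3] 2])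
qed

subsection \<open>Scalars and multiplication operators\<close>

text \<open>To the type classes \<open>bop\<close> is a real algebra; complex scalars enter it as
  central elements.\<close>

definition scal :: "complex \<Rightarrow> 'i bop" where
  "scal c = bop_of (\<lambda>x. c *\<^sub>C x)"

lemma app_scal [simp]: "app (scal c) x = c *\<^sub>C x"
proof -
  have "bounded_linear (\<lambda>x :: 'a ell2. c *\<^sub>C x)"
    by (rule bounded_linear_intro[where K = "cmod c"]) (auto intro!: ell2_eqI simp: algebra_simps)
  then have "bounded_clinear (\<lambda>x :: 'a ell2. c *\<^sub>C x)"
    by (auto simp: bounded_clinear_def intro!: ell2_eqI)
  then show ?thesis by (simp add: scal_def app_bop_of)
qed

lemma scal_add: "scal (c + d) = scal c + scal d"
  and scal_diff: "scal (c - d) = scal c - scal d"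
  and scal_minus: "scal (- c) = - scal c"
  and scal_mult: "scal (c * d) = scal c * scal d"
  and scal_0 [simp]: "scal 0 = 0"
  and scal_1 [simp]: "scal 1 = 1"
  and scal_of_real: "scal (of_real r) = r *\<^sub>R 1"
  by (auto intro!: bop_eqI ell2_eqI simp: algebra_simps)

lemma scal_commute: "A * scal c = scal c * A"
  by (auto intro!: bop_eqI)

lemma norm_scal [simp]: "norm (scal c :: 'i bop) = cmod c"
proof (rule order_antisym)
  show "norm (scal c :: 'i bop) \<le> cmod c" by (rule norm_bop_le) auto
  show "cmod c \<le> norm (scal c :: 'i bop)"
    using norm_app[of "scal c" "ket undefined :: 'i ell2"] by simp
qed

lemma norm_scal_mult [simp]: "norm (scal c * A) = cmod c * norm A"
proof (rule order_antisym)
  show "norm (scal c * A) \<le> cmod c * norm A" using norm_mult_ineq[of "scal c" A] by simp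
  show "cmod c * norm A \<le> norm (scal c * A)"
  proof (cases "c = 0")
    case False
    have "norm (scal (1 / c) * (scal c * A)) \<le> norm (scal (1/c) :: 'a bop) * norm (scal c * A)"
      by (rule norm_mult_ineq)
    moreover have "scal (1 / c) * (scal c * A) = A"
      using False by (simp flip: scal_mult mult.assoc)
    ultimately show ?thesis using False by (simp add: norm_divide field_simps)
  qed auto
qed

lemma bounded_linear_scal: "bounded_linear (scal :: complex \<Rightarrow> 'i bop)"
  by (rule bounded_linear_intro[where K = 1]) (auto simp: scal_add scaleR_conv_of_real scal_mult scal_of_real)

lemma adjoint_pair_scal: "adjoint_pair (scal c) (scal (cnj c))"
  by (simp add: adjoint_pair_def)

definition mulop :: "('i \<Rightarrow> complex) \<Rightarrow> 'i bop" where
  "mulop f = bop_of (\<lambda>x. Abs_ell2 (\<lambda>i. f i * coord x i))"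

lemma
  assumes "\<And>i. cmod (f i) \<le> K"
  shows coord_mulop: "coord (app (mulop f) x) i = f i * coord x i"
    and norm_mulop_le: "norm (mulop f :: 'i bop) \<le> K"
proof -
  have K: "0 \<le> K" using assms[of undefined] norm_ge_zero order_trans by blast
  have b: "(\<Sum>i\<in>F. (cmod (f i * coord x i))\<^sup>2) \<le> (K * norm x)\<^sup>2" if "finite F" for x F
  proof -
    have "(\<Sum>i\<in>F. (cmod (f i * coord x i))\<^sup>2) \<le> (\<Sum>i\<in>F. K\<^sup>2 * (cmod (coord x i))\<^sup>2)"
      by (auto intro!: sum_mono mult_mono power_mono assms simp: norm_mult power_mult_distrib)
    also have "\<dots> \<le> K\<^sup>2 * (norm x)\<^sup>2"
      unfolding sum_distrib_left[symmetric] by (intro mult_left_mono sum_coord_sq_le that) auto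
    finally show ?thesis by (simp add: power_mult_distrib)
  qed
  note co = ell2_of_bound(1)[OF b] and no = ell2_of_bound(2)[OF b]
  have "bounded_clinear (\<lambda>x. Abs_ell2 (\<lambda>i. f i * coord x i))"
    unfolding bounded_clinear_def
  proof (intro conjI bounded_linear_intro[where K = K] allI)
    show "norm (Abs_ell2 (\<lambda>i. f i * coord x i)) \<le> norm x * K" for x
      using no[of x] K by (simp add: mult.commute)
  qed (rule ell2_eqI, simp only: co, simp add: co distrib_left mult.left_commute)+
  note ap = app_bop_of[OF this]
  show "coord (app (mulop f) x) i = f i * coord x i"
    by (simp add: mulop_def ap co)
  show "norm (mulop f :: 'i bop) \<le> K"
    by (rule norm_bop_le[OF K]) (simp add: mulop_def ap no K)
qed

section \<open>Codimension\<close>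

text \<open>Among the finite sets that span \<open>W\<close> modulo \<open>S\<close>, one of least
  cardinality is chosen. If a combination of its elements lay in \<open>S\<close> with a nonzero
  coefficient at \<open>c\<close>, then \<open>c\<close> could be dropped. This one fact
  (\<open>key\<close>) gives both independence and trivial intersection with
  \<open>S\<close>.\<close>

lemma has_codimI:
  assumes S: "complex_vector.subspace S" "S \<subseteq> W" and W: "complex_vector.subspace W"
    and B: "finite B" "B \<subseteq> W" "\<And>w. w \<in> W \<Longrightarrow> \<exists>x\<in>S. \<exists>y\<in>cspan B. w = x + y"
  shows "\<exists>m. has_codim S W m"
proof -
  define Q where "Q C \<longleftrightarrow> finite C \<and> C \<subseteq> W \<and> (\<forall>w\<in>W. \<exists>x\<in>S. \<exists>y\<in>cspan C. w = x + y)" for C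
  have "Q B" using B by (auto simp: Q_def)
  then obtain C where C: "Q C" and min: "\<And>C'. Q C' \<Longrightarrow> card C \<le> card C'"
    using ex_has_least_nat[of Q B card] by auto
  have fin: "finite C" and CW: "C \<subseteq> W" using C by (auto simp: Q_def)
  have key: "a c = 0" if sum: "(\<Sum>c\<in>C. a c *\<^sub>C c) \<in> S" and c: "c \<in> C" for a c
  proof (rule ccontr)
    assume nz: "a c \<noteq> 0"
    define s where "s = (\<Sum>c\<in>C. a c *\<^sub>C c)"
    define t where "t = (\<Sum>c\<in>C - {c}. a c *\<^sub>C c)"
    have t: "t \<in> cspan (C - {c})"
      unfolding t_def by (intro complex_vector.span_sum complex_vector.span_scale complex_vector.span_base)
    have "s = a c *\<^sub>C c + t" unfolding s_def t_def by (rule sum.remove[OF fin c])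
    then have "c = (1 / a c) *\<^sub>C (s - t)" using nz by (simp add: scaleC_scaleC scaleC_one)
    then have ceq: "c = (1 / a c) *\<^sub>C s - (1 / a c) *\<^sub>C t"
      by (simp add: complex_vector.scale_right_diff_distrib)
    have "Q (C - {c})"
      unfolding Q_def
    proof (intro conjI ballI)
      fix w assume "w \<in> W"
      then obtain x y where xy: "x \<in> S" "y \<in> cspan C" "w = x + y" using C by (auto simp: Q_def)
      have "y \<in> cspan (insert c (C - {c}))" using xy(2) c by (simp add: insert_absorb)
      then obtain k where k: "y - k *\<^sub>C c \<in> cspan (C - {c})"
        by (metis complex_vector.span_breakdown_eq)
      have "w = (x + k *\<^sub>C (1 / a c) *\<^sub>C s) + ((y - k *\<^sub>C c) - k *\<^sub>C (1 / a c) *\<^sub>C t)"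
        unfolding xy(3) by (subst ceq) (simp add: complex_vector.scale_right_diff_distrib algebra_simps)
      moreover have "x + k *\<^sub>C (1 / a c) *\<^sub>C s \<in> S"
        using S(1) sum xy(1) by (auto simp: s_def intro!: complex_vector.subspace_add complex_vector.subspace_scale)
      moreover have "(y - k *\<^sub>C c) - k *\<^sub>C (1 / a c) *\<^sub>C t \<in> cspan (C - {c})"
        by (rule complex_vector.span_diff[OF k complex_vector.span_scale[OF complex_vector.span_scale[OF t]]])
      ultimately show "\<exists>x\<in>S. \<exists>y\<in>cspan (C - {c}). w = x + y" by blast
    qed (use fin CW in auto)
    then have "card C \<le> card (C - {c})" by (rule min)
    then show False using fin c by (metis card_Diff1_less leD)
  qed
  have "\<not> cdependent C"
  proof
    assume "cdependent C"
    then obtain a c where "(\<Sum>c\<in>C. a c *\<^sub>C c) = 0" "c \<in> C" "a c \<noteq> 0"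
      using complex_vector.dependent_finite[OF fin] by blast
    then show False using key[of a c] complex_vector.subspace_0[OF S(1)] by simp
  qed
  moreover have "S \<inter> cspan C = {0}"
  proof (intro equalityI subsetI)
    fix x assume "x \<in> S \<inter> cspan C"
    then obtain a where a: "x = (\<Sum>c\<in>C. a c *\<^sub>C c)" "x \<in> S"
      using complex_vector.span_finite[OF fin] by auto
    then have "a c = 0" if "c \<in> C" for c using key that by simp
    then show "x \<in> {0}" using a(1) by simp
  qed (use complex_vector.subspace_0[OF S(1)] complex_vector.span_zero in auto)
  moreover have "{x + y |x y. x \<in> S \<and> y \<in> cspan C} = W"
  proof (intro equalityI subsetI)
    fix w assume "w \<in> {x + y |x y. x \<in> S \<and> y \<in> cspan C}"
    moreover have "cspan C \<subseteq> W" by (rule complex_vector.span_minimal[OF CW W])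
    ultimately show "w \<in> W" using S(2) complex_vector.subspace_add[OF W] by blast
  next
    fix w assume "w \<in> W"
    then show "w \<in> {x + y |x y. x \<in> S \<and> y \<in> cspan C}" using C unfolding Q_def by blast
  qed
  ultimately show ?thesis using fin unfolding has_codim_def by blast
qed

text \<open>Replacing each \<open>c\<close> in \<open>C\<close> by a representative modulo
  \<open>S\<close> in \<open>cspan C'\<close> defines a linear map \<open>L\<close> with
  \<open>x - L x\<close> in \<open>S\<close>. Since \<open>S\<close> meets \<open>cspan C\<close>
  trivially, \<open>L\<close> is injective there, and the bound is the comparison of
  dimensions.\<close>

lemma has_codim_le:
  assumes S: "complex_vector.subspace S" and m: "has_codim S W m" and n: "has_codim S W n"
  shows "m \<le> n"
proof -
  interpret vector_space_pair "scaleC :: complex \<Rightarrow> 'a \<Rightarrow> 'a" "scaleC :: complex \<Rightarrow> 'a \<Rightarrow> 'a" ..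
  obtain C where C: "finite C" "card C = m" "\<not> cdependent C" "S \<inter> cspan C = {0}"
      "{x + y |x y. x \<in> S \<and> y \<in> cspan C} = W"
    using m unfolding has_codim_def by blast
  obtain C' where C': "finite C'" "card C' = n" "\<not> cdependent C'" "S \<inter> cspan C' = {0}"
      "{x + y |x y. x \<in> S \<and> y \<in> cspan C'} = W"
    using n unfolding has_codim_def by blast
  have "\<exists>y. y \<in> cspan C' \<and> c - y \<in> S" if "c \<in> C" for c
  proof -
    have "c \<in> W"
      unfolding C(5)[symmetric] using complex_vector.subspace_0[OF S] complex_vector.span_base[OF that]
      by (metis (mono_tags, lifting) add_0 mem_Collect_eq)
    then show ?thesis unfolding C'(5)[symmetric] by auto
  qed
  then obtain g where g: "\<And>c. c \<in> C \<Longrightarrow> g c \<in> cspan C'" "\<And>c. c \<in> C \<Longrightarrow> c - g c \<in> S" by metis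
  define L where "L = construct C g"
  have L: "Vector_Spaces.linear scaleC scaleC L" unfolding L_def by (rule linear_construct[folded cdependent_def, OF C(3)])
  interpret L: Vector_Spaces.linear scaleC scaleC L by (rule L)
  have Lc: "L c = g c" if "c \<in> C" for c unfolding L_def by (rule construct_basis[folded cdependent_def, OF C(3) that])
  have LS: "x - L x \<in> S" if "x \<in> cspan C" for x
    using that
  proof (induction rule: complex_vector.span_induct_alt)
    case base then show ?case using complex_vector.subspace_0[OF S] by simp
  next
    case (step k c y)
    have "(k *\<^sub>C c + y) - L (k *\<^sub>C c + y) = k *\<^sub>C (c - g c) + (y - L y)"
      using step by (simp add: L.add L.scale Lc complex_vector.scale_right_diff_distrib)
    moreover have "k *\<^sub>C (c - g c) + (y - L y) \<in> S"
      using g(2) step S by (intro complex_vector.subspace_add complex_vector.subspace_scale)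
    ultimately show ?case by (simp only:)
  qed
  have inj: "inj_on L (cspan C)"
  proof (rule inj_onI)
    fix x y assume xy: "x \<in> cspan C" "y \<in> cspan C" "L x = L y"
    then have "x - y \<in> cspan C" "L (x - y) = 0" by (auto simp: L.diff complex_vector.span_diff)
    then have "x - y \<in> S \<inter> cspan C" using LS[of "x - y"] by simp
    then show "x = y" unfolding C(4) by simp
  qed
  have "\<not> cdependent (L ` C)" by (rule linear_independent_injective_image[folded cdependent_def cspan_def, OF L C(3) inj])
  moreover have "L ` C \<subseteq> cspan C'" using Lc g(1) by auto
  ultimately have "card (L ` C) \<le> card C'"
    using complex_vector.independent_span_bound[OF C'(1)] by blast
  moreover have "card (L ` C) = card C"
    by (rule card_image) (rule inj_on_subset[OF inj complex_vector.span_superset])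
  ultimately show ?thesis using C(2) C'(2) by simp
qed

lemma has_codim_unique:
  "complex_vector.subspace S \<Longrightarrow> has_codim S W m \<Longrightarrow> has_codim S W n \<Longrightarrow> m = n"
  by (rule order_antisym) (auto intro: has_codim_le)

lemma has_codim_0:
  assumes "has_codim S W 0" shows "S = W"
proof -
  obtain C where "finite C" "card C = 0" "{x + y |x y. x \<in> S \<and> y \<in> cspan C} = W"
    using assms unfolding has_codim_def by blast
  moreover from this(1,2) have "cspan C = {0}" by (simp add: complex_vector.span_empty)
  ultimately show ?thesis by simp
qed

section \<open>Compact operators\<close>

text \<open>On a Hilbert space the norm limits of finite rank operators are exactly the compact
  operators. This form splits directly into a small part and a finite rank part.\<close>

definition compact_bop :: "'i bop \<Rightarrow> bool" where
  "compact_bop K \<longleftrightarrow> (\<forall>e>0. \<exists>f B. finite B \<and> range (app f) \<subseteq> cspan B \<and> norm (K - f) < e)"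

lemma clinear_app: "Vector_Spaces.linear scaleC scaleC (app A)"
  by unfold_locales auto

lemma app_span: "x \<in> cspan B \<Longrightarrow> app A x \<in> cspan (app A ` B)"
proof -
  interpret vector_space_pair "scaleC :: complex \<Rightarrow> 'a ell2 \<Rightarrow> 'a ell2" "scaleC :: complex \<Rightarrow> 'a ell2 \<Rightarrow> 'a ell2" ..
  show "x \<in> cspan B \<Longrightarrow> app A x \<in> cspan (app A ` B)"
    using linear_span_image[OF clinear_app[of A], of B, folded cspan_def] by blast
qed

lemma compact_bop_add:
  assumes "compact_bop K" "compact_bop L" shows "compact_bop (K + L)"
  unfolding compact_bop_def
proof (intro allI impI)
  fix e :: real assume "0 < e"
  obtain f B where f: "finite B" "range (app f) \<subseteq> cspan B" "norm (K - f) < e / 2"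
    using assms(1) \<open>0 < e\<close> unfolding compact_bop_def by (meson half_gt_zero)
  obtain g C where g: "finite C" "range (app g) \<subseteq> cspan C" "norm (L - g) < e / 2"
    using assms(2) \<open>0 < e\<close> unfolding compact_bop_def by (meson half_gt_zero)
  have "app (f + g) x \<in> cspan (B \<union> C)" for x
    using f(2) g(2) complex_vector.span_mono[of B "B \<union> C"] complex_vector.span_mono[of C "B \<union> C"]
    by (auto intro!: complex_vector.span_add)
  moreover have "norm (K + L - (f + g)) < e"
    using norm_triangle_ineq[of "K - f" "L - g"] f(3) g(3) by (simp add: algebra_simps)
  ultimately show "\<exists>f B. finite B \<and> range (app f) \<subseteq> cspan B \<and> norm (K + L - f) < e"
    using f(1) g(1) by (intro exI[of _ "f + g"] exI[of _ "B \<union> C"]) auto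
qed

lemma compact_bop_mult:
  assumes "compact_bop K" shows "compact_bop (A * K * B)"
  unfolding compact_bop_def
proof (intro allI impI)
  fix e :: real assume e: "0 < e"
  define d where "d = e / (norm A * norm B + 1)"
  have pos: "0 < norm A * norm B + 1" by (simp add: add_nonneg_pos)
  have "0 < d" using e pos by (simp add: d_def)
  then obtain f C where f: "finite C" "range (app f) \<subseteq> cspan C" "norm (K - f) < d"
    using assms unfolding compact_bop_def by blast
  have "norm (A * K * B - A * f * B) = norm (A * (K - f) * B)" by (simp add: algebra_simps)
  also have "\<dots> \<le> norm A * norm (K - f) * norm B"
    by (intro norm_mult_ineq[THEN order_trans] mult_right_mono norm_mult_ineq norm_ge_zero)
  also have "\<dots> \<le> (norm A * norm B) * d"
    using mult_left_mono[OF less_imp_le[OF f(3)], of "norm A * norm B"] by (simp add: mult_ac)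
  also have "\<dots> < (norm A * norm B + 1) * d"
    using \<open>0 < d\<close> by (intro mult_strict_right_mono) auto
  also have "\<dots> = e" using pos by (simp add: d_def)
  finally have "norm (A * K * B - A * f * B) < e" .
  moreover have "range (app (A * f * B)) \<subseteq> cspan (app A ` C)"
    using f(2) by (auto intro!: app_span)
  ultimately show "\<exists>f B'. finite B' \<and> range (app f) \<subseteq> cspan B' \<and> norm (A * K * B - f) < e"
    using f(1) by blast
qed

lemma compact_bop_mult_left: "compact_bop K \<Longrightarrow> compact_bop (A * K)"
  using compact_bop_mult[of K A 1] by simp

lemma compact_bop_mult_right: "compact_bop K \<Longrightarrow> compact_bop (K * B)"
  using compact_bop_mult[of K 1 B] by simp

lemma compact_bop_uminus: "compact_bop K \<Longrightarrow> compact_bop (- K)"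
  using compact_bop_mult_left[of K "- 1"] by simp

lemma compact_bop_diff: "compact_bop K \<Longrightarrow> compact_bop L \<Longrightarrow> compact_bop (K - L)"
  using compact_bop_add[of K "- L"] compact_bop_uminus[of L] by simp

lemma compact_mulop:
  assumes "\<And>i. cmod (f i) \<le> K" and fin: "\<And>e. 0 < e \<Longrightarrow> finite {i. e \<le> cmod (f i)}"
  shows "compact_bop (mulop f)"
  unfolding compact_bop_def
proof (intro allI impI)
  fix e :: real assume "0 < e"
  define F where "F = {i. e / 2 \<le> cmod (f i)}"
  have F: "finite F" unfolding F_def using fin[of "e / 2"] \<open>0 < e\<close> by (simp del: divide_le_eq_numeral1)
  define g where "g i = (if i \<in> F then f i else 0)" for i
  have b: "cmod (g i) \<le> K" for i
    using assms(1)[of i] norm_ge_zero[of "f i"] unfolding g_def by (auto simp del: norm_ge_zero)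
  have "app (mulop g) x = (\<Sum>i\<in>F. (f i * coord x i) *\<^sub>C ket i)" for x
  proof (rule ell2_eqI)
    fix i
    have "(\<Sum>j\<in>F. f j * coord x j * coord (ket j) i) = (\<Sum>j\<in>F. if i = j then f j * coord x j else 0)"
      by (intro sum.cong) (auto simp: coord_ket)
    then show "coord (app (mulop g) x) i = coord (\<Sum>i\<in>F. (f i * coord x i) *\<^sub>C ket i) i"
      unfolding coord_sum using F by (simp add: coord_mulop[of g K, OF b] g_def)
  qed
  then have "app (mulop g) x \<in> cspan (ket ` F)" for x
    by (auto intro!: complex_vector.span_sum complex_vector.span_scale intro: complex_vector.span_base)
  moreover have "norm (mulop f - mulop g) < e"
  proof -
    have fg: "cmod (f i - g i) \<le> e / 2" for i
      using \<open>0 < e\<close> by (auto simp: g_def F_def)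
    have "mulop f - mulop g = mulop (\<lambda>i. f i - g i)"
      by (intro bop_eqI ell2_eqI)
        (simp add: coord_mulop[of f K, OF assms(1)] coord_mulop[of g K, OF b]
          coord_mulop[of "\<lambda>i. f i - g i", OF fg] left_diff_distrib)
    then show ?thesis using norm_mulop_le[of "\<lambda>i. f i - g i", OF fg] \<open>0 < e\<close> by simp
  qed
  ultimately show "\<exists>h B. finite B \<and> range (app h) \<subseteq> cspan B \<and> norm (mulop f - h) < e"
    using F by blast
qed

section \<open>Compact perturbations of the identity\<close>

lemma inverse_one_minus:
  fixes s :: "'a::{real_normed_algebra_1,banach}"
  assumes "norm s < 1"
  obtains J where "(1 - s) * J = 1" "J * (1 - s) = 1"
proof -
  have sm: "summable (\<lambda>n. s ^ n)" by (rule complete_algebra_summable_geometric[OF assms])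
  let ?J = "\<Sum>n. s ^ n"
  have J: "?J = 1 + (\<Sum>n. s ^ Suc n)"
    using suminf_split_head[OF sm] by simp
  have "(\<Sum>n. s ^ Suc n) = s * ?J" by (simp add: suminf_mult[OF sm])
  moreover have "(\<Sum>n. s ^ Suc n) = ?J * s"
    by (simp only: power_Suc2 suminf_mult2[OF sm, symmetric])
  ultimately show ?thesis using J by (intro that[of ?J]) (simp_all add: algebra_simps)
qed

text \<open>With \<open>f\<close> of finite rank and \<open>norm (K - f) < 1\<close>, the factor
  \<open>J = 1 - (K - f)\<close> is invertible by the Neumann series, and \<open>g = J' * f\<close>
  has finite rank.\<close>

lemma compact_perturbation_factor:
  assumes "compact_bop K"
  obtains J J' g B where "J * J' = 1" "J' * J = 1" "1 - K = J * (1 - g)" "finite B" "range (app g) \<subseteq> cspan B"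
proof -
  obtain f B where f: "finite B" "range (app f) \<subseteq> cspan B" "norm (K - f) < 1"
    using assms unfolding compact_bop_def by (meson zero_less_one)
  obtain J where J: "(1 - (K - f)) * J = 1" "J * (1 - (K - f)) = 1"
    using inverse_one_minus[OF f(3)] .
  have "1 - K = (1 - (K - f)) * (1 - J * f)"
    using J(1) by (simp add: right_diff_distrib flip: mult.assoc)
  moreover have "range (app (J * f)) \<subseteq> cspan (app J ` B)"
    using f(2) by (auto intro!: app_span)
  ultimately show ?thesis using that[OF J] f(1) by blast
qed

text \<open>The finite dimensional \<open>cspan B\<close> contains the range of \<open>g\<close> and
  is mapped injectively, hence onto itself, by \<open>1 - g\<close>. Solving
  \<open>(1 - g) v = g x\<close> inside it gives \<open>(1 - g) (x + v) = x\<close> for every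
  \<open>x\<close>.\<close>

lemma fredholm_alternative:
  assumes "compact_bop K" and inj: "\<And>x. app (1 - K) x = 0 \<Longrightarrow> x = 0"
  shows "\<exists>x. app (1 - K) x = y"
proof -
  interpret vector_space_pair "scaleC :: complex \<Rightarrow> 'a ell2 \<Rightarrow> 'a ell2" "scaleC :: complex \<Rightarrow> 'a ell2 \<Rightarrow> 'a ell2" ..
  obtain J J' g B0 where J: "J * J' = 1" "J' * J = 1" "1 - K = J * (1 - g)" "finite B0" "range (app g) \<subseteq> cspan B0"
    using compact_perturbation_factor[OF assms(1)] .
  obtain B where B: "B \<subseteq> B0" "\<not> cdependent B" "B0 \<subseteq> cspan B"
    using complex_vector.maximal_independent_subset[of B0] by blast
  have finB: "finite B" using B(1) J(4) finite_subset by blast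
  have gB: "app g x \<in> cspan B" for x
    using J(5) complex_vector.span_minimal[OF B(3) complex_vector.subspace_span] by blast
  let ?T = "app (1 - g)"
  have injT: "inj_on ?T (cspan B)"
  proof (rule inj_onI)
    fix x y assume "?T x = ?T y"
    then have "?T (x - y) = 0" by (simp only: app_diff) simp
    then have "app (1 - K) (x - y) = 0" unfolding J(3) app_simps(7) by simp
    then show "x = y" using inj[of "x - y"] by simp
  qed
  have ind: "\<not> cdependent (?T ` B)"
    by (rule linear_independent_injective_image[folded cdependent_def cspan_def, OF clinear_app B(2) injT])
  have sub: "?T ` B \<subseteq> cspan B"
    using gB by (auto intro!: complex_vector.span_diff intro: complex_vector.span_base)
  have card: "card (?T ` B) = card B"
    by (rule card_image) (rule inj_on_subset[OF injT complex_vector.span_superset])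
  have "B \<subseteq> cspan (?T ` B)"
  proof (rule ccontr)
    assume "\<not> B \<subseteq> cspan (?T ` B)"
    then obtain b where b: "b \<in> B" "b \<notin> cspan (?T ` B)" by blast
    have bT: "b \<notin> ?T ` B" by (rule contrapos_nn[OF b(2) complex_vector.span_base])
    have "\<not> cdependent (insert b (?T ` B))"
      using ind b(2) bT by (simp add: complex_vector.independent_insert)
    moreover have "insert b (?T ` B) \<subseteq> cspan B"
      using sub complex_vector.span_base[OF b(1)] by blast
    ultimately have "card (insert b (?T ` B)) \<le> card B"
      using complex_vector.independent_span_bound[OF finB] by blast
    then show False using bT finB card by simp
  qed
  then have "cspan B \<subseteq> cspan (?T ` B)"
    by (rule complex_vector.span_minimal[OF _ complex_vector.subspace_span])
  then have surj: "cspan B \<subseteq> ?T ` cspan B"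
    using linear_span_image[OF clinear_app[of "1 - g"], of B, folded cspan_def] by (simp only:)
  define x where "x = app J' y"
  have "app g x \<in> ?T ` cspan B" using gB[of x] surj by (rule rev_subsetD)
  then obtain v where v: "?T v = app g x" by (metis imageE)
  have "?T (x + v) = x" using v by (simp only: app_add) simp
  then have "app (1 - K) (x + v) = app (J * J') y" unfolding J(3) app_simps(7) x_def by simp
  then have "app (1 - K) (x + v) = y" unfolding J(1) app_simps(2) .
  then show ?thesis by (rule exI)
qed

lemma compact_perturbation_cofinite:
  assumes "compact_bop K"
  obtains B where "finite B" "\<And>y. \<exists>x. \<exists>b\<in>cspan B. y = app (1 - K) x + b"
proof -
  obtain J J' g B where J: "J * J' = 1" "J' * J = 1" "1 - K = J * (1 - g)" "finite B" "range (app g) \<subseteq> cspan B"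
    using compact_perturbation_factor[OF assms] .
  have "\<exists>x. \<exists>b\<in>cspan (app J ` B). y = app (1 - K) x + b" for y
  proof (intro exI bexI)
    show "app J (app g (app J' y)) \<in> cspan (app J ` B)" using J(5) by (intro app_span) auto
    have "app (J * J') y = y" by (simp add: J(1) del: app_simps(7))
    then show "y = app (1 - K) (app J' y) + app J (app g (app J' y))"
      unfolding J(3) by simp
  qed
  then show ?thesis using that J(4) by blast
qed

section \<open>Commutators with multiplication operators\<close>

text \<open>\<open>commutator f X Y\<close>: the possibly unbounded commutator of multiplication by \<open>f\<close> with \<open>X\<close>
  is the bounded operator \<open>Y\<close>.\<close>

definition commutator :: "('i \<Rightarrow> complex) \<Rightarrow> 'i bop \<Rightarrow> 'i bop \<Rightarrow> bool" where
  "commutator f X Y \<longleftrightarrow> (\<forall>v w. (\<forall>i. coord w i = f i * coord v i) \<longrightarrow>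
     (\<forall>i. f i * coord (app X v) i = coord (app X w) i + coord (app Y v) i))"

lemma commutatorD:
  "commutator f X Y \<Longrightarrow> (\<And>i. coord w i = f i * coord v i) \<Longrightarrow>
    f i * coord (app X v) i = coord (app X w) i + coord (app Y v) i"
  unfolding commutator_def by blast

lemma bop_ket_eqI: "(\<And>m. app A (ket m) = app B (ket m)) \<Longrightarrow> A = B"
  using bounded_clinear_ket_eqI[OF bounded_clinear_app bounded_clinear_app] by (metis bop_eqI)

lemma commutator_unique:
  assumes "commutator f X Y" "commutator f X Y'" shows "Y = Y'"
proof (intro bop_ket_eqI ell2_eqI)
  fix m i
  have "coord (f m *\<^sub>C ket m) i = f i * coord (ket m) i" for i by (simp add: coord_ket)
  from commutatorD[OF assms(1) this] commutatorD[OF assms(2) this]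
  show "coord (app Y (ket m)) i = coord (app Y' (ket m)) i" by simp
qed

lemma commutator_mult:
  assumes "commutator f X Y" "commutator f X' Y'"
  shows "commutator f (X * X') (X * Y' + Y * X')"
  unfolding commutator_def
proof (intro allI impI)
  fix v w i assume "\<forall>i. coord w i = f i * coord v i"
  then have "coord (app X' w + app Y' v) i = f i * coord (app X' v) i" for i
    using commutatorD[OF assms(2), of w v i] by simp
  from commutatorD[OF assms(1) this, of i]
  show "f i * coord (app (X * X') v) i = coord (app (X * X') w) i + coord (app (X * Y' + Y * X') v) i"
    by simp
qed

section \<open>The index of a compression\<close>

text \<open>Multiplication by \<open>u = z / m\<close> is compressed to the range of the projection \<open>P\<close>, where
  multiplication by \<open>z\<close> preserves this range and \<open>m\<close> is accretive. Up to compact operators the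
  compression is multiplication by \<open>z\<close> composed with the inverse of the compression of
  \<open>m + \<kappa>\<close>, so its range misses the vectors that do not vanish at the zero \<open>\<o>\<close> of \<open>z\<close>.\<close>

locale compression =
  fixes P Y Yz :: "'i bop" and u m :: "'i \<Rightarrow> complex" and \<o> :: 'i
  assumes P_idem: "P * P = P" and P_self: "adjoint_pair P P"
    and u_unit: "cmod (u i) = 1"
    and m_zero: "m \<o> = 0" and m_pos: "i \<noteq> \<o> \<Longrightarrow> 0 < Re (m i)"
    and m_proper: "finite {i. cmod (m i) \<le> N}"
    and comm_m: "commutator m P Y"
    and comm_z: "commutator (\<lambda>i. u i * m i) P Yz" and P_Yz: "P * Yz = Yz"
    and P_ket: "app P (ket \<o>) \<noteq> ket \<o>"
    and P_nonzero: "\<exists>r. coord (app P r) \<o> \<noteq> 0"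
begin

definition U :: "'i bop" where "U = mulop u"
definition U' :: "'i bop" where "U' = mulop (\<lambda>i. cnj (u i))"
text \<open>As \<open>Y = [m, P]\<close>, the operator \<open>m - Z\<close> is the block diagonal
  part \<open>P m P + (1 - P) m (1 - P)\<close> of \<open>m\<close> and commutes with
  \<open>P\<close>. Since \<open>\<kappa>\<close> exceeds \<open>norm Z\<close>,
  \<open>m - Z + \<kappa>\<close> is invertible: \<open>M\<close> is the inverse of
  \<open>m + \<kappa>\<close>, \<open>G\<close> that of \<open>1 - Z * M\<close>, and
  \<open>M * G\<close> that of \<open>m - Z + \<kappa>\<close>.\<close>

definition Z :: "'i bop" where "Z = Y * P - P * Y"
definition \<kappa> :: real where "\<kappa> = norm Z + 1"
definition M :: "'i bop" where "M = mulop (\<lambda>i. 1 / (m i + of_real \<kappa>))"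
definition G :: "'i bop" where "G = (SOME G. (1 - Z * M) * G = 1 \<and> G * (1 - Z * M) = 1)"
definition D :: "'i bop" where "D = P * U - U * P"
definition \<Xi> :: "'i bop" where "\<Xi> = Y * U - Yz + of_real \<kappa> * D"

lemma coord_U: "coord (app U x) i = u i * coord x i"
  unfolding U_def by (rule coord_mulop[of u 1]) (simp add: u_unit)

lemma coord_U': "coord (app U' x) i = cnj (u i) * coord x i"
  unfolding U'_def by (rule coord_mulop[of _ 1]) (simp add: u_unit)

lemma u_cnj: "u i * cnj (u i) = 1" "cnj (u i) * u i = 1"
  using complex_norm_square[of "u i"] by (simp_all add: u_unit mult.commute)

lemma UU': "U * U' = 1" "U' * U = 1"
  by (auto intro!: bop_eqI ell2_eqI simp: coord_U coord_U' u_cnj simp flip: mult.assoc)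

lemma \<kappa>: "0 < \<kappa>" "norm Z < \<kappa>" "1 \<le> \<kappa>"
  by (simp_all add: \<kappa>_def add_nonneg_pos)

lemma m_nonneg: "0 \<le> Re (m i)"
  using m_pos[of i] m_zero by (cases "i = \<o>") auto

lemma m_shift: "\<kappa> \<le> cmod (m i + of_real \<kappa>)" "cmod (m i) \<le> cmod (m i + of_real \<kappa>)"
  "m i + of_real \<kappa> \<noteq> 0"
proof -
  have "\<kappa> \<le> Re (m i + of_real \<kappa>)" using m_nonneg[of i] by simp
  also have "\<dots> \<le> cmod (m i + of_real \<kappa>)" by (rule complex_Re_le_cmod)
  finally show *: "\<kappa> \<le> cmod (m i + of_real \<kappa>)" .
  show "m i + of_real \<kappa> \<noteq> 0" using * \<kappa>(1) by auto
  show "cmod (m i) \<le> cmod (m i + of_real \<kappa>)"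
    unfolding cmod_def using m_nonneg[of i] \<kappa>(1) power_mono[of "Re (m i)" "Re (m i) + \<kappa>" 2] by simp
qed

lemma M_bound: "cmod (1 / (m i + of_real \<kappa>)) \<le> 1 / \<kappa>"
  using m_shift(1)[of i] \<kappa>(1) by (simp add: norm_divide frac_le)

lemma coord_M: "coord (app M x) i = coord x i / (m i + of_real \<kappa>)"
  unfolding M_def using coord_mulop[of "\<lambda>i. 1 / (m i + of_real \<kappa>)", OF M_bound, of x i] by simp

lemma norm_M: "norm M \<le> 1 / \<kappa>"
  unfolding M_def by (rule norm_mulop_le[OF M_bound])

lemma compact_M: "compact_bop M"
  unfolding M_def
proof (rule compact_mulop[OF M_bound])
  fix e :: real assume "0 < e"
  have "cmod (m i) \<le> 1 / e" if "e \<le> cmod (1 / (m i + of_real \<kappa>))" for i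
  proof -
    have "e * cmod (m i + of_real \<kappa>) \<le> 1"
      using that m_shift(3)[of i] by (simp add: norm_divide field_simps)
    then have "cmod (m i + of_real \<kappa>) \<le> 1 / e" using \<open>0 < e\<close> by (simp add: field_simps)
    then show ?thesis using m_shift(2)[of i] by simp
  qed
  then show "finite {i. e \<le> cmod (1 / (m i + of_real \<kappa>))}"
    by (intro finite_subset[OF _ m_proper[of "1 / e"]]) auto
qed

lemma G_inverse: "(1 - Z * M) * G = 1" "G * (1 - Z * M) = 1"
proof -
  have "norm (Z * M) \<le> norm Z * (1 / \<kappa>)"
    by (rule norm_mult_ineq[THEN order_trans]) (intro mult_left_mono norm_M norm_ge_zero)
  also have "\<dots> < 1" using \<kappa> by simp
  finally obtain J where "(1 - Z * M) * J = 1 \<and> J * (1 - Z * M) = 1"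
    by (metis inverse_one_minus)
  then have "(1 - Z * M) * G = 1 \<and> G * (1 - Z * M) = 1" unfolding G_def by (rule someI)
  then show "(1 - Z * M) * G = 1" "G * (1 - Z * M) = 1" by auto
qed

lemma PPx: "P * (P * x) = P * x"
  by (simp add: P_idem flip: mult.assoc)

text \<open>\<open>[m, .]\<close> is a derivation; applied to \<open>P * P = P\<close> it shows that
  \<open>Y\<close> is off-diagonal with respect to \<open>P\<close>.\<close>

lemma Y_split: "Y = P * Y + Y * P"
  using commutator_unique[OF comm_m commutator_mult[OF comm_m comm_m, unfolded P_idem]] .

lemma PYP: "P * (Y * P) = 0"
proof -
  have "P * Y = P * (P * Y + Y * P)" using Y_split by simp
  then show ?thesis by (simp add: distrib_left PPx)
qed

text \<open>The test vector \<open>app M x\<close> lies in the domain of \<open>m\<close>, with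
  image \<open>x - \<kappa> M x\<close>. The commutator then gives
  \<open>(m + \<kappa>) P M = P + Y M\<close>.\<close>

lemma P_M: "P * M = M * (P + Y * M)"
proof (intro bop_eqI ell2_eqI)
  fix x i
  have "coord (x - \<kappa> *\<^sub>R app M x) j = m j * coord (app M x) j" for j
    using m_shift(3)[of j] by (simp add: coord_M field_simps)
  from commutatorD[OF comm_m this, of i]
  have "(m i + of_real \<kappa>) * coord (app P (app M x)) i = coord (app P x) i + coord (app Y (app M x)) i"
    by (simp add: algebra_simps)
  then show "coord (app (P * M) x) i = coord (app (M * (P + Y * M)) x) i"
    using m_shift(3)[of i] by (simp add: coord_M eq_divide_eq mult.commute flip: add_divide_distrib)
qed

text \<open>\<open>P\<close> commutes with \<open>m - Z\<close>, hence with its shifted inverse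
  \<open>M * G\<close>. The bounded form of \<open>[m - Z, P] = 0\<close> is the identity
  \<open>Y + P * Z = Z * P\<close>.\<close>

lemma P_\<Gamma>: "P * (M * G) = M * G * P"
proof -
  have *: "Y + P * Z = Z * P"
    using Y_split PYP by (simp add: Z_def algebra_simps P_idem PPx)
  have "(1 - Z * M) * (P + Y * M) = P + Y * M - Z * (M * (P + Y * M))"
    by (simp add: algebra_simps)
  also have "\<dots> = P + Y * M - Z * P * M" by (simp add: P_M[symmetric] mult.assoc)
  also have "\<dots> = P + Y * M - (Y + P * Z) * M" by (simp only: *)
  also have "\<dots> = P * (1 - Z * M)" by (simp add: algebra_simps)
  finally have "G * ((1 - Z * M) * (P + Y * M)) * G = G * (P * (1 - Z * M)) * G" by simp
  then have "(G * (1 - Z * M)) * (P + Y * M) * G = G * P * ((1 - Z * M) * G)"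
    by (simp only: mult.assoc)
  then have "(P + Y * M) * G = G * P" by (simp add: G_inverse)
  then show ?thesis by (simp add: P_M mult.assoc flip: mult.assoc[of P M G])
qed

text \<open>This is \<open>m (m - Z + \<kappa>)^(-1)\<close>, written with
  \<open>m M = 1 - \<kappa> M\<close> so that only bounded operators occur; see
  \<open>coord_w\<close>.\<close>

definition w :: "'i bop" where "w = G - of_real \<kappa> * (M * G)"

lemma app_w: "app w x = app G x - \<kappa> *\<^sub>R app M (app G x)"
  by (simp add: w_def of_real_def)

lemma coord_w: "coord (app w x) i = m i * coord (app M (app G x)) i"
  using m_shift(3)[of i] by (simp add: app_w coord_M field_simps)

lemma w_decomp: "app w x + \<kappa> *\<^sub>R app M (app G x) - app Z (app M (app G x)) = x"
proof -
  have "app ((1 - Z * M) * G) x = x" by (simp only: G_inverse app_simps)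
  then show ?thesis by (simp add: app_w)
qed

text \<open>Such a \<open>v\<close> is a multiple of \<open>ket \<o>\<close>, which \<open>P\<close>
  does not fix. The lemma settles the one index at which \<open>m\<close> and \<open>z\<close> give
  no information.\<close>

lemma vanish:
  assumes "app P v = v" "\<And>i. i \<noteq> \<o> \<Longrightarrow> coord v i = 0"
  shows "v = 0"
proof -
  have v: "v = coord v \<o> *\<^sub>C ket \<o>"
    using assms(2) by (intro ell2_eqI) (auto simp: coord_ket)
  have "coord v \<o> *\<^sub>C app P (ket \<o>) = coord v \<o> *\<^sub>C ket \<o>"
    using assms(1) v by (metis app_scaleC)
  then have "coord v \<o> = 0"
    using P_ket by (metis complex_vector.scale_left_imp_eq)
  then show ?thesis using v by simp
qed

lemma P_\<Gamma>_app: "app P x = x \<Longrightarrow> app P (app M (app G x)) = app M (app G x)"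
  using arg_cong[OF P_\<Gamma>, of "\<lambda>A. app A x"] by simp

text \<open>Since \<open>Yz\<close> is \<open>z P - P z\<close>, the hypothesis
  \<open>P * Yz = Yz\<close> amounts to \<open>P z P = z P\<close>.\<close>

lemma z_invariant:
  assumes "app P v = v" "\<And>i. coord y i = u i * m i * coord v i"
  shows "app P y = y"
proof -
  have y: "y = app P y + app Yz v"
    using commutatorD[OF comm_z assms(2)] assms by (intro ell2_eqI) simp
  have "app P y = app P (app P y) + app (P * Yz) v" by (subst y) simp
  also have "app P (app P y) = app P y" using arg_cong[OF P_idem, of "\<lambda>A. app A y"] by simp
  finally show ?thesis using y by (simp add: P_Yz)
qed

text \<open>\<open>U w\<close> is \<open>z\<close> after the inverse of
  \<open>m - Z + \<kappa>\<close>. That inverse commutes with \<open>P\<close>, so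
  \<open>U w\<close> preserves the range of \<open>P\<close>; its values vanish at
  \<open>\<o>\<close> because \<open>z\<close> does. Decomposing \<open>x\<close> by
  \<open>w_decomp\<close> leaves, between \<open>P U\<close> and \<open>U w\<close>, only terms with
  the compact factor \<open>M\<close>.\<close>

lemma B_properties:
  assumes x: "app P x = x"
  shows "app P (app U (app w x)) = app U (app w x)" "coord (app U (app w x)) \<o> = 0"
    "app U (app w x) = 0 \<Longrightarrow> x = 0"
    "app (P * U) x = app U (app w x) + app (P * U * (of_real \<kappa> - Z) * M * G) x"
proof -
  let ?v = "app M (app G x)"
  have v: "app P ?v = ?v" by (rule P_\<Gamma>_app[OF x])
  show 1: "app P (app U (app w x)) = app U (app w x)"
    by (rule z_invariant[OF v]) (simp add: coord_U coord_w)
  show "coord (app U (app w x)) \<o> = 0" by (simp add: coord_U coord_w m_zero)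
  show "x = 0" if "app U (app w x) = 0"
  proof -
    have "app U' (app U (app w x)) = app U' 0" by (simp only: that)
    then have "app (U' * U) (app w x) = 0" by simp
    then have w0: "app w x = 0" unfolding UU' by simp
    have "coord ?v i = 0" if "i \<noteq> \<o>" for i
      using coord_w[of x i] m_pos[OF that] unfolding w0 by auto
    then have "?v = 0" by (rule vanish[OF v])
    then show "x = 0" using w_decomp[of x] w0 by simp
  qed
  have "app (P * U) x = app P (app U (app w x + \<kappa> *\<^sub>R ?v - app Z ?v))" by (simp add: w_decomp)
  also have "\<dots> = app U (app w x) + app (P * U * (of_real \<kappa> - Z) * M * G) x"
    using 1 by (simp add: of_real_def)
  finally show "app (P * U) x = app U (app w x) + app (P * U * (of_real \<kappa> - Z) * M * G) x" .
qed

text \<open>Formally \<open>m [P, U] = [m, P] U - [m U, P]\<close>, and \<open>m U\<close> is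
  \<open>z\<close>; so \<open>(m + \<kappa>) D\<close> is the bounded operator \<open>\<Xi>\<close>.
  The factor \<open>M\<close> gained in this way makes \<open>[P, U]\<close> compact.\<close>

lemma D_eq: "D = M * \<Xi>"
proof (intro bop_ket_eqI ell2_eqI)
  fix j i
  define y where "y = m j *\<^sub>C ket j"
  have y: "coord y i = m i * coord (ket j) i" for i by (simp add: y_def coord_ket)
  have "m i * coord (app P (app U (ket j))) i = coord (app P (app U y)) i + coord (app Y (app U (ket j))) i"
    by (rule commutatorD[OF comm_m]) (simp add: coord_U y)
  moreover have "u i * m i * coord (app P (ket j)) i = coord (app P (app U y)) i + coord (app Yz (ket j)) i"
    by (rule commutatorD[OF comm_z]) (simp add: coord_U y)
  ultimately have "(m i + of_real \<kappa>) * coord (app D (ket j)) i = coord (app \<Xi> (ket j)) i"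
    by (simp add: D_def \<Xi>_def coord_U of_real_def algebra_simps)
  then show "coord (app D (ket j)) i = coord (app (M * \<Xi>) (ket j)) i"
    using m_shift(3)[of i] by (simp add: coord_M field_simps)
qed

lemma compact_D: "compact_bop D"
  unfolding D_eq by (rule compact_bop_mult_right[OF compact_M])

text \<open>If \<open>P U v = 0\<close>, then \<open>U v\<close> is orthogonal to the range of
  \<open>P\<close>, which contains \<open>z v\<close>. But \<open><U v, z v>\<close> is the sum of
  \<open>m |v|^2\<close>, whose real part is positive off \<open>\<o>\<close>.\<close>

lemma compression_injective:
  assumes v: "app P v = v" and 0: "app P (app U v) = 0"
  shows "v = 0"
proof -
  have "app U v = - app D v" using v 0 by (simp add: D_def)
  also have "\<dots> = app M (- app \<Xi> v)" by (simp add: D_eq)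
  finally have Uv: "app U v = app M (- app \<Xi> v)" .
  \<comment> \<open>This is \<open>z v\<close>. It is square summable because
    \<open>U v = - D v\<close> lies in the range of \<open>M\<close>, the domain of
    \<open>m\<close>.\<close>
  define y where "y = - app \<Xi> v - \<kappa> *\<^sub>R app U v"
  have y: "coord y i = u i * m i * coord v i" for i
  proof -
    have "u i * coord v i = - coord (app \<Xi> v) i / (m i + of_real \<kappa>)"
      using arg_cong[OF Uv, of "\<lambda>x. coord x i"] by (simp add: coord_U coord_M)
    then show ?thesis using m_shift(3)[of i] by (simp add: y_def coord_U field_simps)
  qed
  have "app P y = y" by (rule z_invariant[OF v y])
  then have "cinner (app U v) y = cinner (app P (app U v)) y"
    by (metis adjoint_pairD[OF P_self])
  then have 1: "cinner (app U v) y = 0" by (simp add: 0)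
  have summand: "cnj (coord (app U v) i) * coord y i = m i * of_real ((cmod (coord v i))\<^sup>2)" for i
  proof -
    have "cnj (coord (app U v) i) * coord y i
        = (cnj (u i) * u i) * m i * (coord v i * cnj (coord v i))"
      by (simp add: coord_U y mult_ac)
    then show ?thesis by (simp only: u_cnj complex_norm_square mult_1_left)
  qed
  have re: "((\<lambda>i. Re (cnj (coord (app U v) i) * coord y i)) has_sum 0) UNIV"
    using has_sum_infsum[OF coord_mult_summable, of "app U v" y] 1 unfolding cinner_ell2_def
    by (metis has_sum_Re zero_complex.sel(1))
  have "coord v i = 0" if "i \<noteq> \<o>" for i
  proof -
    have "Re (cnj (coord (app U v) i) * coord y i) = 0"
      by (rule nonneg_has_sum_le_0D[OF re]) (auto simp: summand m_nonneg)
    then show ?thesis using m_pos[OF that] by (simp add: summand)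
  qed
  then show ?thesis by (rule vanish[OF v])
qed

definition D' :: "'i bop" where "D' = P * U' - U' * P"

lemma D'_eq: "D' = - (U' * D * U')"
  by (simp add: D'_def D_def algebra_simps UU') (simp add: UU' flip: mult.assoc)

text \<open>\<open>P U' P\<close> is a right parametrix of \<open>P U P\<close>: the error
  \<open>K\<close> contains the compact commutator \<open>D\<close>.\<close>

lemma compression_cofinite:
  "\<exists>B. finite B \<and> B \<subseteq> range (app P) \<and>
    (\<forall>y\<in>range (app P). \<exists>x\<in>range (app P). \<exists>b\<in>cspan B. y = app P (app U x) + b)"
proof -
  define K where "K = P * D * U' * P"
  have KP: "K * P = K" "P * K = K" by (simp_all add: K_def mult.assoc P_idem PPx)
  have K: "P * U * P * U' * P = P - K"
  proof -
    have "P * U' * P = U' * P + D' * P" by (simp add: D'_def algebra_simps P_idem)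
    then have "P * U * P * U' * P = P * U * (U' * P + D' * P)" by (simp add: mult.assoc)
    also have "\<dots> = P * (U * U') * P - P * (U * U') * D * U' * P"
      by (simp add: D'_eq algebra_simps)
    finally show ?thesis by (simp add: UU' K_def P_idem)
  qed
  have "compact_bop K"
    unfolding K_def by (intro compact_bop_mult_right compact_bop_mult_left compact_D)
  then obtain B where B: "finite B" "\<And>y. \<exists>x. \<exists>b\<in>cspan B. y = app (1 - K) x + b"
    by (rule compact_perturbation_cofinite) blast
  have "\<exists>x\<in>range (app P). \<exists>b\<in>cspan (app P ` B). y = app P (app U x) + b" if y: "y \<in> range (app P)" for y
  proof -
    obtain x b where xb: "b \<in> cspan B" "y = app (1 - K) x + b" using B(2) by blast
    have "app P y = y" using y arg_cong[OF P_idem, of "\<lambda>A. app A _"] by auto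
    then have "y = app P (app (1 - K) x + b)" using xb(2) by simp
    also have "\<dots> = app (P * (1 - K)) x + app P b" by simp
    also have "P * (1 - K) = P * U * P * U' * P" by (simp only: K right_diff_distrib KP mult_1_right)
    finally have "y = app P (app U (app P (app U' (app P x)))) + app P b" by simp
    then show ?thesis using app_span[OF xb(1), of P] by blast
  qed
  then show ?thesis using B(1) by blast
qed

text \<open>Surjectivity makes the adjoint compression \<open>P U' P\<close> injective on the range
  of \<open>P\<close>. On that range \<open>P U' (U w)\<close> equals \<open>1 - K\<close> with
  \<open>K\<close> compact, and it is injective, so the Fredholm alternative makes
  \<open>1 - K\<close> onto. Solving for \<open>P U' P r\<close> and cancelling \<open>P U'\<close>
  yields \<open>U w x = P r\<close>; the left side vanishes at \<open>\<o>\<close>, while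
  \<open>r\<close> is chosen so that the right side does not.\<close>

lemma compression_not_surjective:
  "\<exists>y\<in>range (app P). \<forall>x\<in>range (app P). app P (app U x) \<noteq> y"
proof (rule ccontr)
  assume "\<not> ?thesis"
  then have surj: "\<exists>x. app P (app U (app P x)) = app P y" for y by blast
  have adjU: "adjoint_pair U U'"
    unfolding adjoint_pair_def cinner_ell2_def by (auto simp: coord_U coord_U' mult_ac intro!: infsum_cong)
  have inj': "y = 0" if y: "app P y = y" "app P (app U' y) = 0" for y
  proof -
    obtain x where x: "app P (app U (app P x)) = y" using surj[of y] y by auto
    have "cinner y y = cinner (app P (app U (app P x))) y" by (simp add: x)
    also have "\<dots> = cinner x (app P (app U' (app P y)))"
      by (simp only: adjoint_pairD[OF P_self] adjoint_pairD[OF adjU])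
    finally show ?thesis using y by (simp add: cinner_self)
  qed
  define C where "C = P * U * (of_real \<kappa> - Z) * M * G"
  define K where "K = (P * U' * C - P * U' * D) * P"
  have "compact_bop (P * U * (of_real \<kappa> - Z) * M * G)"
    by (intro compact_bop_mult compact_M)
  then have "compact_bop (P * U' * C)" unfolding C_def by (rule compact_bop_mult_left)
  from compact_bop_mult_right[OF compact_bop_diff[OF this compact_bop_mult_left[OF compact_D, of "P * U'"]]]
  have K: "compact_bop K" unfolding K_def .
  have id: "app (1 - K) x = app P (app U' (app U (app w x)))" if x: "app P x = x" for x
  proof -
    have "app (P * U') (app U (app w x)) = app (P * U') (app (P * U) x - app C x)"
      using B_properties(4)[OF x] by (simp add: C_def)
    also have "app (P * U) x = app U x + app D x" using x by (simp add: D_def)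
    also have "app (P * U') (app U x + app D x - app C x) = app P (app (U' * U) x) - app K x"
      using x by (simp add: K_def)
    finally show ?thesis using x unfolding UU' by simp
  qed
  have PK: "P * K = K" by (simp add: K_def algebra_simps PPx)
  have "x = 0" if "app (1 - K) x = 0" for x
  proof -
    have "x = app K x" using that by simp
    then have "x = app (P * K) x" unfolding PK .
    then have x: "app P x = x" using arg_cong[OF P_idem, of "\<lambda>A. app A (app K x)"] by simp
    then have "app P (app U' (app U (app w x))) = 0" using id that by simp
    then have "app U (app w x) = 0" using inj'[of "app U (app w x)"] B_properties(1)[OF x] by simp
    then show "x = 0" by (rule B_properties(3)[OF x])
  qed
  then have K_surj: "\<exists>x. app (1 - K) x = y" for y by (rule fredholm_alternative[OF K])
  obtain r where r: "coord (app P r) \<o> \<noteq> 0" using P_nonzero by blast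
  obtain x where x: "app (1 - K) x = app P (app U' (app P r))" using K_surj by blast
  have "x = app (P * K) x + app P (app U' (app P r))" using x unfolding PK by (simp add: algebra_simps)
  then have "x = app P (app K x + app U' (app P r))" by simp
  then have Px: "app P x = x" by (metis app_simps(7) P_idem)
  have Pr: "app P (app P r) = app P r" using arg_cong[OF P_idem, of "\<lambda>A. app A r"] by simp
  let ?d = "app U (app w x) - app P r"
  have "app P ?d = ?d" using B_properties(1)[OF Px] Pr by simp
  moreover have "app P (app U' ?d) = 0" using id[OF Px] x by simp
  ultimately have "?d = 0" by (rule inj')
  then show False using B_properties(2)[OF Px] r by simp
qed

end

section \<open>The pairing operator of a single projection\<close>

definition emb_pos :: "hilb \<Rightarrow> nat \<Rightarrow> hilb \<times> hilb" where
  "emb_pos x = (\<lambda>k. if k = 0 then (x, 0) else 0)"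

definition emb_neg :: "hilb \<Rightarrow> nat \<Rightarrow> hilb \<times> hilb" where
  "emb_neg x = (\<lambda>k. if k = 0 then (0, x) else 0)"

lemma scaleC_fun [simp]: "(c *\<^sub>C f) x = c *\<^sub>C f x"
  by (simp add: scaleC_fun_def)

lemma scaleC_zero_right [simp]: "c *\<^sub>C (0 :: 'a::complex_vector) = 0"
  by (rule complex_vector.scale_zero_right)

lemma scaleC_Pair [simp]: "c *\<^sub>C (x, y) = (c *\<^sub>C x, c *\<^sub>C y)"
  by (simp add: scaleC_prod_def)

lemma linear_emb: "Vector_Spaces.linear scaleC scaleC emb_pos" "Vector_Spaces.linear scaleC scaleC emb_neg"
  by (unfold_locales; auto simp: emb_pos_def emb_neg_def fun_eq_iff)+

lemma emb_neg_eq_iff: "emb_neg x = emb_neg y \<longleftrightarrow> x = y"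
  by (auto simp: emb_neg_def fun_eq_iff dest: spec[of _ 0])

text \<open>The lower left corner of \<open>F\<close> is multiplication by \<open>u\<close>, so for
  \<open>n = 1\<close> the pairing operator is \<open>P U P\<close> between the two graded copies of
  the range of \<open>P\<close>. Its kernel is zero, and its index is minus the codimension of the
  range.\<close>

lemma index_pairing_compression:
  fixes P :: "idx bop" and p :: uq2 and q :: complex
  assumes "compression P Y Yz u m (0, 0, 0)" and u: "\<And>i. u i = sgn ((uq2_d((0, 0, 0) := 1)) i)"
    and p: "uq2_pi q p = app P"
  shows "pairing_fredholm (uq2_pi_eq q) uq2_F uq2_gamma 1 (\<lambda>_ _. p)"
    and "index_pairing (uq2_pi_eq q) uq2_F uq2_gamma 1 (\<lambda>_ _. p) \<noteq> 0"
proof -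
  interpret compression P Y Yz u m "(0, 0, 0)" by fact
  interpret pos: Vector_Spaces.linear scaleC scaleC emb_pos by (rule linear_emb)
  interpret neg: Vector_Spaces.linear scaleC scaleC emb_neg by (rule linear_emb)
  let ?p = "\<lambda>(_ :: nat) (_ :: nat). p"
  let ?R = "range (app P)"
  have half: "(1 / 2) *\<^sub>C (x + x) = x" for x :: hilb
    by (rule ell2_eqI) simp
  have rho: "uq2_pi_eq q p w = (app P (fst w), app P (snd w))" for w
    by (cases w) (simp add: uq2_pi_eq_def p)
  have gpos: "graded_matrix (uq2_pi_eq q) uq2_gamma 1 ?p 1 v = emb_pos (app P (fst (v 0)))" for v
    by (auto simp: graded_matrix_def matrix_act_def amplify_def uq2_gamma_def rho emb_pos_def half
        scaleC_one fun_eq_iff zero_prod_def)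
  have gneg: "graded_matrix (uq2_pi_eq q) uq2_gamma 1 ?p (- 1) v = emb_neg (app P (snd (v 0)))" for v
  proof -
    have "(- 1) *\<^sub>C x = - x" for x :: hilb by (rule ell2_eqI) simp
    then show ?thesis
      by (auto simp: graded_matrix_def matrix_act_def amplify_def uq2_gamma_def rho emb_neg_def half
          fun_eq_iff zero_prod_def)
  qed
  have "emb_pos x \<in> graded_part uq2_gamma 1 1" for x
    by (auto simp: graded_part_def amplify_def uq2_gamma_def emb_pos_def scaleC_one)
  then have space_pos: "pairing_space (uq2_pi_eq q) uq2_gamma 1 ?p 1 = emb_pos ` ?R"
    unfolding pairing_space_def gpos
    by (force simp: image_iff emb_pos_def)
  have "emb_neg x \<in> graded_part uq2_gamma 1 (- 1)" for x
    by (auto simp: graded_part_def amplify_def uq2_gamma_def emb_neg_def fun_eq_iff intro!: ell2_eqI)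
  then have space_neg: "pairing_space (uq2_pi_eq q) uq2_gamma 1 ?p (- 1) = emb_neg ` ?R"
    unfolding pairing_space_def gneg
    by (force simp: image_iff emb_neg_def)
  have F: "snd (uq2_F (x, y)) = app U x" for x y
    by (rule ell2_eqI) (simp only: coord_uq2_F coord_U u)
  define S where "S = pairing_operator (uq2_pi_eq q) uq2_F uq2_gamma 1 ?p"
  have S: "S v = emb_neg (app P (app U (app P (fst (v 0)))))" for v
    unfolding S_def pairing_operator_def o_apply gpos gneg
    by (simp add: amplify_def emb_pos_def F)
  have SV: "S ` (emb_pos ` ?R) = emb_neg ` (\<lambda>x. app P (app U x)) ` ?R"
    using arg_cong[OF P_idem, of "\<lambda>A. app A _"] by (auto simp: S emb_pos_def image_image)
  have subR: "complex_vector.subspace ?R"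
    by (rule complex_vector.subspaceI) (auto simp: image_iff intro: exI[of _ "_ + _"] exI[of _ "_ *\<^sub>C _"] app_0[symmetric] app_add[symmetric] app_scaleC[symmetric])
  have subV: "complex_vector.subspace (emb_pos ` ?R)" by (rule pos.subspace_image[OF subR])
  have subW: "complex_vector.subspace (emb_neg ` ?R)" by (rule neg.subspace_image[OF subR])
  have linA: "Vector_Spaces.linear scaleC scaleC (\<lambda>x. app P (app U x))"
    by unfold_locales auto
  have "complex_vector.subspace ((\<lambda>x. app P (app U x)) ` ?R)"
    by (rule Vector_Spaces.linear.axioms(3)[OF linA, THEN module_hom.subspace_image, OF subR]) 
  then have subSV: "complex_vector.subspace (S ` emb_pos ` ?R)"
    unfolding SV by (rule neg.subspace_image)
  have add: "S (x + y) = S x + S y" for x y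
    by (simp add: S neg.add)
  have scale: "S (c *\<^sub>C x) = c *\<^sub>C S x" for c x
    by (simp add: S neg.scale scaleC_prod_def)
  have ker: "kernel_on S (emb_pos ` ?R) = {0}"
  proof (intro equalityI subsetI)
    fix v assume "v \<in> kernel_on S (emb_pos ` ?R)"
    then obtain x where x: "v = emb_pos (app P x)" "S v = 0" by (auto simp: kernel_on_def)
    have PP: "app P (app P x) = app P x" using arg_cong[OF P_idem, of "\<lambda>A. app A x"] by simp
    have "emb_neg (app P (app U (app P x))) = emb_neg 0" using x PP by (simp add: S emb_pos_def neg.zero)
    then have "app P (app U (app P x)) = 0" by (simp only: emb_neg_eq_iff)
    then have "app P x = 0" by (rule compression_injective[OF PP])
    then show "v \<in> {0}" using x by (simp add: pos.zero)
  qed (use complex_vector.subspace_0[OF subV] in \<open>auto simp: kernel_on_def S neg.zero\<close>)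
  obtain B where B: "finite B \<and> B \<subseteq> ?R \<and>
      (\<forall>y\<in>?R. \<exists>x\<in>?R. \<exists>b\<in>cspan B. y = app P (app U x) + b)"
    using compression_cofinite by (rule exE)
  have SW: "S ` emb_pos ` ?R \<subseteq> emb_neg ` ?R" unfolding SV by blast
  have cofin: "\<exists>m. has_codim (S ` emb_pos ` ?R) (emb_neg ` ?R) m"
  proof (rule has_codimI[OF subSV SW subW, of "emb_neg ` B"])
    fix w assume "w \<in> emb_neg ` ?R"
    then obtain y where y: "y \<in> ?R" "w = emb_neg y" by blast
    obtain x where "x \<in> ?R" "\<exists>b\<in>cspan B. y = app P (app U x) + b"
      using bspec[OF B[THEN conjunct2, THEN conjunct2] y(1)] by (rule bexE)
    then obtain b where xb: "x \<in> ?R" "b \<in> cspan B" "y = app P (app U x) + b" by (elim bexE)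
    have "emb_neg b \<in> cspan (emb_neg ` B)"
      using imageI[OF xb(2), of emb_neg] by (simp only: neg.span_image[folded cspan_def])
    moreover have "emb_neg (app P (app U x)) \<in> S ` emb_pos ` ?R"
      unfolding SV by (intro imageI xb(1))
    moreover have "w = emb_neg (app P (app U x)) + emb_neg b" by (simp only: y(2) xb(3) neg.add)
    ultimately show "\<exists>x\<in>S ` emb_pos ` ?R. \<exists>y\<in>cspan (emb_neg ` B). w = x + y"
      by (intro bexI)
  qed (use B in auto)
  then obtain k where k: "has_codim (S ` emb_pos ` ?R) (emb_neg ` ?R) k" by blast
  have the: "(THE m. has_codim (S ` emb_pos ` ?R) (emb_neg ` ?R) m) = k"
    using k has_codim_unique[OF subSV _ k] by (rule the_equality)
  have "k \<noteq> 0"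
  proof
    assume "k = 0"
    then have "emb_neg ` (\<lambda>x. app P (app U x)) ` ?R = emb_neg ` ?R"
      using has_codim_0 k unfolding SV by blast
    moreover obtain y where "y \<in> ?R" "\<forall>x\<in>?R. app P (app U x) \<noteq> y"
      using compression_not_surjective by (rule bexE)
    ultimately show False by (metis (no_types, lifting) emb_neg_eq_iff imageE imageI)
  qed
  show "pairing_fredholm (uq2_pi_eq q) uq2_F uq2_gamma 1 ?p"
    unfolding pairing_fredholm_def fredholm_def space_pos space_neg S_def[symmetric]
    using subV subW SW add scale cofin ker by (auto intro!: exI[of _ "{}"] simp: complex_vector.span_empty)
  have "cdim {0 :: nat \<Rightarrow> hilb \<times> hilb} = 0"
    by (subst complex_vector.dim_eq_card[of "{}"])
      (auto simp: complex_vector.span_insert_0 complex_vector.span_empty complex_vector.independent_empty)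
  then show "index_pairing (uq2_pi_eq q) uq2_F uq2_gamma 1 ?p \<noteq> 0"
    unfolding index_pairing_def fredholm_index_def space_pos space_neg S_def[symmetric] ker the
    using \<open>k \<noteq> 0\<close> by simp
qed

section \<open>Poisson summation for Gaussians\<close>

lemma has_sum_geometric_int:
  fixes r :: real
  assumes "0 \<le> r" "r < 1"
  shows "((\<lambda>p :: int. r ^ nat \<bar>p\<bar>) has_sum (1 + r) / (1 - r)) UNIV"
proof -
  have pos: "((\<lambda>n. r ^ n) has_sum 1 / (1 - r)) UNIV"
    using assms by (intro sums_nonneg_imp_has_sum geometric_sums) auto
  then have "((\<lambda>p :: int. r ^ nat \<bar>p\<bar>) has_sum 1 / (1 - r)) (int ` UNIV)"
    by (subst has_sum_reindex) (auto simp: o_def)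
  moreover have "((\<lambda>n. r * r ^ n) has_sum r * (1 / (1 - r))) UNIV"
    by (rule has_sum_cmult_right[OF pos])
  then have "((\<lambda>p :: int. r ^ nat \<bar>p\<bar>) has_sum r * (1 / (1 - r))) ((\<lambda>n. - 1 - int n) ` UNIV)"
    by (subst has_sum_reindex) (auto simp: o_def inj_on_def nat_add_distrib)
  ultimately have "((\<lambda>p :: int. r ^ nat \<bar>p\<bar>) has_sum 1 / (1 - r) + r * (1 / (1 - r)))
      (int ` UNIV \<union> (\<lambda>n. - 1 - int n) ` UNIV)"
    by (rule has_sum_Un_disjoint) auto
  moreover have "int ` UNIV \<union> (\<lambda>n. - 1 - int n) ` UNIV = UNIV"
  proof (intro equalityI subsetI UNIV_I)
    fix p :: int
    have "p = int (nat p) \<or> p = - 1 - int (nat (- 1 - p))" by linarith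
    then show "p \<in> int ` UNIV \<union> (\<lambda>n. - 1 - int n) ` UNIV" by blast
  qed
  ultimately show ?thesis by (simp add: add_divide_distrib)
qed

lemma exp_neg_square_le:
  assumes "0 \<le> K" shows "exp (- K * (real_of_int p)\<^sup>2) \<le> exp (- K) ^ nat \<bar>p\<bar>"
proof -
  have "real (nat \<bar>p\<bar>) \<le> (real_of_int p)\<^sup>2"
  proof -
    have "\<bar>p\<bar> * 1 \<le> \<bar>p\<bar> * \<bar>p\<bar>" by (cases "p = 0") (simp, intro mult_left_mono, auto)
    then have "\<bar>p\<bar> \<le> p\<^sup>2" by (simp add: power2_eq_square)
    then have "real_of_int \<bar>p\<bar> \<le> real_of_int (p\<^sup>2)" by (simp only: of_int_le_iff)
    then show ?thesis by simp
  qed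
  then have "K * real (nat \<bar>p\<bar>) \<le> K * (real_of_int p)\<^sup>2" using assms by (intro mult_left_mono)
  then show ?thesis by (simp add: exp_of_nat_mult[symmetric] mult.commute)
qed

lemma summable_gauss_int:
  assumes "0 < K" shows "(\<lambda>p :: int. exp (- K * (real_of_int p - a)\<^sup>2)) summable_on UNIV"
proof (rule summable_on_comparison_test)
  have "(\<lambda>p :: int. exp (- (K / 2)) ^ nat \<bar>p\<bar>) summable_on UNIV"
    using has_sum_geometric_int[of "exp (- (K / 2))"] assms by (auto simp: summable_on_def)
  then show "(\<lambda>p :: int. exp (K * a\<^sup>2) * exp (- (K / 2)) ^ nat \<bar>p\<bar>) summable_on UNIV"
    by (rule summable_on_cmult_right)
  fix p :: int
  \<comment> \<open>This gives \<open>(p - a)^2 >= p^2 / 2 - a^2\<close>: halving the rate absorbs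
    the shift.\<close>
  have "0 \<le> (real_of_int p / 2 - a)\<^sup>2 * 2" by simp
  then have "- (real_of_int p - a)\<^sup>2 \<le> a\<^sup>2 - (real_of_int p)\<^sup>2 / 2"
    by (simp add: power2_eq_square algebra_simps)
  then have "K * - (real_of_int p - a)\<^sup>2 \<le> K * (a\<^sup>2 - (real_of_int p)\<^sup>2 / 2)"
    using assms by (intro mult_left_mono) auto
  then have "exp (- K * (real_of_int p - a)\<^sup>2) \<le> exp (K * a\<^sup>2) * exp (- (K / 2) * (real_of_int p)\<^sup>2)"
    by (simp add: exp_add[symmetric] algebra_simps)
  also have "\<dots> \<le> exp (K * a\<^sup>2) * exp (- (K / 2)) ^ nat \<bar>p\<bar>"
    using assms by (intro mult_left_mono exp_neg_square_le) auto
  finally show "exp (- K * (real_of_int p - a)\<^sup>2) \<le> exp (K * a\<^sup>2) * exp (- (K / 2)) ^ nat \<bar>p\<bar>" .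
qed auto

text \<open>\<open>f\<close> is orthogonal to all trigonometric polynomials, hence to every
  polynomial on the circle. By Stone-Weierstrass these approximate \<open>cnj f\<close> uniformly,
  so the integral of \<open>|f|^2\<close> vanishes.\<close>

lemma fourier_uniqueness:
  fixes f :: "real \<Rightarrow> complex"
  assumes cont: "continuous_on {0..1} f" and loop: "f 0 = f 1"
    and coeff: "\<And>n :: int. integral {0..1} (\<lambda>x. f x * cis (2 * pi * n * x)) = 0"
    and x: "x \<in> {0..1}"
  shows "f x = 0"
proof -
  define N where "N h \<longleftrightarrow> continuous_on {0..1} h \<and> (\<forall>n :: int. integral {0..1} (\<lambda>x. h x * cis (2 * pi * n * x)) = 0)" for h
  \<comment> \<open>The multipliers that preserve vanishing of all Fourier coefficients. They form
    an algebra containing the real and imaginary part of \<open>E\<close>, hence all polynomials in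
    these.\<close>
  define Q where "Q h \<longleftrightarrow> (\<forall>k. N k \<longrightarrow> N (\<lambda>x. k x * h x))" for h
  have contcis: "continuous_on {0..1} (\<lambda>x :: real. cis (2 * pi * of_int n * x))" for n :: int
    by (intro continuous_intros)
  have Nadd: "N (\<lambda>x. h x + k x)" if "N h" "N k" for h k
    unfolding N_def
  proof (intro conjI allI)
    have c: "continuous_on {0..1} h" "continuous_on {0..1} k" using that by (auto simp: N_def)
    then show "continuous_on {0..1} (\<lambda>x. h x + k x)" by (rule continuous_on_add)
    fix n :: int
    show "integral {0..1} (\<lambda>x. (h x + k x) * cis (2 * pi * n * x)) = 0"
      using that integrable_continuous_real[OF continuous_on_mult[OF c(1) contcis[of n]]]
        integrable_continuous_real[OF continuous_on_mult[OF c(2) contcis[of n]]]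
      unfolding distrib_right by (subst integral_add) (auto simp: N_def)
  qed
  have Nscale: "N (\<lambda>x. c * h x)" if "N h" for c h
    using that unfolding N_def by (auto intro: continuous_on_mult simp: mult.assoc)
  have Ncis: "N (\<lambda>x. h x * cis (2 * pi * m * x))" if "N h" for h and m :: int
    unfolding N_def
  proof (intro conjI allI)
    show "continuous_on {0..1} (\<lambda>x. h x * cis (2 * pi * m * x))"
      using that unfolding N_def by (intro continuous_on_mult contcis) auto
    fix n :: int
    have "integral {0..1} (\<lambda>x. h x * cis (2 * pi * (m + n) * x)) = 0"
      using that unfolding N_def by (metis of_int_add)
    then show "integral {0..1} (\<lambda>x. h x * cis (2 * pi * m * x) * cis (2 * pi * n * x)) = 0"
      by (simp add: mult.assoc cis_mult ring_distribs)
  qed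
  have Qadd: "Q (\<lambda>x. h x + k x)" if "Q h" "Q k" for h k
    using that Nadd unfolding Q_def by (simp add: distrib_left)
  have Qmult: "Q (\<lambda>x. h x * k x)" if "Q h" "Q k" for h k
    using that unfolding Q_def by (simp flip: mult.assoc)
  have Qscale: "Q (\<lambda>x. c * h x)" if "Q h" for c h
    using that Nscale unfolding Q_def by (simp add: mult.left_commute)
  have Qconst: "Q (\<lambda>x. c)" for c
    using Nscale unfolding Q_def by (simp add: mult.commute)
  have Qcis: "Q (\<lambda>x. cis (2 * pi * of_int m * x))" for m :: int
    using Ncis unfolding Q_def by blast
  define E where "E x = cis (2 * pi * x)" for x :: real
  have re: "complex_of_real (Re (E x)) = (1 / 2) * (cis (2 * pi * of_int 1 * x) + cis (2 * pi * of_int (- 1) * x))"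
    and im: "complex_of_real (Im (E x)) = (- \<i> / 2) * (cis (2 * pi * of_int 1 * x) + (- 1) * cis (2 * pi * of_int (- 1) * x))" for x
    by (simp_all add: E_def complex_eq_iff)
  have Qre: "Q (\<lambda>x. complex_of_real (Re (E x)))" and Qim: "Q (\<lambda>x. complex_of_real (Im (E x)))"
    unfolding re im by (intro Qscale Qadd Qcis)+
  have Qpoly: "Q (\<lambda>x. complex_of_real (g (E x)))" if "real_polynomial_function g" for g
    using that
  proof (induction g)
    case (linear g)
    interpret g: bounded_linear g by fact
    have gz: "g z = g 1 * Re z + g \<i> * Im z" for z
    proof -
      have "g z = g (Re z *\<^sub>R 1 + Im z *\<^sub>R \<i>)" by (rule arg_cong[of _ _ g]) (simp add: complex_eq_iff)
      then show ?thesis by (simp only: g.add g.scaleR real_scaleR_def mult.commute)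
    qed
    have "(\<lambda>x. complex_of_real (g (E x))) = (\<lambda>x. of_real (g 1) * of_real (Re (E x)) + of_real (g \<i>) * of_real (Im (E x)))"
      by (rule ext) (subst gz, simp only: of_real_add of_real_mult)
    then show ?case by (simp only: Qadd Qscale Qre Qim)
  next
    case (const c) show ?case by (rule Qconst)
  next
    case (add g h) then show ?case by (simp add: Qadd)
  next
    case (mult g h) then show ?case by (simp add: Qmult)
  qed
  have Nf: "N f" using cont coeff by (simp add: N_def)
  have poly0: "integral {0..1} (\<lambda>x. f x * g (E x)) = 0" if "polynomial_function g" for g
  proof -
    have "real_polynomial_function (\<lambda>z. Re (g z))" "real_polynomial_function (\<lambda>z. Im (g z))"
      using that[unfolded polynomial_function_def o_def, rule_format, OF bounded_linear_Re]
        that[unfolded polynomial_function_def o_def, rule_format, OF bounded_linear_Im] .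
    from this[THEN Qpoly]
    have "Q (\<lambda>x. of_real (Re (g (E x))) + \<i> * of_real (Im (g (E x))))"
      by (intro Qadd Qscale)
    then have "N (\<lambda>x. f x * (of_real (Re (g (E x))) + \<i> * of_real (Im (g (E x)))))"
      using Nf unfolding Q_def by blast
    then have "N (\<lambda>x. f x * g (E x))" by (simp flip: complex_eq)
    from this[unfolded N_def, THEN conjunct2, THEN spec, of 0] show ?thesis by simp
  qed
  have path: "path f" using cont by (simp add: path_def)
  \<comment> \<open>The homotopy is trivial. It serves only to obtain that the loop, read as a
    function on the circle through \<open>Arg2pi\<close>, is continuous also across the branch
    cut.\<close>
  have "homotopic_loops UNIV f f"
    using path loop by (simp add: homotopic_loops_refl pathfinish_def pathstart_def)
  from homotopic_loops_imp_homotopic_circlemaps[OF this]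
  have contF: "continuous_on (sphere 0 1) (f \<circ> (\<lambda>z. Arg2pi z / (2 * pi)))"
    using homotopic_with_imp_continuous by blast
  have FE: "f (Arg2pi (E x) / (2 * pi)) = f x" if "x \<in> {0..1}" for x
  proof (cases "x = 1")
    case True
    moreover have "Arg2pi 1 = 0" by (rule Arg2pi_unique[of 1]) auto
    ultimately show ?thesis using loop by (simp add: E_def)
  next
    case False
    have "Arg2pi (E x) = 2 * pi * x"
      using that False by (intro Arg2pi_unique[of 1]) (auto simp: E_def cis_conv_exp)
    then show ?thesis by simp
  qed
  define I where "I = integral {0..1} (\<lambda>x. (cmod (f x))\<^sup>2)"
  define J where "J = integral {0..1} (\<lambda>x. cmod (f x))"
  have conts: "continuous_on {0..1} (\<lambda>x. (cmod (f x))\<^sup>2)" "continuous_on {0..1} (\<lambda>x. cmod (f x))"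
    using cont by (auto intro!: continuous_intros)
  have "I \<le> e * J" if "0 < e" for e
  proof -
    have "continuous_on (sphere 0 1) (\<lambda>z. cnj ((f \<circ> (\<lambda>z. Arg2pi z / (2 * pi))) z))"
      by (intro continuous_intros contF)
    from Stone_Weierstrass_polynomial_function[OF compact_sphere this \<open>0 < e\<close>]
    obtain g where g: "polynomial_function g"
      "\<And>z. z \<in> sphere 0 1 \<Longrightarrow> cmod (cnj (f (Arg2pi z / (2 * pi))) - g z) < e" by auto
    have gE: "cmod (cnj (f x) - g (E x)) \<le> e" if "x \<in> {0..1}" for x
      using g(2)[of "E x"] FE[OF that] by (simp add: E_def)
    have contgE: "continuous_on {0..1} (\<lambda>x. g (E x))"
      unfolding E_def
      by (rule continuous_on_compose2[OF continuous_on_polymonial_function[OF g(1), of UNIV]])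
        (auto intro!: continuous_intros)
    have "complex_of_real I = integral {0..1} (\<lambda>x. f x * cnj (f x))"
      unfolding I_def complex_norm_square[symmetric]
      using integral_linear[OF integrable_continuous_real[OF conts(1)], of "of_real :: real \<Rightarrow> complex", OF bounded_linear_of_real]
      by (simp add: o_def)
    also have "\<dots> = integral {0..1} (\<lambda>x. f x * (cnj (f x) - g (E x)) + f x * g (E x))"
      by (simp add: algebra_simps)
    also have "\<dots> = integral {0..1} (\<lambda>x. f x * (cnj (f x) - g (E x)))"
      by (subst integral_add)
        (auto intro!: integrable_continuous_real continuous_intros cont contgE simp: poly0[OF g(1)])
    finally have "\<bar>I\<bar> = cmod (integral {0..1} (\<lambda>x. f x * (cnj (f x) - g (E x))))"
      by (metis norm_of_real)
    also have "\<dots> \<le> integral {0..1} (\<lambda>x. e * cmod (f x))"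
    proof (rule integral_norm_bound_integral)
      show "cmod (f x * (cnj (f x) - g (E x))) \<le> e * cmod (f x)" if "x \<in> {0..1}" for x
        using mult_left_mono[OF gE[OF that], of "cmod (f x)"] by (simp add: norm_mult mult.commute)
    qed (intro integrable_continuous_real continuous_intros cont contgE)+
    finally show ?thesis by (simp add: J_def)
  qed
  then have "I \<le> 0"
  proof -
    assume a: "\<And>e. 0 < e \<Longrightarrow> I \<le> e * J"
    have "((\<lambda>e. e * J) \<longlongrightarrow> 0 * J) (at_right 0)" by (intro tendsto_intros)
    then have "I \<le> 0 * J"
      by (rule tendsto_lowerbound) (auto simp: eventually_at_right_field intro!: a exI[of _ 1])
    then show ?thesis by simp
  qed
  moreover have "0 \<le> I" unfolding I_def by (intro integral_nonneg integrable_continuous_real conts) auto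
  ultimately have "I = 0" by simp
  then have "\<forall>x\<in>{0..1}. (cmod (f x))\<^sup>2 = 0"
    unfolding I_def by (subst (asm) integral_eq_0_iff) (use conts in auto)
  then show ?thesis using x by simp
qed

lemma integral_infsum_uniform:
  fixes f :: "'a \<Rightarrow> real \<Rightarrow> complex"
  assumes cont: "\<And>p. continuous_on {0..1} (f p)"
    and le: "\<And>p x. x \<in> {0..1} \<Longrightarrow> cmod (f p x) \<le> M p" and M: "M summable_on UNIV"
  shows "continuous_on {0..1} (\<lambda>x. \<Sum>\<^sub>\<infinity>p. f p x)"
    and "((\<lambda>p. integral {0..1} (f p)) has_sum integral {0..1} (\<lambda>x. \<Sum>\<^sub>\<infinity>p. f p x)) UNIV"
proof -
  have u: "uniform_limit {0..1} (\<lambda>X x. \<Sum>p\<in>X. f p x) (\<lambda>x. \<Sum>\<^sub>\<infinity>p. f p x) (finite_subsets_at_top UNIV)"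
    by (rule Weierstrass_m_test_general[OF le M])
  have c: "continuous_on {0..1} (\<lambda>x. \<Sum>p\<in>X. f p x)" for X
    by (intro continuous_on_sum cont)
  show "continuous_on {0..1} (\<lambda>x. \<Sum>\<^sub>\<infinity>p. f p x)"
    by (rule uniform_limit_theorem[OF _ u]) (auto intro: c always_eventually)
  obtain I J where IJ: "\<And>X. ((\<lambda>x. \<Sum>p\<in>X. f p x) has_integral I X) {0..1}"
    "((\<lambda>x. \<Sum>\<^sub>\<infinity>p. f p x) has_integral J) {0..1}" "(I \<longlongrightarrow> J) (finite_subsets_at_top UNIV)"
    by (rule uniform_limit_integral[OF u c]) auto
  have "I X = (\<Sum>p\<in>X. integral {0..1} (f p))" if "finite X" for X
    using IJ(1)[of X] integral_sum[OF that, of "\<lambda>p. f p" "{0..1}"] cont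
    by (simp add: integrable_continuous_real has_integral_iff)
  then have "\<forall>\<^sub>F X in finite_subsets_at_top UNIV. I X = (\<Sum>p\<in>X. integral {0..1} (f p))"
    by (intro eventually_finite_subsets_at_top_weakI) auto
  from Lim_transform_eventually[OF IJ(3) this]
  show "((\<lambda>p. integral {0..1} (f p)) has_sum integral {0..1} (\<lambda>x. \<Sum>\<^sub>\<infinity>p. f p x)) UNIV"
    unfolding has_sum_def using IJ(2) by (simp add: integral_unique)
qed

lemma integral_cis:
  "integral {0..1} (\<lambda>x. cis (2 * pi * of_int k * x)) = (if k = 0 then 1 else 0)"
proof (cases "k = 0")
  case False
  have "((\<lambda>x. cis (2 * pi * of_int k * x)) has_integral
      cis (2 * pi * of_int k * 1) / (2 * pi * of_int k * \<i>) - cis (2 * pi * of_int k * 0) / (2 * pi * of_int k * \<i>)) {0..1}"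
  proof (rule fundamental_theorem_of_calculus)
    fix x :: real
    have "((\<lambda>x. exp (2 * pi * of_int k * \<i> * of_real x) / (2 * pi * of_int k * \<i>)) has_vector_derivative
        exp (2 * pi * of_int k * \<i> * of_real x)) (at x within {0..1})"
      using False by (auto intro!: derivative_eq_intros has_vector_derivative_real_field)
    then show "((\<lambda>x. cis (2 * pi * of_int k * x) / (2 * pi * of_int k * \<i>)) has_vector_derivative
        cis (2 * pi * of_int k * x)) (at x within {0..1})"
      by (simp add: cis_conv_exp mult_ac)
  qed auto
  moreover have "cis (2 * pi * of_int k) = 1"
    by (simp add: cis_multiple_2pi)
  ultimately show ?thesis using False by (simp add: integral_unique)
qed simp

text \<open>The characteristic function of the standard normal distribution after the substitution
  \<open>x = s y\<close>: with \<open>s = c sqrt (2 pi)\<close> the density becomes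
  \<open>exp (- pi c^2 y^2)\<close> up to its constant, and \<open>t\<close> is chosen so that
  \<open>t s = 2 pi \<xi>\<close>.\<close>

lemma gauss_fourier:
  assumes c: "0 < c"
  shows "((\<lambda>y. of_real (exp (- pi * c\<^sup>2 * y\<^sup>2)) * cis (2 * pi * \<xi> * y)) has_integral
    of_real (exp (- pi * \<xi>\<^sup>2 / c\<^sup>2) / c)) UNIV"
proof -
  define s where "s = c * sqrt (2 * pi)"
  define t where "t = sqrt (2 * pi) * \<xi> / c"
  have s: "0 < s" using c by (simp add: s_def)
  let ?h = "\<lambda>x. std_normal_density x *\<^sub>R iexp (t * x)"
  have int: "integrable lborel ?h"
  proof (rule Bochner_Integration.integrable_bound)
    show "integrable lborel std_normal_density" by (simp add: integrable_normal_density)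
  qed auto
  have "complex_of_real (exp (- (t\<^sup>2) / 2)) = (CLINT x|std_normal_distribution. iexp (t * x))"
    using fun_cong[OF char_std_normal_distribution, of t] by (simp add: char_def)
  also have "\<dots> = (\<integral>x. ?h x \<partial>lborel)"
    by (subst integral_density) (auto simp: normal_density_nonneg)
  also have "\<dots> = \<bar>s\<bar> *\<^sub>R (\<integral>x. ?h (0 + s * x) \<partial>lborel)"
    by (rule lborel_integral_real_affine) (use s in auto)
  finally have 1: "(\<integral>x. ?h (s * x) \<partial>lborel) = of_real (exp (- (t\<^sup>2) / 2) / s)"
    using s by (simp add: scaleR_conv_of_real field_simps)
  have "integrable lborel (\<lambda>x. ?h (s * x))"
    using lborel_integrable_real_affine[OF int, of s 0] s by simp
  from has_integral_integral_lborel[OF this]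
  have "((\<lambda>x. ?h (s * x)) has_integral of_real (exp (- (t\<^sup>2) / 2) / s)) UNIV" by (simp only: 1)
  then have "((\<lambda>x. of_real (sqrt (2 * pi)) * ?h (s * x)) has_integral
      of_real (sqrt (2 * pi)) * of_real (exp (- (t\<^sup>2) / 2) / s)) UNIV"
    by (rule has_integral_mult_right)
  moreover have "of_real (sqrt (2 * pi)) * ?h (s * x) = of_real (exp (- pi * c\<^sup>2 * x\<^sup>2)) * cis (2 * pi * \<xi> * x)" for x
  proof -
    have 1: "sqrt (2 * pi) * std_normal_density (s * x) = exp (- pi * c\<^sup>2 * x\<^sup>2)"
      by (simp add: std_normal_density_def s_def power_mult_distrib mult_ac)
    have "t * (s * x) = 2 * pi * \<xi> * x"
      using c by (simp add: t_def s_def field_simps)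
    then have "iexp (t * (s * x)) = cis (2 * pi * \<xi> * x)" by (simp only: cis_conv_exp)
    then show ?thesis unfolding 1[symmetric] by (simp add: scaleR_conv_of_real)
  qed
  moreover have "complex_of_real (sqrt (2 * pi)) * of_real (exp (- (t\<^sup>2) / 2) / s) = of_real (exp (- pi * \<xi>\<^sup>2 / c\<^sup>2) / c)"
  proof -
    have "- (t\<^sup>2) / 2 = - pi * \<xi>\<^sup>2 / c\<^sup>2"
      by (simp add: t_def power_mult_distrib power_divide)
    then show ?thesis unfolding of_real_mult[symmetric] by (simp add: s_def)
  qed
  ultimately show ?thesis by simp
qed

text \<open>Both sides are values at \<open>a / c\<close> of continuous functions of period 1:
  \<open>\<phi>\<close> is the periodisation of the Gaussian \<open>h\<close>, and
  \<open>\<psi>\<close> is a Fourier series. Unfolding the unit interval along the integer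
  translates turns the coefficients of \<open>\<phi>\<close> into Fourier integrals over the line,
  which equal the coefficients \<open>C m\<close> of \<open>\<psi>\<close>.\<close>

lemma poisson_gauss:
  fixes a b c :: real
  assumes c: "0 < c"
  shows "(\<Sum>\<^sub>\<infinity>p :: int. of_real (exp (- pi * (c * p - a)\<^sup>2)) * cis (- 2 * pi * b * (c * p - a)))
    = (\<Sum>\<^sub>\<infinity>n :: int. of_real (exp (- pi * (n / c + b)\<^sup>2) / c) * cis (- 2 * pi * a * n / c))"
proof -
  define h where "h y = of_real (exp (- pi * c\<^sup>2 * y\<^sup>2)) * cis (2 * pi * (c * b) * y)" for y :: real
  define \<phi> where "\<phi> x = (\<Sum>\<^sub>\<infinity>p :: int. h (x - of_int p))" for x
  define C where "C n = exp (- pi * (n / c + b)\<^sup>2) / c" for n :: int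
  define \<psi> where "\<psi> x = (\<Sum>\<^sub>\<infinity>n :: int. of_real (C n) * cis (- 2 * pi * n * x))" for x :: real
  define M where "M p = exp (pi * c\<^sup>2) * exp (- (pi * c\<^sup>2 / 2) * (real_of_int p - 0)\<^sup>2)" for p :: int
  have K: "0 < pi * c\<^sup>2" using c by simp
  have M: "M summable_on UNIV"
    unfolding M_def using K by (intro summable_on_cmult_right summable_gauss_int) auto
  have hM: "cmod (h (x - of_int p)) \<le> M p" if "x \<in> {0..1}" for x p
  proof -
    have "0 \<le> 2 * (x - of_int p / 2)\<^sup>2" by simp
    moreover have "x\<^sup>2 \<le> 1" using that by (simp add: power_le_one)
    ultimately have "- (x - of_int p)\<^sup>2 \<le> 1 - (of_int p)\<^sup>2 / 2"
      by (simp add: power2_eq_square algebra_simps)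
    then have "(pi * c\<^sup>2) * (- (x - of_int p)\<^sup>2) \<le> (pi * c\<^sup>2) * (1 - (of_int p)\<^sup>2 / 2)"
      using K by (intro mult_left_mono) auto
    then show ?thesis by (simp add: h_def M_def norm_mult exp_add[symmetric] algebra_simps)
  qed
  have conth: "continuous_on S (\<lambda>x. h (x - of_int p))" for p S
    unfolding h_def by (intro continuous_intros)
  have summ_h: "(\<lambda>p. h (x - of_int p)) summable_on UNIV" if "x \<in> {0..1}" for x
    by (rule abs_summable_summable[OF Infinite_Sum.abs_summable_on_comparison_test'[OF M hM[OF that]]])
  have C: "C summable_on UNIV"
  proof -
    have "(\<lambda>n :: int. exp (- (pi / c\<^sup>2) * (n - (- b * c))\<^sup>2)) summable_on UNIV"
      using c by (intro summable_gauss_int) auto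
    moreover have "(pi / c\<^sup>2) * (n - (- b * c))\<^sup>2 = pi * (n / c + b)\<^sup>2" for n
      using c by (simp add: field_simps power2_eq_square)
    ultimately have "(\<lambda>n :: int. exp (- pi * (n / c + b)\<^sup>2)) summable_on UNIV" by simp
    then show ?thesis unfolding C_def divide_inverse by (rule summable_on_cmult_left)
  qed
  have C0: "0 \<le> C n" for n using c by (simp add: C_def)
  have \<psi>M: "cmod (of_real (C n) * cis (- 2 * pi * n * x)) \<le> C n" for n and x :: real
    using C0[of n] by (simp add: norm_mult)
  have cis1: "cis (2 * pi * of_int m * (x - of_int p)) = cis (2 * pi * of_int m * x)" for m p :: int and x
  proof -
    have "cis (2 * pi * of_int m * (x - of_int p)) = cis (2 * pi * of_int m * x) * cis (2 * pi * of_int (- m * p))"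
      by (simp add: cis_mult algebra_simps)
    then show ?thesis by (simp add: cis_multiple_2pi del: of_int_mult of_int_minus)
  qed
  have coeff_\<phi>: "integral {0..1} (\<lambda>x. \<phi> x * cis (2 * pi * m * x)) = of_real (C m)" for m :: int
  proof -
    define k where "k y = h y * cis (2 * pi * m * y)" for y
    have k: "(k has_integral of_real (C m)) UNIV"
    proof -
      have "k = (\<lambda>y. of_real (exp (- pi * c\<^sup>2 * y\<^sup>2)) * cis (2 * pi * (c * b + m) * y))"
        by (rule ext) (simp add: k_def h_def mult.assoc cis_mult, simp add: algebra_simps)
      moreover have "exp (- pi * (c * b + m)\<^sup>2 / c\<^sup>2) / c = C m"
        using c by (simp add: C_def field_simps power2_eq_square)
      ultimately show ?thesis using gauss_fourier[OF c, of "c * b + m"] by simp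
    qed
    have kc: "continuous_on S k" for S unfolding k_def h_def by (intro continuous_intros)
    have ki: "k integrable_on {u..v}" for u v by (intro integrable_continuous_real kc)
    have "((\<lambda>p. integral {0..1} (\<lambda>x. k (x - of_int p))) has_sum
        integral {0..1} (\<lambda>x. \<Sum>\<^sub>\<infinity>p. k (x - of_int p))) UNIV"
    proof (rule integral_infsum_uniform(2)[OF _ _ M])
      show "continuous_on {0..1} (\<lambda>x. k (x - of_int p))" for p
        by (rule continuous_on_compose2[OF kc[of UNIV]]) (auto intro!: continuous_intros)
      show "cmod (k (x - of_int p)) \<le> M p" if "x \<in> {0..1}" for x p
        using hM[OF that, of p] by (simp add: k_def norm_mult)
    qed
    moreover have "integral {0..1} (\<lambda>x. \<Sum>\<^sub>\<infinity>p. k (x - of_int p)) = integral {0..1} (\<lambda>x. \<phi> x * cis (2 * pi * m * x))"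
      by (rule integral_cong) (simp add: k_def \<phi>_def cis1 infsum_cmult_left summ_h)
    moreover have "integral {0..1} (\<lambda>x. k (x - of_int p)) = integral {- of_int p..1 - of_int p} k" for p :: int
      using integral_shift_Icc_real[of 0 1 k "- of_int p"] by (simp add: o_def)
    ultimately have hs: "((\<lambda>p :: int. integral {- of_int p..1 - of_int p} k) has_sum
        integral {0..1} (\<lambda>x. \<phi> x * cis (2 * pi * m * x))) UNIV" by simp
    \<comment> \<open>The index \<open>p\<close> stands for the interval from \<open>- p\<close> to
      \<open>1 - p\<close>, so the symmetric interval from \<open>- n\<close> to \<open>n\<close> is
      tiled by \<open>p\<close> from \<open>1 - n\<close> to \<open>n\<close>.\<close>
    have part: "(\<Sum>p\<in>{1 - int n..int n}. integral {- of_int p..1 - of_int p} k) = integral {- real n..real n} k" for n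
    proof (induction n)
      case (Suc n)
      have "{1 - int (Suc n)..int (Suc n)} = insert (int n + 1) (insert (- int n) {1 - int n..int n})" by auto
      then have "(\<Sum>p\<in>{1 - int (Suc n)..int (Suc n)}. integral {- of_int p..1 - of_int p} k)
          = integral {- 1 - real n..- real n} k + (integral {real n..1 + real n} k + integral {- real n..real n} k)"
        using Suc minus_diff_commute[of "real n" 1] by (simp add: add.commute)
      also have "\<dots> = integral {- 1 - real n..1 + real n} k"
        using Henstock_Kurzweil_Integration.integral_combine[where f = k and a = "- real n" and c = "real n" and b = "1 + real n"]
          Henstock_Kurzweil_Integration.integral_combine[where f = k and a = "- 1 - real n" and c = "- real n" and b = "1 + real n"] ki
        by (simp add: add.commute)
      finally show ?case by simp
    qed simp
    have "filterlim (\<lambda>n. {1 - int n..int n}) (finite_subsets_at_top UNIV) sequentially"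
      unfolding filterlim_finite_subsets_at_top
    proof (intro allI impI)
      fix X :: "int set" assume X: "finite X \<and> X \<subseteq> UNIV"
      have "X \<subseteq> {1 - int n..int n}" if "nat (Max (abs ` insert 0 X)) + 1 \<le> n" for n
      proof
        fix p assume "p \<in> X"
        then have "\<bar>p\<bar> \<le> Max (abs ` insert 0 X)" using X by (intro Max_ge) auto
        then show "p \<in> {1 - int n..int n}" using that by auto
      qed
      then show "\<forall>\<^sub>F n in sequentially. finite {1 - int n..int n} \<and> X \<subseteq> {1 - int n..int n} \<and> {1 - int n..int n} \<subseteq> UNIV"
        by (intro eventually_sequentiallyI[of "nat (Max (abs ` insert 0 X)) + 1"]) auto
    qed
    from filterlim_compose[OF hs[unfolded has_sum_def] this]
    have lim1: "(\<lambda>n. integral {- real n..real n} k) \<longlonglongrightarrow> integral {0..1} (\<lambda>x. \<phi> x * cis (2 * pi * m * x))"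
      by (simp only: part)
    have lim2: "(\<lambda>n. integral {- real n..real n} k) \<longlonglongrightarrow> of_real (C m)"
    proof (rule metric_LIMSEQ_I)
      fix e :: real assume "0 < e"
      then obtain B where B: "0 < B" "\<And>a b. ball 0 B \<subseteq> cbox a b \<Longrightarrow> norm (integral (cbox a b) k - of_real (C m)) < e"
        using k unfolding has_integral_alt' by auto
      have "dist (integral {- real n..real n} k) (of_real (C m)) < e" if "nat \<lceil>B\<rceil> \<le> n" for n
      proof -
        have "B \<le> real n" using that by linarith
        then have "ball 0 B \<subseteq> cbox (- real n) (real n)" by (auto simp: dist_real_def)
        from B(2)[OF this] show ?thesis by (simp add: dist_norm)
      qed
      then show "\<exists>N. \<forall>n\<ge>N. dist (integral {- real n..real n} k) (of_real (C m)) < e" by blast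
    qed
    show ?thesis by (rule LIMSEQ_unique[OF lim1 lim2])
  qed
  have coeff_\<psi>: "integral {0..1} (\<lambda>x. \<psi> x * cis (2 * pi * m * x)) = of_real (C m)" for m :: int
  proof -
    have eq: "of_real (C n) * cis (- 2 * pi * n * x) * cis (2 * pi * m * x) = of_real (C n) * cis (2 * pi * of_int (m - n) * x)" for n and x :: real
      by (simp add: mult.assoc cis_mult) (simp add: algebra_simps)
    have "((\<lambda>n. integral {0..1} (\<lambda>x. of_real (C n) * cis (2 * pi * of_int (m - n) * x))) has_sum
        integral {0..1} (\<lambda>x. \<Sum>\<^sub>\<infinity>n. of_real (C n) * cis (2 * pi * of_int (m - n) * x))) UNIV"
      by (rule integral_infsum_uniform(2)[OF _ _ C]) (auto intro!: continuous_intros simp: norm_mult C0)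
    moreover have "integral {0..1} (\<lambda>x. \<Sum>\<^sub>\<infinity>n. of_real (C n) * cis (2 * pi * of_int (m - n) * x)) = integral {0..1} (\<lambda>x. \<psi> x * cis (2 * pi * m * x))"
      unfolding \<psi>_def eq[symmetric]
      by (rule integral_cong) (intro infsum_cmult_left abs_summable_summable[OF Infinite_Sum.abs_summable_on_comparison_test'[OF C \<psi>M]])
    moreover have "integral {0..1} (\<lambda>x. of_real (C n) * cis (2 * pi * of_int (m - n) * x)) = (if n = m then of_real (C m) else 0)" for n
      using integral_cis[of "m - n"] by (simp del: of_int_diff)
    moreover have "((\<lambda>n. if n = m then complex_of_real (C m) else 0) has_sum of_real (C m)) UNIV"
      by (rule has_sum_finite_neutralI[of "{m}"]) auto
    ultimately show ?thesis by (simp add: has_sum_unique)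
  qed
  have cont\<phi>: "continuous_on {0..1} \<phi>" unfolding \<phi>_def by (rule integral_infsum_uniform(1)[OF conth hM M])
  have cont\<psi>: "continuous_on {0..1} \<psi>" unfolding \<psi>_def by (rule integral_infsum_uniform(1)[OF _ \<psi>M C]) (auto intro!: continuous_intros)
  have cont: "continuous_on {0..1} (\<lambda>x. \<phi> x - \<psi> x)"
    by (intro continuous_on_diff cont\<phi> cont\<psi>)
  have per_\<phi>: "\<phi> (x + of_int i) = \<phi> x" for x i
  proof -
    have "(\<Sum>\<^sub>\<infinity>p :: int. h (x + of_int i - of_int p)) = (\<Sum>\<^sub>\<infinity>p :: int. h (x - of_int p))"
      by (rule infsum_reindex_bij_witness[of _ "\<lambda>p. p + i" "\<lambda>p. p - i"]) (auto simp: algebra_simps)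
    then show ?thesis by (simp add: \<phi>_def)
  qed
  have per_\<psi>: "\<psi> (x + of_int i) = \<psi> x" for x i
    using cis1[of "- _" x "- i"] by (simp add: \<psi>_def)
  have "\<phi> x - \<psi> x = 0" if "x \<in> {0..1}" for x
  proof (rule fourier_uniqueness[OF cont _ _ that])
    show "\<phi> 0 - \<psi> 0 = \<phi> 1 - \<psi> 1" using per_\<phi>[of 0 1] per_\<psi>[of 0 1] by simp
    show "integral {0..1} (\<lambda>x. (\<phi> x - \<psi> x) * cis (2 * pi * n * x)) = 0" for n :: int
      unfolding left_diff_distrib
      by (subst integral_diff) (auto intro!: integrable_continuous_real continuous_intros cont\<phi> cont\<psi> simp: coeff_\<phi> coeff_\<psi>)
  qed
  from this[of "frac (a / c)"]
  have "\<phi> (frac (a / c) + of_int \<lfloor>a / c\<rfloor>) = \<psi> (frac (a / c) + of_int \<lfloor>a / c\<rfloor>)"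
    unfolding per_\<phi> per_\<psi> using frac_ge_0[of "a / c"] frac_lt_1[of "a / c"] by simp
  then have "\<phi> (a / c) = \<psi> (a / c)" by (simp add: frac_def)
  moreover have "h (a / c - of_int p) = of_real (exp (- pi * (c * p - a)\<^sup>2)) * cis (- 2 * pi * b * (c * p - a))" for p :: int
  proof -
    have "- pi * c\<^sup>2 * (a / c - of_int p)\<^sup>2 = - pi * (c * p - a)\<^sup>2"
      "2 * pi * (c * b) * (a / c - of_int p) = - 2 * pi * b * (c * p - a)"
      using c by (simp_all add: power2_eq_square field_simps)
    then show ?thesis by (simp only: h_def)
  qed
  moreover have "of_real (C n) * cis (- 2 * pi * n * (a / c)) = of_real (exp (- pi * (n / c + b)\<^sup>2) / c) * cis (- 2 * pi * a * n / c)" for n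
    by (simp add: C_def mult_ac)
  ultimately show ?thesis by (simp only: \<phi>_def \<psi>_def)
qed

section \<open>Gaussians on a planar lattice\<close>

lemma
  fixes f :: "'a \<Rightarrow> 'c::{real_normed_algebra, banach}" and g :: "'b \<Rightarrow> 'c"
  assumes f: "(\<lambda>x. norm (f x)) summable_on A" and g: "(\<lambda>y. norm (g y)) summable_on B"
  shows abs_summable_times: "(\<lambda>(x, y). norm (f x * g y)) summable_on A \<times> B"
    and infsum_times: "(\<Sum>\<^sub>\<infinity>(x, y)\<in>A \<times> B. f x * g y) = infsum f A * infsum g B"
proof -
  have "(\<lambda>(x, y). norm (f x) * norm (g y)) summable_on A \<times> B"
  proof (rule summable_on_SigmaI)
    show "((\<lambda>y. case (x, y) of (x, y) \<Rightarrow> norm (f x) * norm (g y)) has_sum norm (f x) * infsum (\<lambda>y. norm (g y)) B) B" for x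
      using has_sum_cmult_right[OF has_sum_infsum[OF g]] by simp
    show "(\<lambda>x. norm (f x) * infsum (\<lambda>y. norm (g y)) B) summable_on A"
      by (rule summable_on_cmult_left[OF f])
  qed auto
  then show n: "(\<lambda>(x, y). norm (f x * g y)) summable_on A \<times> B"
    by (rule summable_on_comparison_test) (auto simp: norm_mult_ineq)
  have s: "(\<lambda>(x, y). f x * g y) summable_on A \<times> B"
    by (rule abs_summable_summable) (use n in \<open>simp add: case_prod_unfold\<close>)
  have "(\<Sum>\<^sub>\<infinity>(x, y)\<in>A \<times> B. f x * g y) = (\<Sum>\<^sub>\<infinity>x\<in>A. \<Sum>\<^sub>\<infinity>y\<in>B. f x * g y)"
    using infsum_Sigma'_banach[OF s] by simp
  also have "\<dots> = (\<Sum>\<^sub>\<infinity>x\<in>A. f x * infsum g B)"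
    using has_sum_bounded_linear[OF bounded_linear_mult_right has_sum_infsum[OF abs_summable_summable[OF g]]]
    by (intro infsum_cong) (auto intro: infsumI)
  also have "\<dots> = infsum f A * infsum g B"
    using has_sum_bounded_linear[OF bounded_linear_mult_left has_sum_infsum[OF abs_summable_summable[OF f]]]
    by (auto intro: infsumI)
  finally show "(\<Sum>\<^sub>\<infinity>(x, y)\<in>A \<times> B. f x * g y) = infsum f A * infsum g B" .
qed

text \<open>Shifting the summation index by the floor of \<open>a\<close> reduces the centre to the
  unit interval, where one majorant serves for all centres.\<close>

lemma infsum_gauss_int_bound:
  assumes "0 < K"
  shows "\<exists>B\<ge>0. \<forall>a. (\<Sum>\<^sub>\<infinity>p :: int. exp (- K * (real_of_int p - a)\<^sup>2)) \<le> B"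
proof (intro exI conjI allI)
  let ?B = "\<Sum>\<^sub>\<infinity>p :: int. exp K * exp (- (K / 2) * (real_of_int p - 0)\<^sup>2)"
  have s: "(\<lambda>p :: int. exp K * exp (- (K / 2) * (real_of_int p - 0)\<^sup>2)) summable_on UNIV"
    using assms by (intro summable_on_cmult_right summable_gauss_int) auto
  show "0 \<le> ?B" by (intro infsum_nonneg) auto
  fix a :: real
  have "(\<Sum>\<^sub>\<infinity>p :: int. exp (- K * (real_of_int p - a)\<^sup>2)) = (\<Sum>\<^sub>\<infinity>p :: int. exp (- K * (real_of_int p - frac a)\<^sup>2))"
    by (rule infsum_reindex_bij_witness[of _ "\<lambda>p. p + \<lfloor>a\<rfloor>" "\<lambda>p. p - \<lfloor>a\<rfloor>"]) (auto simp: frac_def algebra_simps)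
  also have "\<dots> \<le> ?B"
  proof (intro infsum_mono s summable_gauss_int assms)
    fix p :: int
    have "0 \<le> 2 * (real_of_int p / 2 - frac a)\<^sup>2" by simp
    moreover have "(frac a)\<^sup>2 \<le> 1" using frac_lt_1[of a] by (simp add: power_le_one)
    ultimately have "- (real_of_int p - frac a)\<^sup>2 \<le> 1 - (real_of_int p)\<^sup>2 / 2"
      by (simp add: power2_eq_square algebra_simps)
    then have "K * - (real_of_int p - frac a)\<^sup>2 \<le> K * (1 - (real_of_int p)\<^sup>2 / 2)"
      using assms by (intro mult_left_mono) auto
    then show "exp (- K * (real_of_int p - frac a)\<^sup>2) \<le> exp K * exp (- (K / 2) * (real_of_int p - 0)\<^sup>2)"
      by (simp add: exp_add[symmetric] algebra_simps)
  qed
  finally show "(\<Sum>\<^sub>\<infinity>p :: int. exp (- K * (real_of_int p - a)\<^sup>2)) \<le> ?B" .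
qed

definition lat :: "real \<Rightarrow> int \<times> int \<Rightarrow> complex" where
  "lat c = (\<lambda>(j, k). Complex (c * j) (c * k))"

text \<open>The adjoint lattice: \<open>Im (cnj (lat c x) * dual c y)\<close> is an integer.\<close>

definition dual :: "real \<Rightarrow> int \<times> int \<Rightarrow> complex" where
  "dual c = (\<lambda>(l, n). Complex (l / c) (- (n / c)))"

lemma exp_lat:
  assumes "0 < c"
  shows "exp (- K * (cmod (lat c (p, s) - w))\<^sup>2)
    = exp (- (K * c\<^sup>2) * (p - Re w / c)\<^sup>2) * exp (- (K * c\<^sup>2) * (s - Im w / c)\<^sup>2)"
proof -
  have "(cmod (lat c (p, s) - w))\<^sup>2 = (c * p - Re w)\<^sup>2 + (c * s - Im w)\<^sup>2"
    by (simp add: lat_def cmod_power2)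
  also have "\<dots> = c\<^sup>2 * (p - Re w / c)\<^sup>2 + c\<^sup>2 * (s - Im w / c)\<^sup>2"
    using assms by (simp add: field_simps power2_eq_square)
  finally show ?thesis by (simp add: exp_add[symmetric] algebra_simps)
qed

lemma
  assumes "0 < c" "0 < K"
  shows summable_gauss_lat: "(\<lambda>x. exp (- K * (cmod (lat c x - w))\<^sup>2)) summable_on UNIV"
    and infsum_gauss_lat: "(\<Sum>\<^sub>\<infinity>x. exp (- K * (cmod (lat c x - w))\<^sup>2))
      = (\<Sum>\<^sub>\<infinity>p :: int. exp (- (K * c\<^sup>2) * (p - Re w / c)\<^sup>2)) * (\<Sum>\<^sub>\<infinity>s :: int. exp (- (K * c\<^sup>2) * (s - Im w / c)\<^sup>2))"
proof -
  have "0 < K * c\<^sup>2" using assms by simp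
  note s = summable_gauss_int[OF this]
  have e: "(\<lambda>(p, s). exp (- K * (cmod (lat c (p, s) - w))\<^sup>2)) = (\<lambda>x. exp (- K * (cmod (lat c x - w))\<^sup>2))"
    by auto
  show "(\<lambda>x. exp (- K * (cmod (lat c x - w))\<^sup>2)) summable_on UNIV"
    using abs_summable_times[of "\<lambda>p :: int. exp (- (K * c\<^sup>2) * (p - Re w / c)\<^sup>2)" UNIV
        "\<lambda>s :: int. exp (- (K * c\<^sup>2) * (s - Im w / c)\<^sup>2)" UNIV] s
    unfolding e[symmetric] exp_lat[OF assms(1)] by (simp add: abs_mult)
  show "(\<Sum>\<^sub>\<infinity>x. exp (- K * (cmod (lat c x - w))\<^sup>2))
      = (\<Sum>\<^sub>\<infinity>p :: int. exp (- (K * c\<^sup>2) * (p - Re w / c)\<^sup>2)) * (\<Sum>\<^sub>\<infinity>s :: int. exp (- (K * c\<^sup>2) * (s - Im w / c)\<^sup>2))"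
    using infsum_times[of "\<lambda>p :: int. exp (- (K * c\<^sup>2) * (p - Re w / c)\<^sup>2)" UNIV
        "\<lambda>s :: int. exp (- (K * c\<^sup>2) * (s - Im w / c)\<^sup>2)" UNIV] s
    unfolding e[symmetric] exp_lat[OF assms(1)] by simp
qed

lemma infsum_gauss_lat_bound:
  assumes "0 < c" "0 < K"
  shows "\<exists>B\<ge>0. \<forall>w. (\<Sum>\<^sub>\<infinity>x. exp (- K * (cmod (lat c x - w))\<^sup>2)) \<le> B"
proof -
  have "0 < K * c\<^sup>2" using assms by simp
  from infsum_gauss_int_bound[OF this]
  obtain B where B: "0 \<le> B" "\<And>a. (\<Sum>\<^sub>\<infinity>p :: int. exp (- (K * c\<^sup>2) * (real_of_int p - a)\<^sup>2)) \<le> B" by blast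
  have "(\<Sum>\<^sub>\<infinity>x. exp (- K * (cmod (lat c x - w))\<^sup>2)) \<le> B * B" for w
    unfolding infsum_gauss_lat[OF assms] by (intro mult_mono B infsum_nonneg) auto
  then show ?thesis using B(1) by (intro exI[of _ "B * B"]) auto
qed

text \<open>Half of the Gaussian exponent pays for the linear weight; the other half remains for
  summation over a lattice.\<close>

lemma weight_gauss_le:
  assumes "0 \<le> t" shows "(1 + t) * exp (- pi / 2 * t\<^sup>2) \<le> 2 * exp (- pi / 4 * t\<^sup>2)"
proof -
  have "0 \<le> (t / 2 - 1)\<^sup>2" by simp
  then have "t \<le> 1 + t\<^sup>2 / 4" by (simp add: power2_eq_square field_simps)
  also have "\<dots> \<le> 1 + 2 * (pi / 4 * t\<^sup>2)" using mult_right_mono[of 1 "2 * pi" "t\<^sup>2"] pi_gt3 by simp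
  finally have "1 + t \<le> 2 * (1 + pi / 4 * t\<^sup>2)" by simp
  also have "\<dots> \<le> 2 * exp (pi / 4 * t\<^sup>2)" by (intro mult_left_mono exp_ge_add_one_self) simp
  finally have "(1 + t) * exp (- pi / 2 * t\<^sup>2) \<le> (2 * exp (pi / 4 * t\<^sup>2)) * exp (- pi / 2 * t\<^sup>2)"
    by (rule mult_right_mono) simp
  also have "\<dots> = 2 * exp (- pi / 4 * t\<^sup>2)" by (simp add: exp_add[symmetric])
  finally show ?thesis .
qed

text \<open>Up to \<open>c^2\<close>, the overlap of the coherent states centred at \<open>x\<close>
  and \<open>w\<close>. The factor \<open>c^2\<close> normalises the coefficient of the dual point 0
  in \<open>gauss_convolution\<close> to 1.\<close>

definition gauss :: "real \<Rightarrow> complex \<Rightarrow> complex \<Rightarrow> complex" where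
  "gauss c w x = of_real (c\<^sup>2 * exp (- pi / 2 * (cmod (x - w))\<^sup>2)) * cis (- pi * Im (cnj x * w))"

definition twist :: "complex \<Rightarrow> complex \<Rightarrow> complex" where
  "twist x y = cis (- pi * Im (cnj x * y))"

definition dual_coeff :: "real \<Rightarrow> complex \<Rightarrow> int \<times> int \<Rightarrow> complex" where
  "dual_coeff c w y = of_real (exp (- pi / 2 * (cmod (dual c y))\<^sup>2)) * cis (pi * Im (cnj (dual c y) * w))"

lemma norm_gauss: "cmod (gauss c w x) = c\<^sup>2 * exp (- pi / 2 * (cmod (x - w))\<^sup>2)"
  by (simp add: gauss_def norm_mult norm_power)

lemma norm_twist [simp]: "cmod (twist x y) = 1"
  by (simp add: twist_def)

lemma norm_dual_coeff: "cmod (dual_coeff c w y) = exp (- pi / 2 * (cmod (dual c y))\<^sup>2)"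
  by (simp add: dual_coeff_def norm_mult)

lemma exp_cis: "of_real (exp r) * cis t = exp (Complex r t)"
  by (simp add: exp_eq_polar)

lemma gauss_exp: "gauss c w x = of_real (c\<^sup>2) * exp (Complex (- pi / 2 * (cmod (x - w))\<^sup>2) (- pi * Im (cnj x * w)))"
  unfolding gauss_def exp_cis[symmetric] by simp

lemma twist_exp: "twist x y = exp (Complex 0 (- pi * Im (cnj x * y)))"
  unfolding twist_def exp_cis[symmetric] by simp

text \<open>The duality of a Gabor lattice and its adjoint lattice, by hand. Completing the square
  separates the summand into Gaussians in the two coordinates of the lattice, each transformed by
  \<open>poisson_gauss\<close>. The phase exchanges coordinates: the sum over \<open>p\<close>
  becomes the sum over \<open>n\<close>, and the sum over \<open>s\<close> the one over
  \<open>l\<close>.\<close>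

lemma gauss_convolution:
  assumes c: "0 < c"
  shows "(\<Sum>\<^sub>\<infinity>x. gauss c 0 (lat c x) * gauss c w (lat c (j, k) - lat c x) * twist (lat c x) (lat c (j, k)))
    = (\<Sum>\<^sub>\<infinity>y. dual_coeff c w y * gauss c (w + dual c y) (lat c (j, k)))"
proof -
  \<comment> \<open>With \<open>v = lat c (j, k) - w\<close>, the point \<open>a1 + \<i> a2\<close>
    is \<open>v / 2\<close>, the minimum of \<open>|x|^2 + |v - x|^2\<close>.\<close>
  define a1 where "a1 = (c * j - Re w) / 2"
  define a2 where "a2 = (c * k - Im w) / 2"
  define E :: complex where "E = of_real (c ^ 4) * exp (Complex (- pi * (a1\<^sup>2 + a2\<^sup>2)) (- pi * (c * j * Im w - c * k * Re w)))"
  define f where "f p = of_real (exp (- pi * (c * p - a1)\<^sup>2)) * cis (- 2 * pi * a2 * (c * p - a1))" for p :: int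
  define g where "g s = of_real (exp (- pi * (c * s - a2)\<^sup>2)) * cis (- 2 * pi * (- a1) * (c * s - a2))" for s :: int
  define f' where "f' n = of_real (exp (- pi * (n / c + a2)\<^sup>2) / c) * cis (- 2 * pi * a1 * n / c)" for n :: int
  define g' where "g' l = of_real (exp (- pi * (l / c + (- a1))\<^sup>2) / c) * cis (- 2 * pi * a2 * l / c)" for l :: int
  have c2: "0 < pi * c\<^sup>2" "0 < pi / c\<^sup>2" using c by auto
  have sf: "(\<lambda>p. norm (f p)) summable_on UNIV" and sg: "(\<lambda>p. norm (g p)) summable_on UNIV"
  proof -
    have "pi * (c * p - a)\<^sup>2 = (pi * c\<^sup>2) * (p - a / c)\<^sup>2" for p a
      using c by (simp add: field_simps power2_eq_square)
    then have "(\<lambda>p :: int. exp (- pi * (c * p - a)\<^sup>2)) summable_on UNIV" for a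
      using summable_gauss_int[OF c2(1), of "a / c"] by (simp only: minus_mult_left[symmetric])
    then show "(\<lambda>p. norm (f p)) summable_on UNIV" "(\<lambda>p. norm (g p)) summable_on UNIV"
      by (simp_all add: f_def g_def norm_mult)
  qed
  have sf': "(\<lambda>p. norm (f' p)) summable_on UNIV" and sg': "(\<lambda>p. norm (g' p)) summable_on UNIV"
  proof -
    have "pi * (n / c + a)\<^sup>2 = (pi / c\<^sup>2) * (n - (- a * c))\<^sup>2" for n a
      using c by (simp add: field_simps power2_eq_square)
    then have "(\<lambda>n :: int. exp (- pi * (n / c + a)\<^sup>2)) summable_on UNIV" for a
      using summable_gauss_int[OF c2(2), of "- a * c"] by (simp only: minus_mult_left[symmetric])
    then have "(\<lambda>n :: int. exp (- pi * (n / c + a)\<^sup>2) * (1 / c)) summable_on UNIV" for a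
      by (rule summable_on_cmult_left)
    from this[of a2] this[of "- a1"]
    show "(\<lambda>p. norm (f' p)) summable_on UNIV" "(\<lambda>p. norm (g' p)) summable_on UNIV"
      using c by (simp_all add: f'_def g'_def norm_mult norm_divide del: of_real_divide of_real_exp)
  qed
  have c4: "complex_of_real (c ^ 4) = of_real (c\<^sup>2) * of_real (c\<^sup>2)"
    by (simp flip: power_add)
  have L: "gauss c 0 (lat c (p, s)) * gauss c w (lat c (j, k) - lat c (p, s)) * twist (lat c (p, s)) (lat c (j, k))
      = E * (f p * g s)" for p s
  proof -
    let ?x = "lat c (p, s)" and ?y = "lat c (j, k)"
    have "gauss c 0 ?x * gauss c w (?y - ?x) * twist ?x ?y = of_real (c ^ 4) *
      exp (Complex (- pi / 2 * (cmod (?x - 0))\<^sup>2) (- pi * Im (cnj ?x * 0))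
        + Complex (- pi / 2 * (cmod (?y - ?x - w))\<^sup>2) (- pi * Im (cnj (?y - ?x) * w))
        + Complex 0 (- pi * Im (cnj ?x * ?y)))"
      unfolding gauss_exp twist_exp c4 exp_add by (simp only: mult_ac)
    also have "(cmod (?x - 0))\<^sup>2 = (c * p)\<^sup>2 + (c * s)\<^sup>2" by (simp add: lat_def cmod_power2)
    also have "(cmod (?y - ?x - w))\<^sup>2 = (c * j - c * p - Re w)\<^sup>2 + (c * k - c * s - Im w)\<^sup>2"
      by (simp add: lat_def cmod_power2)
    also have "of_real (c ^ 4) * exp (Complex (- pi / 2 * ((c * p)\<^sup>2 + (c * s)\<^sup>2)) (- pi * Im (cnj ?x * 0))
        + Complex (- pi / 2 * ((c * j - c * p - Re w)\<^sup>2 + (c * k - c * s - Im w)\<^sup>2)) (- pi * Im (cnj (?y - ?x) * w))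
        + Complex 0 (- pi * Im (cnj ?x * ?y)))
      = of_real (c ^ 4) * exp (Complex (- pi * (a1\<^sup>2 + a2\<^sup>2)) (- pi * (c * j * Im w - c * k * Re w))
        + (Complex (- pi * (c * p - a1)\<^sup>2) (- 2 * pi * a2 * (c * p - a1))
        + Complex (- pi * (c * s - a2)\<^sup>2) (- 2 * pi * (- a1) * (c * s - a2))))"
      by (rule arg_cong[where f = "\<lambda>z. of_real (c ^ 4) * exp z"])
        (simp add: a1_def a2_def lat_def complex_eq_iff power2_eq_square field_simps)
    also have "\<dots> = E * (f p * g s)"
      unfolding E_def f_def g_def exp_cis exp_add by (simp only: mult_ac)
    finally show ?thesis .
  qed
  have R: "dual_coeff c w (l, n) * gauss c (w + dual c (l, n)) (lat c (j, k)) = E * (g' l * f' n)" for l n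
  proof -
    let ?d = "dual c (l, n)" and ?y = "lat c (j, k)"
    \<comment> \<open>The exponents of the two sides agree only up to this multiple of
      \<open>2 pi \<i>\<close>; here the duality of the two lattices enters.\<close>
    have z: "exp (Complex 0 (2 * pi * of_int (j * n + k * l))) = 1"
      using exp_cis[of 0 "2 * pi * of_int (j * n + k * l)"] cis_multiple_2pi[of "of_int (j * n + k * l)"] by simp
    have "dual_coeff c w (l, n) * gauss c (w + ?d) ?y = of_real (c\<^sup>2) *
      exp (Complex (- pi / 2 * (cmod ?d)\<^sup>2) (pi * Im (cnj ?d * w))
        + Complex (- pi / 2 * (cmod (?y - (w + ?d)))\<^sup>2) (- pi * Im (cnj ?y * (w + ?d))))"
      unfolding gauss_exp dual_coeff_def exp_cis exp_add by (simp only: mult_ac)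
    also have "(cmod ?d)\<^sup>2 = (l / c)\<^sup>2 + (n / c)\<^sup>2" by (simp add: dual_def cmod_power2)
    also have "(cmod (?y - (w + ?d)))\<^sup>2 = (c * j - (Re w + l / c))\<^sup>2 + (c * k - (Im w - n / c))\<^sup>2"
      by (simp add: dual_def lat_def cmod_power2)
    also have "of_real (c\<^sup>2) *
      exp (Complex (- pi / 2 * ((l / c)\<^sup>2 + (n / c)\<^sup>2)) (pi * Im (cnj ?d * w))
        + Complex (- pi / 2 * ((c * j - (Re w + l / c))\<^sup>2 + (c * k - (Im w - n / c))\<^sup>2)) (- pi * Im (cnj ?y * (w + ?d))))
      = of_real (c\<^sup>2) * exp (Complex (- pi * (a1\<^sup>2 + a2\<^sup>2)) (- pi * (c * j * Im w - c * k * Re w))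
        + (Complex (- pi * (l / c + (- a1))\<^sup>2) (- 2 * pi * a2 * l / c)
        + Complex (- pi * (n / c + a2)\<^sup>2) (- 2 * pi * a1 * n / c))
        + Complex 0 (2 * pi * of_int (j * n + k * l)))"
      using c by (intro arg_cong[where f = "\<lambda>z. of_real (c\<^sup>2) * exp z"])
        (simp add: a1_def a2_def lat_def dual_def complex_eq_iff power2_eq_square field_simps)
    also have "\<dots> = E * (g' l * f' n)"
      using c unfolding E_def f'_def g'_def of_real_divide times_divide_eq_left exp_cis exp_add z c4
      by (simp add: power2_eq_square)
    finally show ?thesis .
  qed
  have "(\<Sum>\<^sub>\<infinity>x. gauss c 0 (lat c x) * gauss c w (lat c (j, k) - lat c x) * twist (lat c x) (lat c (j, k)))
      = (\<Sum>\<^sub>\<infinity>(p, s). E * (f p * g s))"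
    by (rule infsum_cong) (auto simp: L)
  also have "\<dots> = E * (infsum f UNIV * infsum g UNIV)"
    using infsum_times[OF sf sg] by (simp add: case_prod_unfold infsum_cmult_right')
  also have "infsum f UNIV = infsum f' UNIV" unfolding f_def f'_def by (rule poisson_gauss[OF c])
  also have "infsum g UNIV = infsum g' UNIV" unfolding g_def g'_def using poisson_gauss[OF c, of a2 "- a1"] by simp
  also have "E * (infsum f' UNIV * infsum g' UNIV) = (\<Sum>\<^sub>\<infinity>(l, n). E * (g' l * f' n))"
    using infsum_times[OF sg' sf'] by (simp add: case_prod_unfold infsum_cmult_right' mult.commute)
  also have "\<dots> = (\<Sum>\<^sub>\<infinity>y. dual_coeff c w y * gauss c (w + dual c y) (lat c (j, k)))"
    by (rule infsum_cong) (auto simp: R)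
  finally show ?thesis .
qed

text \<open>Source of the bound \<open>1/8\<close>: it gives \<open>pi / (4 c^2) >= 6\<close>, so
  \<open>r <= exp (- 6) <= 1/20\<close>. The two geometric series without their common centre add up
  to \<open>8 r / (1 - r)^2\<close>, which is below \<open>1/2\<close>. This \<open>1/2\<close> is
  the contraction factor of the iteration in \<open>T_induct\<close>.\<close>

lemma dual_sum:
  assumes c: "0 < c" "c\<^sup>2 \<le> 1 / 8"
  shows "(\<lambda>y. exp (- pi / 2 * (cmod (dual c y))\<^sup>2) * (1 + cmod (dual c y))) summable_on UNIV - {(0, 0)}"
    and "(\<Sum>\<^sub>\<infinity>y\<in>UNIV - {(0, 0)}. exp (- pi / 2 * (cmod (dual c y))\<^sup>2) * (1 + cmod (dual c y))) \<le> 1 / 2"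
proof -
  define r where "r = exp (- (pi / (4 * c\<^sup>2)))"
  define T where "T = (\<lambda>(l, n). r ^ nat \<bar>l\<bar> * r ^ nat \<bar>n :: int\<bar>)"
  have r: "0 < r" "r \<le> 1 / 20"
  proof -
    have "6 \<le> 3 / (4 * (1 / 8 :: real))" by simp
    also have "\<dots> \<le> pi / (4 * c\<^sup>2)" using c pi_gt3 by (intro frac_le) auto
    finally have "r \<le> exp (- 6)" by (simp add: r_def)
    also have "\<dots> = inverse (exp 1) ^ 6" using exp_of_nat_mult[of 6 "- 1 :: real"] by (simp add: exp_minus)
    also have "\<dots> \<le> (1 / 2) ^ 6"
      using exp_ge_add_one_self[of 1] by (intro power_mono) (auto simp: field_simps)
    finally show "r \<le> 1 / 20" by (simp add: power_numeral_reduce)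
  qed (simp add: r_def)
  have hr: "((\<lambda>p :: int. r ^ nat \<bar>p\<bar>) has_sum (1 + r) / (1 - r)) UNIV"
    using r by (intro has_sum_geometric_int) auto
  then have nr: "(\<lambda>p :: int. norm (r ^ nat \<bar>p\<bar>)) summable_on UNIV"
    using r(1) by (auto simp: summable_on_def)
  have Ts: "T summable_on UNIV"
    using abs_summable_times[OF nr nr] r(1) by (simp add: T_def case_prod_unfold)
  have Ti: "infsum T UNIV = ((1 + r) / (1 - r)) * ((1 + r) / (1 - r))"
    using infsum_times[OF nr nr] infsumI[OF hr] by (simp add: T_def)
  have "(T has_sum infsum T UNIV - T (0, 0)) (UNIV - {(0, 0)})"
    using has_sum_Diff[OF has_sum_infsum[OF Ts] has_sum_finite[of "{(0, 0)}" T]] by simp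
  then have hT: "((\<lambda>y. 2 * T y) has_sum 2 * (infsum T UNIV - T (0, 0))) (UNIV - {(0, 0)})"
    by (rule has_sum_cmult_right)
  have le: "exp (- pi / 2 * (cmod (dual c y))\<^sup>2) * (1 + cmod (dual c y)) \<le> 2 * T y" for y
  proof -
    obtain l n where y: "y = (l, n)" by (cases y)
    have "(cmod (dual c y))\<^sup>2 = ((real_of_int l)\<^sup>2 + (real_of_int n)\<^sup>2) / c\<^sup>2"
      by (simp add: y dual_def cmod_power2 power_divide add_divide_distrib)
    then have e: "exp (- pi / 4 * (cmod (dual c y))\<^sup>2)
        = exp (- (pi / (4 * c\<^sup>2)) * (real_of_int l)\<^sup>2) * exp (- (pi / (4 * c\<^sup>2)) * (real_of_int n)\<^sup>2)"
      by (simp add: exp_add[symmetric] add_divide_distrib distrib_left)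
    have "exp (- pi / 2 * (cmod (dual c y))\<^sup>2) * (1 + cmod (dual c y)) \<le> 2 * exp (- pi / 4 * (cmod (dual c y))\<^sup>2)"
      using weight_gauss_le[of "cmod (dual c y)"] by (simp add: mult.commute)
    also have "\<dots> \<le> 2 * T y"
      unfolding e unfolding T_def y r_def split by (intro mult_left_mono mult_mono exp_neg_square_le) auto
    finally show ?thesis by simp
  qed
  show s: "(\<lambda>y. exp (- pi / 2 * (cmod (dual c y))\<^sup>2) * (1 + cmod (dual c y))) summable_on UNIV - {(0, 0)}"
    by (rule summable_on_comparison_test[OF has_sum_imp_summable[OF hT] le]) auto
  have "(\<Sum>\<^sub>\<infinity>y\<in>UNIV - {(0, 0)}. exp (- pi / 2 * (cmod (dual c y))\<^sup>2) * (1 + cmod (dual c y))) \<le> 2 * (infsum T UNIV - T (0, 0))"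
    using infsum_mono[OF s has_sum_imp_summable[OF hT] le] infsumI[OF hT] by simp
  also have "\<dots> = 8 * r / ((1 - r) * (1 - r))"
  proof -
    have "infsum T UNIV - 1 = ((1 + r) * (1 + r) - (1 - r) * (1 - r)) / ((1 - r) * (1 - r))"
      using r unfolding Ti by (simp add: diff_divide_distrib)
    moreover have "(1 + r) * (1 + r) - (1 - r) * (1 - r) = 4 * r" by (simp add: algebra_simps)
    ultimately show ?thesis by (simp add: T_def)
  qed
  also have "\<dots> \<le> 8 * (1 / 20) / ((19 / 20) * (19 / 20))"
    using r by (intro frac_le mult_mono) auto
  also have "\<dots> \<le> 1 / 2" by simp
  finally show "(\<Sum>\<^sub>\<infinity>y\<in>UNIV - {(0, 0)}. exp (- pi / 2 * (cmod (dual c y))\<^sup>2) * (1 + cmod (dual c y))) \<le> 1 / 2" .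
qed

section \<open>Projections from Weyl systems\<close>

lemma summable_norm_scal:
  assumes "(\<lambda>x. cmod (a x) * B x) summable_on I" "\<And>x. x \<in> I \<Longrightarrow> norm (X x) \<le> B x"
  shows "(\<lambda>x. norm (scal (a x) * X x)) summable_on I"
  by (rule summable_on_comparison_test[OF assms(1)]) (auto intro!: mult_left_mono assms(2))

lemma has_sum_mult_left_bop: "(f has_sum S) I \<Longrightarrow> ((\<lambda>x. A * f x) has_sum A * S) I" for A :: "'i bop"
  by (rule has_sum_bounded_linear[OF bounded_linear_mult_right])

lemma norm_infsum_bop_le:
  assumes "(\<lambda>x. norm (X x :: 'i bop)) summable_on I" "\<And>x. x \<in> I \<Longrightarrow> norm (X x) \<le> B x" "B summable_on I"
  shows "norm (infsum X I) \<le> infsum B I"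
  by (rule norm_infsum_le[OF has_sum_infsum[OF abs_summable_summable[OF assms(1)]] has_sum_infsum[OF assms(3)]])
    (rule assms(2))

text \<open>\<open>Q\<close> records where the commutator maps: \<open>Q = 1 - P\<close> expresses
  that its range lies in that of \<open>P\<close>, while \<open>Q = 0\<close> leaves only the norm
  bound. Both cases then share one induction.\<close>

definition commutator_bound :: "('i \<Rightarrow> complex) \<Rightarrow> 'i bop \<Rightarrow> 'i bop \<Rightarrow> real \<Rightarrow> bool" where
  "commutator_bound f Q X B \<longleftrightarrow> (\<exists>Y. commutator f X Y \<and> Q * Y = 0 \<and> norm Y \<le> B)"

text \<open>Multiplication by an unbounded \<open>f\<close> is not continuous, but at a single
  coordinate it is a scalar factor and passes through the sum.\<close>

lemma commutator_infsum:
  fixes f :: "'i \<Rightarrow> complex" and X Y :: "'a \<Rightarrow> 'i bop"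
  assumes X: "(X has_sum X') I" and Y: "(Y has_sum Y') I"
    and c: "\<And>x. x \<in> I \<Longrightarrow> commutator f (X x) (Y x)"
  shows "commutator f X' Y'"
  unfolding commutator_def
proof (intro allI impI)
  fix v w :: "'i ell2" and i :: 'i assume vw: "\<forall>i. coord w i = f i * coord v i"
  have bl: "bounded_linear (\<lambda>A. coord (app A v) i)" for v
    by (rule bounded_linear_compose[OF bounded_linear_coord bounded_linear_app_left])
  have 1: "((\<lambda>x. f i * coord (app (X x) v) i) has_sum f i * coord (app X' v) i) I"
    by (rule has_sum_cmult_right[OF has_sum_bounded_linear[OF bl X]])
  have 2: "((\<lambda>x. coord (app (X x) w) i + coord (app (Y x) v) i) has_sum coord (app X' w) i + coord (app Y' v) i) I"
    by (intro has_sum_add has_sum_bounded_linear[OF bl X] has_sum_bounded_linear[OF bl Y])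
  have "((\<lambda>x. f i * coord (app (X x) v) i) has_sum coord (app X' w) i + coord (app Y' v) i) I"
    by (rule has_sum_cong[THEN iffD2, OF _ 2]) (use vw in \<open>auto intro: commutatorD[OF c]\<close>)
  from has_sum_unique[OF 1 this]
  show "f i * coord (app X' v) i = coord (app X' w) i + coord (app Y' v) i" .
qed

lemma commutator_scal: "commutator f X Y \<Longrightarrow> commutator f (scal a * X) (scal a * Y)"
  by (auto simp: commutator_def algebra_simps)

lemma commutator_bound_infsum:
  assumes b: "\<And>x. x \<in> I \<Longrightarrow> commutator_bound f Q (X x) (B x)"
    and s: "(\<lambda>x. cmod (a x) * B x) summable_on I" "(\<lambda>x. norm (scal (a x) * X x)) summable_on I"
  shows "commutator_bound f Q (\<Sum>\<^sub>\<infinity>x\<in>I. scal (a x) * X x) (\<Sum>\<^sub>\<infinity>x\<in>I. cmod (a x) * B x)"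
proof -
  obtain Y where Y: "\<And>x. x \<in> I \<Longrightarrow> commutator f (X x) (Y x)" "\<And>x. x \<in> I \<Longrightarrow> Q * Y x = 0"
      "\<And>x. x \<in> I \<Longrightarrow> norm (Y x) \<le> B x"
    using b unfolding commutator_bound_def by metis
  have n: "(\<lambda>x. norm (scal (a x) * Y x)) summable_on I"
    by (rule summable_norm_scal[OF s(1) Y(3)])
  have hY: "((\<lambda>x. scal (a x) * Y x) has_sum (\<Sum>\<^sub>\<infinity>x\<in>I. scal (a x) * Y x)) I"
    by (rule has_sum_infsum[OF abs_summable_summable[OF n]])
  have "commutator f (\<Sum>\<^sub>\<infinity>x\<in>I. scal (a x) * X x) (\<Sum>\<^sub>\<infinity>x\<in>I. scal (a x) * Y x)"
    by (rule commutator_infsum[OF has_sum_infsum[OF abs_summable_summable[OF s(2)]] hY]) (rule commutator_scal[OF Y(1)])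
  moreover have "Q * (\<Sum>\<^sub>\<infinity>x\<in>I. scal (a x) * Y x) = 0"
  proof -
    have "Q * (scal (a x) * Y x) = 0" if "x \<in> I" for x
      using Y(2)[OF that] by (simp add: scal_commute flip: mult.assoc) (simp add: mult.assoc)
    then have "((\<lambda>x. 0) has_sum Q * (\<Sum>\<^sub>\<infinity>x\<in>I. scal (a x) * Y x)) I"
      using has_sum_mult_left_bop[OF hY, of Q] by (simp cong: has_sum_cong)
    then show ?thesis by (metis has_sum_0 has_sum_unique)
  qed
  moreover have "norm (\<Sum>\<^sub>\<infinity>x\<in>I. scal (a x) * Y x) \<le> (\<Sum>\<^sub>\<infinity>x\<in>I. cmod (a x) * B x)"
    by (rule norm_infsum_bop_le[OF n _ s(1)]) (auto intro!: mult_left_mono Y(3))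
  ultimately show ?thesis unfolding commutator_bound_def by blast
qed

lemma commutator_bound_mono: "commutator_bound f Q X B \<Longrightarrow> B \<le> B' \<Longrightarrow> commutator_bound f Q X B'"
  unfolding commutator_bound_def by (meson order_trans)

lemma gauss_weight_bound:
  assumes "0 < c"
  shows "\<exists>C\<ge>0. \<forall>w. (\<lambda>x. cmod (gauss c w (lat c x)) * (1 + cmod (lat c x - w))) summable_on UNIV \<and>
    (\<Sum>\<^sub>\<infinity>x. cmod (gauss c w (lat c x)) * (1 + cmod (lat c x - w))) \<le> C"
proof -
  obtain B where B: "0 \<le> B" "\<And>w. (\<Sum>\<^sub>\<infinity>x. exp (- (pi / 4) * (cmod (lat c x - w))\<^sup>2)) \<le> B"
    using infsum_gauss_lat_bound[OF assms, of "pi / 4"] by auto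
  have le: "cmod (gauss c w (lat c x)) * (1 + cmod (lat c x - w)) \<le> 2 * c\<^sup>2 * exp (- (pi / 4) * (cmod (lat c x - w))\<^sup>2)" for w x
    using mult_left_mono[OF weight_gauss_le[of "cmod (lat c x - w)"], of "c\<^sup>2"]
    by (simp add: norm_gauss mult_ac)
  have s: "(\<lambda>x. 2 * c\<^sup>2 * exp (- (pi / 4) * (cmod (lat c x - w))\<^sup>2)) summable_on UNIV" for w
    using assms by (intro summable_on_cmult_right summable_gauss_lat) auto
  have s': "(\<lambda>x. cmod (gauss c w (lat c x)) * (1 + cmod (lat c x - w))) summable_on UNIV" for w
    by (rule summable_on_comparison_test[OF s le]) auto
  have "(\<Sum>\<^sub>\<infinity>x. cmod (gauss c w (lat c x)) * (1 + cmod (lat c x - w))) \<le> 2 * c\<^sup>2 * B" for w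
  proof -
    have "(\<Sum>\<^sub>\<infinity>x. cmod (gauss c w (lat c x)) * (1 + cmod (lat c x - w)))
        \<le> (\<Sum>\<^sub>\<infinity>x. 2 * c\<^sup>2 * exp (- (pi / 4) * (cmod (lat c x - w))\<^sup>2))"
      by (rule infsum_mono[OF s' s le])
    also have "\<dots> = 2 * c\<^sup>2 * (\<Sum>\<^sub>\<infinity>x. exp (- (pi / 4) * (cmod (lat c x - w))\<^sup>2))"
      by (rule infsum_cmult_right')
    also have "\<dots> \<le> 2 * c\<^sup>2 * B" by (intro mult_left_mono B) auto
    finally show ?thesis .
  qed
  then show ?thesis using s' B(1) by (intro exI[of _ "2 * c\<^sup>2 * B"]) auto
qed

text \<open>One constant for all \<open>w\<close>. It depends on \<open>c\<close> alone and not on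
  the operators \<open>W x\<close>, so the estimates below are uniform in the
  representation.\<close>

definition gauss_const :: "real \<Rightarrow> real" where
  "gauss_const c = (SOME C. 0 \<le> C \<and> (\<forall>w. (\<lambda>x. cmod (gauss c w (lat c x)) * (1 + cmod (lat c x - w))) summable_on UNIV \<and>
    (\<Sum>\<^sub>\<infinity>x. cmod (gauss c w (lat c x)) * (1 + cmod (lat c x - w))) \<le> C))"

lemma
  assumes "0 < c"
  shows gauss_const_nonneg: "0 \<le> gauss_const c"
    and summable_gauss_weight: "(\<lambda>x. cmod (gauss c w (lat c x)) * (1 + cmod (lat c x - w))) summable_on UNIV"
    and infsum_gauss_weight: "(\<Sum>\<^sub>\<infinity>x. cmod (gauss c w (lat c x)) * (1 + cmod (lat c x - w))) \<le> gauss_const c"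
    and summable_gauss: "(\<lambda>x. cmod (gauss c w (lat c x))) summable_on UNIV"
    and infsum_gauss: "(\<Sum>\<^sub>\<infinity>x. cmod (gauss c w (lat c x))) \<le> gauss_const c"
proof -
  have C: "0 \<le> gauss_const c \<and> (\<forall>w. (\<lambda>x. cmod (gauss c w (lat c x)) * (1 + cmod (lat c x - w))) summable_on UNIV \<and>
    (\<Sum>\<^sub>\<infinity>x. cmod (gauss c w (lat c x)) * (1 + cmod (lat c x - w))) \<le> gauss_const c)"
    unfolding gauss_const_def by (rule someI_ex) (use gauss_weight_bound[OF assms] in blast)
  then show "0 \<le> gauss_const c"
    and s: "(\<lambda>x. cmod (gauss c w (lat c x)) * (1 + cmod (lat c x - w))) summable_on UNIV"
    and b: "(\<Sum>\<^sub>\<infinity>x. cmod (gauss c w (lat c x)) * (1 + cmod (lat c x - w))) \<le> gauss_const c" by blast+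
  have le: "cmod (gauss c w (lat c x)) \<le> cmod (gauss c w (lat c x)) * (1 + cmod (lat c x - w))" for x
    by (simp add: distrib_left)
  show s': "(\<lambda>x. cmod (gauss c w (lat c x))) summable_on UNIV"
    by (rule summable_on_comparison_test[OF s le]) auto
  show "(\<Sum>\<^sub>\<infinity>x. cmod (gauss c w (lat c x))) \<le> gauss_const c"
    using infsum_mono[OF s' s le] b by linarith
qed

lemma lat_add: "lat c (x + y) = lat c x + lat c y" and lat_minus: "lat c (- x) = - lat c x"
  and lat_0 [simp]: "lat c 0 = 0" "lat c (0, 0) = 0"
  by (auto simp: lat_def split_beta complex_eq_iff algebra_simps)

lemma dual_0 [simp]: "dual c (0, 0) = 0"
  by (simp add: dual_def complex_eq_iff)

lemma summable_dual_coeff_weight: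
  assumes "0 < c" "c\<^sup>2 \<le> 1 / 8"
  shows "(\<lambda>y. cmod (dual_coeff c w y) * (1 + cmod (dual c y))) summable_on UNIV - {(0, 0)}"
  unfolding norm_dual_coeff by (rule dual_sum(1)[OF assms])

lemma summable_dual_coeff:
  assumes "0 < c" "c\<^sup>2 \<le> 1 / 8"
  shows "(\<lambda>y. cmod (dual_coeff c w y)) summable_on UNIV"
proof -
  have "(\<lambda>y. cmod (dual_coeff c w y)) summable_on UNIV - {(0, 0)}"
    by (rule summable_on_comparison_test[OF summable_dual_coeff_weight[OF assms, of w]]) (auto simp: distrib_left)
  then have "(\<lambda>y. cmod (dual_coeff c w y)) summable_on (UNIV - {(0, 0)}) \<union> {(0, 0)}"
    by (intro summable_on_Un_disjoint) auto
  then show ?thesis by simp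
qed

text \<open>The relations of a noncommutative torus in a corner: \<open>W 0\<close> is a
  self-adjoint idempotent that need not be 1, which is why the \<open>W x\<close> are only required
  to be contractions.\<close>

locale weyl_system =
  fixes W :: "int \<times> int \<Rightarrow> 'i bop" and c :: real
  assumes c_pos: "0 < c" and c_small: "c\<^sup>2 \<le> 1 / 8"
    and W_mult: "W x * W y = scal (twist (lat c x) (lat c y)) * W (x + y)"
    and norm_W: "norm (W x) \<le> 1" and W_adj: "adjoint_pair (W x) (W (- x))"
begin

definition H :: "complex \<Rightarrow> 'i bop" where
  "H w = (\<Sum>\<^sub>\<infinity>x. scal (gauss c w (lat c x)) * W x)"

lemma summable_W:
  assumes "(\<lambda>x. cmod (a x)) summable_on I"
  shows "(\<lambda>x. norm (scal (a x) * W x)) summable_on I"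
  using summable_norm_scal[of a "\<lambda>_. 1" I W] assms norm_W by simp

lemma norm_H: "norm (H w) \<le> gauss_const c"
proof -
  have "norm (H w) \<le> (\<Sum>\<^sub>\<infinity>x. cmod (gauss c w (lat c x)))"
    unfolding H_def using norm_W
    by (intro norm_infsum_bop_le summable_W summable_gauss[OF c_pos]) (simp add: mult_left_le)
  then show ?thesis using infsum_gauss[OF c_pos, of w] by linarith
qed

text \<open>Collecting the product at a fixed \<open>W k\<close> gives the twisted convolution of
  the coefficients, which \<open>gauss_convolution\<close> rewrites as a sum over the dual lattice.
  Absolute summability before and after this step allows both exchanges of summation. The term at
  the dual point 0 is \<open>H w\<close> itself.\<close>

lemma H_convolution: "((\<lambda>y. scal (dual_coeff c w y) * H (w + dual c y)) has_sum H 0 * H w) UNIV"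
proof -
  let ?g = "\<lambda>w x. gauss c w (lat c x)"
  define F where "F = (\<lambda>(x, k). scal (?g 0 x * gauss c w (lat c k - lat c x) * twist (lat c x) (lat c k)) * W k)"
  define F' where "F' = (\<lambda>(y, k). scal (dual_coeff c w y * ?g (w + dual c y) k) * W k)"
  note sW = summable_W[OF summable_gauss[OF c_pos]]
  have bij: "bij_betw (\<lambda>(x, y). (x, x + y)) UNIV (UNIV :: ((int \<times> int) \<times> (int \<times> int)) set)"
    by (rule bij_betw_byWitness[of _ "\<lambda>(x, k). (x, k - x)"]) auto
  have tw: "twist (lat c x) (lat c (x + y)) = twist (lat c x) (lat c y)" for x y
    by (simp add: twist_def lat_add distrib_left)
  have eq: "F (case p of (x, y) \<Rightarrow> (x, x + y)) = (case p of (x, y) \<Rightarrow> scal (?g 0 x) * W x * (scal (?g w y) * W y))" for p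
  proof -
    obtain x y where p: "p = (x, y)" by (cases p)
    have "scal (?g 0 x) * W x * (scal (?g w y) * W y) = scal (?g 0 x) * (W x * scal (?g w y)) * W y"
      by (simp only: mult.assoc)
    also have "\<dots> = scal (?g 0 x) * scal (?g w y) * (W x * W y)" by (simp only: scal_commute[of "W x"] mult.assoc)
    also have "\<dots> = F (x, x + y)" by (simp add: W_mult F_def tw scal_mult mult.assoc) (simp add: lat_add)
    finally show ?thesis by (simp add: p)
  qed
  have "(\<lambda>p. norm (F (case p of (x, y) \<Rightarrow> (x, x + y)))) summable_on UNIV"
    unfolding eq using abs_summable_times[OF sW[of 0] sW[of w]] by (simp add: case_prod_unfold)
  then have nF: "(\<lambda>p. norm (F p)) summable_on UNIV"
    using summable_on_reindex_bij_betw[OF bij, of "\<lambda>p. norm (F p)"] by simp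
  have "H 0 * H w = infsum F UNIV"
    unfolding H_def using infsum_times[OF sW[of 0] sW[of w]] infsum_reindex_bij_betw[OF bij, of F] eq
    by (simp add: case_prod_unfold)
  also have "\<dots> = (\<Sum>\<^sub>\<infinity>x. \<Sum>\<^sub>\<infinity>k. F (x, k))"
    using infsum_Sigma'_banach[of "\<lambda>x k. F (x, k)" UNIV "\<lambda>_. UNIV"] abs_summable_summable[OF nF] by simp
  also have "\<dots> = (\<Sum>\<^sub>\<infinity>k. \<Sum>\<^sub>\<infinity>x. F (x, k))"
    using infsum_swap_banach[of "\<lambda>x k. F (x, k)" UNIV UNIV] abs_summable_summable[OF nF] by simp
  also have "\<dots> = (\<Sum>\<^sub>\<infinity>k. \<Sum>\<^sub>\<infinity>y. F' (y, k))"
  proof (rule infsum_cong)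
    fix k :: "int \<times> int"
    obtain j l where k: "k = (j, l)" by (cases k)
    have push: "(\<Sum>\<^sub>\<infinity>x. scal (a x) * W k) = scal (infsum a UNIV) * W k" if "(\<lambda>x. cmod (a x)) summable_on UNIV" for a :: "int \<times> int \<Rightarrow> complex"
      using has_sum_bounded_linear[OF bounded_linear_compose[OF bounded_linear_mult_left bounded_linear_scal] has_sum_infsum[OF abs_summable_summable[OF that]]]
      by (rule infsumI)
    have bd: "cmod (gauss c w x) \<le> c\<^sup>2" for w x by (simp add: norm_gauss mult_left_le)
    have "(\<Sum>\<^sub>\<infinity>x. F (x, k)) = scal (\<Sum>\<^sub>\<infinity>x. ?g 0 x * gauss c w (lat c k - lat c x) * twist (lat c x) (lat c k)) * W k"
      unfolding F_def split
      by (rule push, rule summable_on_comparison_test[OF summable_on_cmult_left[OF summable_gauss[OF c_pos, of 0], of "c\<^sup>2"]])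
        (auto simp: norm_mult intro!: mult_left_mono bd)
    also have "\<dots> = scal (\<Sum>\<^sub>\<infinity>y. dual_coeff c w y * gauss c (w + dual c y) (lat c k)) * W k"
      unfolding k gauss_convolution[OF c_pos] ..
    also have "\<dots> = (\<Sum>\<^sub>\<infinity>y. F' (y, k))"
      unfolding F'_def split
      by (rule push[symmetric], rule summable_on_comparison_test[OF summable_on_cmult_left[OF summable_dual_coeff[OF c_pos c_small, of w], of "c\<^sup>2"]])
        (auto simp: norm_mult intro!: mult_left_mono bd)
    finally show "(\<Sum>\<^sub>\<infinity>x. F (x, k)) = (\<Sum>\<^sub>\<infinity>y. F' (y, k))" .
  qed
  finally have HH: "H 0 * H w = (\<Sum>\<^sub>\<infinity>k. \<Sum>\<^sub>\<infinity>y. F' (y, k))" .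
  have nF': "(\<lambda>p. norm (F' p)) summable_on UNIV"
  proof -
    have "(\<lambda>(y, k). cmod (dual_coeff c w y) * cmod (?g (w + dual c y) k)) summable_on UNIV \<times> UNIV"
    proof (rule summable_on_SigmaI)
      show "((\<lambda>k. case (y, k) of (y, k) \<Rightarrow> cmod (dual_coeff c w y) * cmod (?g (w + dual c y) k)) has_sum
          cmod (dual_coeff c w y) * (\<Sum>\<^sub>\<infinity>k. cmod (?g (w + dual c y) k))) UNIV" for y
        using has_sum_cmult_right[OF has_sum_infsum[OF summable_gauss[OF c_pos, of "w + dual c y"]]] by simp
      show "(\<lambda>y. cmod (dual_coeff c w y) * (\<Sum>\<^sub>\<infinity>k. cmod (?g (w + dual c y) k))) summable_on UNIV"
        by (rule summable_on_comparison_test[OF summable_on_cmult_left[OF summable_dual_coeff[OF c_pos c_small, of w], of "gauss_const c"]])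
          (auto intro!: mult_left_mono infsum_gauss[OF c_pos] mult_nonneg_nonneg infsum_nonneg)
    qed auto
    then show ?thesis
      unfolding UNIV_Times_UNIV
      by (rule summable_on_comparison_test)
        (auto simp: F'_def norm_mult mult_left_le norm_W)
  qed
  have "((\<lambda>y. \<Sum>\<^sub>\<infinity>k. F' (y, k)) has_sum (\<Sum>\<^sub>\<infinity>y. \<Sum>\<^sub>\<infinity>k. F' (y, k))) UNIV"
    using summable_on_Sigma_banach[of "\<lambda>y k. F' (y, k)" UNIV "\<lambda>_. UNIV"] abs_summable_summable[OF nF'] by (intro has_sum_infsum) (simp add: case_prod_unfold)
  also have "(\<Sum>\<^sub>\<infinity>y. \<Sum>\<^sub>\<infinity>k. F' (y, k)) = H 0 * H w"
    unfolding HH using infsum_swap_banach[of "\<lambda>y k. F' (y, k)" UNIV UNIV] abs_summable_summable[OF nF'] by simp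
  also have "(\<lambda>y. \<Sum>\<^sub>\<infinity>k. F' (y, k)) = (\<lambda>y. scal (dual_coeff c w y) * H (w + dual c y))"
  proof
    fix y
    show "(\<Sum>\<^sub>\<infinity>k. F' (y, k)) = scal (dual_coeff c w y) * H (w + dual c y)"
      using has_sum_mult_left_bop[OF has_sum_infsum[OF abs_summable_summable[OF sW[of "w + dual c y"]]], of "scal (dual_coeff c w y)"]
      unfolding H_def F'_def split scal_mult mult.assoc by (rule infsumI)
  qed
  finally show ?thesis .
qed

definition T :: "nat \<Rightarrow> complex \<Rightarrow> 'i bop" where
  "T n w = (1 - H 0) ^ n * H w"

lemma H_commute: "(1 - H 0) ^ n * H 0 = H 0 * (1 - H 0) ^ n"
  by (rule power_commuting_commutes) (simp add: algebra_simps)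

lemma T_Suc: "((\<lambda>y. scal (- dual_coeff c w y) * T n (w + dual c y)) has_sum T (Suc n) w) (UNIV - {(0, 0)})"
proof -
  have 0: "dual_coeff c w (0, 0) = 1" by (simp add: dual_coeff_def)
  have "((\<lambda>y. scal (dual_coeff c w y) * H (w + dual c y)) has_sum H 0 * H w - H w) (UNIV - {(0, 0)})"
    using has_sum_Diff[OF H_convolution[of w] has_sum_finite[of "{(0, 0)}"]] by (simp add: 0)
  from has_sum_mult_left_bop[OF this, of "- ((1 - H 0) ^ n)"]
  have "((\<lambda>y. - ((1 - H 0) ^ n) * (scal (dual_coeff c w y) * H (w + dual c y))) has_sum T (Suc n) w) (UNIV - {(0, 0)})"
    by (simp add: T_def power_Suc2 algebra_simps del: power_Suc)
  moreover have "- ((1 - H 0) ^ n) * (scal (dual_coeff c w y) * H (w + dual c y)) = scal (- dual_coeff c w y) * T n (w + dual c y)" for y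
    by (simp add: T_def scal_minus scal_commute flip: mult.assoc)
  ultimately show ?thesis by simp
qed

text \<open>One induction for three kinds of bounds \<open>R\<close>: the operator norm, the
  commutator with a multiplication operator, and a diagonal coefficient. By \<open>T_Suc\<close>
  each step sums over nonzero dual points. Since \<open>1 + |w + y| <= (1 + |w|) (1 + |y|)\<close>,
  the weight at \<open>w\<close> factors out, and \<open>dual_sum\<close> supplies the factor
  \<open>1/2\<close>.\<close>

lemma T_induct:
  fixes R :: "'i bop \<Rightarrow> real \<Rightarrow> bool"
  assumes sum: "\<And>I (X :: int \<times> int \<Rightarrow> 'i bop) a B. (\<And>x. x \<in> I \<Longrightarrow> R (X x) (B x)) \<Longrightarrow>
      (\<lambda>x. cmod (a x) * B x) summable_on I \<Longrightarrow> (\<lambda>x. norm (scal (a x) * X x)) summable_on I \<Longrightarrow>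
      R (\<Sum>\<^sub>\<infinity>x\<in>I. scal (a x) * X x) (\<Sum>\<^sub>\<infinity>x\<in>I. cmod (a x) * B x)"
    and mono: "\<And>X B B'. R X B \<Longrightarrow> B \<le> B' \<Longrightarrow> R X B'"
    and base: "\<And>w. R (H w) (C * (1 + cmod w))" and C: "0 \<le> C"
  shows "R (T n w) (C * (1 / 2) ^ n * (1 + cmod w))"
proof (induction n arbitrary: w)
  case 0
  then show ?case using base by (simp add: T_def)
next
  case (Suc n)
  let ?I = "UNIV - {(0, 0) :: int \<times> int}"
  define D where "D = C * (1 / 2) ^ n * (1 + cmod w)"
  have D: "0 \<le> D" using C by (simp add: D_def)
  have le: "cmod (- dual_coeff c w y) * (C * (1 / 2) ^ n * (1 + cmod (w + dual c y)))
      \<le> D * (cmod (dual_coeff c w y) * (1 + cmod (dual c y)))" for y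
  proof -
    have "1 + cmod (w + dual c y) \<le> (1 + cmod w) * (1 + cmod (dual c y))"
      using norm_triangle_ineq[of w "dual c y"] mult_nonneg_nonneg[OF norm_ge_zero[of w] norm_ge_zero[of "dual c y"]]
      unfolding distrib_left distrib_right by linarith
    then have "(C * (1 / 2) ^ n) * (1 + cmod (w + dual c y)) \<le> (C * (1 / 2) ^ n) * ((1 + cmod w) * (1 + cmod (dual c y)))"
      using C by (intro mult_left_mono) auto
    from mult_left_mono[OF this norm_ge_zero[of "dual_coeff c w y"]] show ?thesis
      by (simp add: D_def mult_ac)
  qed
  note sw = summable_on_cmult_right[OF summable_dual_coeff_weight[OF c_pos c_small, of w], of D]
  have s: "(\<lambda>y. cmod (- dual_coeff c w y) * (C * (1 / 2) ^ n * (1 + cmod (w + dual c y)))) summable_on ?I"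
    by (rule summable_on_comparison_test[OF sw le]) (use C in auto)
  have nT: "norm (T n v) \<le> norm (1 - H 0) ^ n * gauss_const c" for v
    unfolding T_def
    by (intro norm_mult_ineq[THEN order_trans] mult_mono norm_power_ineq norm_H) auto
  have "(\<lambda>y. cmod (- dual_coeff c w y) * (norm (1 - H 0) ^ n * gauss_const c)) summable_on ?I"
    using summable_on_subset_banach[OF summable_dual_coeff[OF c_pos c_small, of w], of ?I]
    by (intro summable_on_cmult_left) auto
  then have s': "(\<lambda>y. norm (scal (- dual_coeff c w y) * T n (w + dual c y))) summable_on ?I"
    by (rule summable_norm_scal) (rule nT)
  have "R (T (Suc n) w) (\<Sum>\<^sub>\<infinity>y\<in>?I. cmod (- dual_coeff c w y) * (C * (1 / 2) ^ n * (1 + cmod (w + dual c y))))"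
    using sum[OF Suc s s'] infsumI[OF T_Suc[of w n]] by simp
  moreover have "(\<Sum>\<^sub>\<infinity>y\<in>?I. cmod (- dual_coeff c w y) * (C * (1 / 2) ^ n * (1 + cmod (w + dual c y))))
      \<le> D * (\<Sum>\<^sub>\<infinity>y\<in>?I. cmod (dual_coeff c w y) * (1 + cmod (dual c y)))"
    using infsum_mono[OF s sw le] by (simp add: infsum_cmult_right')
  moreover have "\<dots> \<le> D * (1 / 2)"
    unfolding norm_dual_coeff by (rule mult_left_mono[OF dual_sum(2)[OF c_pos c_small] D])
  ultimately have "R (T (Suc n) w) (D * (1 / 2))" by (meson mono order_trans)
  then show ?case by (simp add: D_def mult_ac)
qed

lemma norm_T: "norm (T n w) \<le> gauss_const c * (1 / 2) ^ n * (1 + cmod w)"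
proof (rule T_induct)
  show "norm (\<Sum>\<^sub>\<infinity>x\<in>I. scal (a x) * X x) \<le> (\<Sum>\<^sub>\<infinity>x\<in>I. cmod (a x) * B x)"
    if "\<And>x. x \<in> I \<Longrightarrow> norm (X x) \<le> B x" "(\<lambda>x. cmod (a x) * B x) summable_on I"
      "(\<lambda>x. norm (scal (a x) * X x)) summable_on I" for I and X :: "int \<times> int \<Rightarrow> 'i bop" and a B
    by (rule norm_infsum_bop_le[OF that(3) _ that(2)]) (auto intro!: mult_left_mono that(1))
  show "norm (H w) \<le> gauss_const c * (1 + cmod w)" for w
    using norm_H[of w] gauss_const_nonneg[OF c_pos] by (simp add: distrib_left add_increasing2)
qed (use gauss_const_nonneg[OF c_pos] in auto)

definition P :: "'i bop" where "P = (\<Sum>n. T n 0)"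

lemma summable_norm_T: "summable (\<lambda>n. norm (T n 0))"
  by (rule summable_comparison_test'[of "\<lambda>n. gauss_const c * (1 / 2) ^ n" 0])
    (use norm_T[of _ 0] in \<open>auto intro!: summable_mult summable_geometric\<close>)

lemma sums_P: "(\<lambda>n. T n 0) sums P"
  unfolding P_def by (rule summable_sums[OF summable_norm_cancel[OF summable_norm_T]])

lemma has_sum_P: "((\<lambda>n. T n 0) has_sum P) UNIV"
  by (rule norm_summable_imp_has_sum[OF summable_norm_T sums_P])

lemma power_tendsto: "(\<lambda>n. (1 - H 0) ^ n) \<longlonglongrightarrow> 1 - P"
proof -
  have "(\<Sum>k<n. T k 0) = 1 - (1 - H 0) ^ n" for n
    by (induction n) (simp_all add: T_def power_Suc2 algebra_simps del: power_Suc)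
  then have "(1 - H 0) ^ n = 1 - (\<Sum>k<n. T k 0)" for n by simp
  then show ?thesis using sums_P unfolding sums_def by (auto intro!: tendsto_intros)
qed

lemma P_H: "P * H w = H w"
proof -
  have "(\<lambda>n. (1 - H 0) ^ n * H w) \<longlonglongrightarrow> (1 - P) * H w"
    by (intro tendsto_intros power_tendsto)
  moreover have "(\<lambda>n. T n w) \<longlonglongrightarrow> 0"
  proof (rule Lim_null_comparison)
    show "\<forall>\<^sub>F n in sequentially. norm (T n w) \<le> gauss_const c * (1 / 2) ^ n * (1 + cmod w)"
      using norm_T by simp
    have "(\<lambda>n. gauss_const c * (1 / 2) ^ n * (1 + cmod w)) \<longlonglongrightarrow> gauss_const c * 0 * (1 + cmod w)"
      by (intro tendsto_intros LIMSEQ_realpow_zero) auto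
    then show "(\<lambda>n. gauss_const c * (1 / 2) ^ n * (1 + cmod w)) \<longlonglongrightarrow> 0" by simp
  qed
  ultimately have "(1 - P) * H w = 0" unfolding T_def using LIMSEQ_unique by blast
  then show ?thesis by (simp add: algebra_simps)
qed

lemma P_idem: "P * P = P"
proof -
  have "((\<lambda>n. P * T n 0) has_sum P * P) UNIV" by (rule has_sum_mult_left_bop[OF has_sum_P])
  moreover have "P * T n 0 = T n 0" for n
  proof (cases n)
    case (Suc m)
    \<comment> \<open>Moving \<open>H 0\<close> to the left end exhibits \<open>T n 0\<close> as a
      left multiple of \<open>H 0\<close>, which \<open>P\<close> fixes.\<close>
    have "T n 0 = H 0 * (1 - H 0) ^ n"
      unfolding T_def by (rule H_commute)
    then show ?thesis by (simp add: P_H flip: mult.assoc)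
  qed (simp add: T_def P_H)
  ultimately show ?thesis using has_sum_P has_sum_unique by fastforce
qed

lemma H_self: "adjoint_pair (H 0) (H 0)"
proof -
  let ?a = "\<lambda>x. gauss c 0 (lat c x)"
  have 1: "((\<lambda>F. \<Sum>x\<in>F. scal (?a x) * W x) \<longlongrightarrow> H 0) (finite_subsets_at_top UNIV)"
    using has_sum_infsum[OF abs_summable_summable[OF summable_W[OF summable_gauss[OF c_pos, of 0]]]]
    by (simp add: has_sum_def H_def)
  have "((\<lambda>x. scal (?a (- x)) * W (- x)) has_sum H 0) UNIV"
    using has_sum_infsum[OF abs_summable_summable[OF summable_W[OF summable_gauss[OF c_pos, of 0]]]]
    by (subst has_sum_reindex_bij_witness[of UNIV uminus uminus UNIV]) (auto simp: H_def)
  moreover have "?a (- x) = cnj (?a x)" for x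
    by (simp add: gauss_def lat_minus)
  ultimately have 2: "((\<lambda>F. \<Sum>x\<in>F. scal (cnj (?a x)) * W (- x)) \<longlongrightarrow> H 0) (finite_subsets_at_top UNIV)"
    by (simp add: has_sum_def)
  have "adjoint_pair (\<Sum>x\<in>F. scal (?a x) * W x) (\<Sum>x\<in>F. scal (cnj (?a x)) * W (- x))" for F
  proof (induction F rule: infinite_finite_induct)
    case (insert x F)
    have "adjoint_pair (scal (?a x) * W x) (W (- x) * scal (cnj (?a x)))"
      by (rule adjoint_pair_mult[OF adjoint_pair_scal W_adj])
    then show ?case using insert by (simp add: adjoint_pair_add scal_commute)
  qed (simp_all add: adjoint_pair_def)
  then show ?thesis by (intro adjoint_pair_tendsto[OF always_eventually 1 2]) auto
qed

lemma P_self: "adjoint_pair P P"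
proof -
  have "adjoint_pair ((1 - H 0) ^ n) ((1 - H 0) ^ n)" for n
    by (intro adjoint_pair_power adjoint_pair_diff adjoint_pair_one H_self)
  then have "adjoint_pair (1 - P) (1 - P)"
    by (intro adjoint_pair_tendsto[OF always_eventually power_tendsto power_tendsto]) auto
  from adjoint_pair_diff[OF adjoint_pair_one this] show ?thesis by simp
qed

lemma commutator_bound_P:
  assumes base: "\<And>w. commutator_bound f Q (H w) (C * (1 + cmod w))" and C: "0 \<le> C"
  shows "\<exists>Y. commutator f P Y \<and> Q * Y = 0"
proof -
  have b: "commutator_bound f Q (T n 0) (C * (1 / 2) ^ n)" for n
    using T_induct[where R = "commutator_bound f Q" and C = C and n = n and w = 0, OF commutator_bound_infsum commutator_bound_mono base C] by simp
  have "(\<lambda>n. C * (1 / 2) ^ n) summable_on UNIV"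
    using C by (intro norm_summable_imp_summable_on) (auto intro!: summable_mult summable_geometric simp: abs_mult)
  then have "commutator_bound f Q (\<Sum>\<^sub>\<infinity>n. scal 1 * T n 0) (\<Sum>\<^sub>\<infinity>n. cmod 1 * (C * (1 / 2) ^ n))"
    using norm_summable_imp_summable_on[of "\<lambda>n. norm (T n 0)"] summable_norm_T
    by (intro commutator_bound_infsum b) auto
  then have "commutator_bound f Q P (\<Sum>\<^sub>\<infinity>n. cmod 1 * (C * (1 / 2) ^ n))"
    using infsumI[OF has_sum_P] by simp
  then show ?thesis unfolding commutator_bound_def by blast
qed

end

lemma has_sum_diff_bop:
  "(f has_sum a) A \<Longrightarrow> (g has_sum b) A \<Longrightarrow> ((\<lambda>x. f x - g x) has_sum (a - b)) A" for a b :: "'i bop"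
  using has_sum_add[of f A a "\<lambda>x. - 1 * g x" "- 1 * b"] has_sum_mult_left_bop[of g A b "- 1"] by simp

section \<open>Differentiating the translates; commutators of the projection\<close>

context weyl_system
begin

text \<open>The commutator with the holomorphic coordinate, for which
  \<open>[z, W x] = lat c x W x\<close>; up to the factor \<open>pi\<close> also the derivative of
  the suitably rescaled \<open>H w\<close>.\<close>

definition dH :: "complex \<Rightarrow> 'i bop" where
  "dH w = (\<Sum>\<^sub>\<infinity>x. scal (lat c x * gauss c w (lat c x)) * W x)"

lemma weight_le: "cmod (lat c x) \<le> (1 + cmod (lat c x - w)) * (1 + cmod w)"
proof -
  have "cmod (lat c x) \<le> cmod (lat c x - w) + cmod w" using norm_triangle_ineq[of "lat c x - w" w] by simp
  then show ?thesis
    using mult_nonneg_nonneg[OF norm_ge_zero[of "lat c x - w"] norm_ge_zero[of w]]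
    unfolding distrib_left distrib_right by linarith
qed

lemma
  shows summable_gauss_cmod_lat: "(\<lambda>x. cmod (gauss c w (lat c x)) * cmod (lat c x)) summable_on UNIV"
    and infsum_gauss_cmod_lat: "(\<Sum>\<^sub>\<infinity>x. cmod (gauss c w (lat c x)) * cmod (lat c x)) \<le> gauss_const c * (1 + cmod w)"
proof -
  have le: "cmod (gauss c w (lat c x)) * cmod (lat c x) \<le> cmod (gauss c w (lat c x)) * (1 + cmod (lat c x - w)) * (1 + cmod w)" for x
    using mult_left_mono[OF weight_le[of x w], of "cmod (gauss c w (lat c x))"] by (simp add: mult.assoc)
  have s: "(\<lambda>x. cmod (gauss c w (lat c x)) * (1 + cmod (lat c x - w)) * (1 + cmod w)) summable_on UNIV"
    by (rule summable_on_cmult_left[OF summable_gauss_weight[OF c_pos]])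
  show s': "(\<lambda>x. cmod (gauss c w (lat c x)) * cmod (lat c x)) summable_on UNIV"
    by (rule summable_on_comparison_test[OF s le]) auto
  have "(\<Sum>\<^sub>\<infinity>x. cmod (gauss c w (lat c x)) * cmod (lat c x))
      \<le> (\<Sum>\<^sub>\<infinity>x. cmod (gauss c w (lat c x)) * (1 + cmod (lat c x - w)) * (1 + cmod w))"
    by (rule infsum_mono[OF s' s le])
  also have "\<dots> = (\<Sum>\<^sub>\<infinity>x. cmod (gauss c w (lat c x)) * (1 + cmod (lat c x - w))) * (1 + cmod w)"
    by (rule infsum_cmult_left')
  also have "\<dots> \<le> gauss_const c * (1 + cmod w)"
    by (intro mult_right_mono infsum_gauss_weight[OF c_pos]) auto
  finally show "(\<Sum>\<^sub>\<infinity>x. cmod (gauss c w (lat c x)) * cmod (lat c x)) \<le> gauss_const c * (1 + cmod w)" .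
qed

text \<open>Majorant of the quadratic Taylor remainder in \<open>P_dH\<close>. The factor 5 bounds
  \<open>1 + pi\<close>, and \<open>25/3\<close> comes from completing the square in
  \<open>5 t - 3/4 t^2\<close>, where 3 is a lower bound of \<open>pi\<close>.\<close>

lemma summable_gauss_exp:
  "(\<lambda>x. cmod (gauss c w (lat c x)) * ((pi * cmod (lat c x))\<^sup>2 * exp (pi * cmod (lat c x)))) summable_on UNIV"
proof (rule summable_on_comparison_test)
  let ?A = "c\<^sup>2 * (2 * pi\<^sup>2 * exp (5 * cmod w) * exp (25 / 3))"
  show "(\<lambda>x. ?A * exp (- (pi / 4) * (cmod (lat c x - w))\<^sup>2)) summable_on UNIV"
    using c_pos by (intro summable_on_cmult_right summable_gauss_lat) auto
  fix x
  define s where "s = cmod (lat c x)"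
  define t where "t = cmod (lat c x - w)"
  have st: "s \<le> t + cmod w" unfolding s_def t_def using norm_triangle_ineq[of "lat c x - w" w] by simp
  have s0: "0 \<le> s" by (simp add: s_def)
  have "s\<^sup>2 \<le> 2 * exp s"
    using exp_lower_Taylor_quadratic[OF s0] s0 by simp
  then have "(pi * s)\<^sup>2 * exp (pi * s) \<le> (pi\<^sup>2 * (2 * exp s)) * exp (pi * s)"
    by (intro mult_right_mono) (auto simp: power_mult_distrib)
  also have "\<dots> = 2 * pi\<^sup>2 * exp (s + pi * s)" by (simp add: exp_add)
  also have "\<dots> \<le> 2 * pi\<^sup>2 * exp (5 * (t + cmod w))"
  proof -
    have "s + pi * s \<le> 5 * s" using mult_right_mono[OF less_imp_le[OF pi_less_4] s0] by simp
    then show ?thesis using st by (intro mult_left_mono) auto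
  qed
  finally have 1: "(pi * s)\<^sup>2 * exp (pi * s) \<le> 2 * pi\<^sup>2 * exp (5 * cmod w) * exp (5 * t)"
    by (simp add: exp_add[symmetric] distrib_left add.commute mult.assoc)
  have "0 \<le> 3 / 4 * (t - 10 / 3)\<^sup>2" by simp
  then have "5 * t \<le> 3 / 4 * t\<^sup>2 + 25 / 3" by (simp add: power2_eq_square algebra_simps)
  also have "\<dots> \<le> pi / 4 * t\<^sup>2 + 25 / 3" using pi_gt3 by (intro add_right_mono mult_right_mono) auto
  finally have 2: "- pi / 2 * t\<^sup>2 + 5 * t \<le> - (pi / 4) * t\<^sup>2 + 25 / 3" by simp
  have "cmod (gauss c w (lat c x)) * ((pi * s)\<^sup>2 * exp (pi * s))
      \<le> c\<^sup>2 * exp (- pi / 2 * t\<^sup>2) * (2 * pi\<^sup>2 * exp (5 * cmod w) * exp (5 * t))"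
    unfolding norm_gauss t_def[symmetric] by (intro mult_left_mono 1) auto
  also have "\<dots> = c\<^sup>2 * (2 * pi\<^sup>2 * exp (5 * cmod w)) * exp (- pi / 2 * t\<^sup>2 + 5 * t)"
    by (simp only: exp_add mult_ac)
  also have "\<dots> \<le> c\<^sup>2 * (2 * pi\<^sup>2 * exp (5 * cmod w)) * exp (- (pi / 4) * t\<^sup>2 + 25 / 3)"
    using 2 by (intro mult_left_mono) auto
  also have "\<dots> = ?A * exp (- (pi / 4) * t\<^sup>2)" by (simp only: exp_add mult_ac)
  finally show "cmod (gauss c w (lat c x)) * ((pi * cmod (lat c x))\<^sup>2 * exp (pi * cmod (lat c x)))
      \<le> ?A * exp (- (pi / 4) * (cmod (lat c x - w))\<^sup>2)"
    by (simp only: s_def t_def)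
qed auto

text \<open>\<open>gauss c w\<close> is a scalar multiple of an entire function of \<open>cnj w\<close>, whose derivative is
  multiplication by \<open>pi x\<close>.\<close>

lemma gauss_shift:
  fixes x :: complex and t :: real
  shows "gauss c (w + of_real t) x = of_real (exp (- pi / 2 * (2 * t * Re w + t\<^sup>2))) * (exp (pi * t * x) * gauss c w x)"
proof -
  have e: "exp (complex_of_real (pi * t) * x) = exp (Complex (pi * t * Re x) (pi * t * Im x))"
    by (rule arg_cong[of _ _ exp]) (simp add: complex_eq_iff)
  have r: "complex_of_real (exp r) = exp (Complex r 0)" for r
    by (simp add: exp_eq_polar)
  have n: "(cmod (x - v))\<^sup>2 = (Re x - Re v)\<^sup>2 + (Im x - Im v)\<^sup>2" for v by (simp add: cmod_power2)
  have "gauss c (w + of_real t) x = of_real (c\<^sup>2) * exp (Complex (- pi / 2 * (2 * t * Re w + t\<^sup>2)) 0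
      + (Complex (pi * t * Re x) (pi * t * Im x) + Complex (- pi / 2 * (cmod (x - w))\<^sup>2) (- pi * Im (cnj x * w))))"
    unfolding gauss_exp n
    by (rule arg_cong[of _ _ "\<lambda>z. of_real (c\<^sup>2) * exp z"]) (simp add: complex_eq_iff power2_eq_square field_simps)
  then show ?thesis unfolding gauss_exp r e exp_add of_real_mult[symmetric] by (simp only: mult_ac)
qed

text \<open>The condition \<open>P * X = X\<close> is linear and closed, so it passes from the
  translates \<open>H (w + t)\<close> to their derivative at \<open>t = 0\<close>. Real increments
  suffice: by holomorphy in \<open>cnj w\<close> they already produce the factor
  \<open>pi * lat c x\<close>.\<close>

lemma P_dH: "P * dH w = dH w"
proof -
  let ?g = "\<lambda>x. gauss c w (lat c x)"
  define S where "S = (\<Sum>\<^sub>\<infinity>x. cmod (?g x) * ((pi * cmod (lat c x))\<^sup>2 * exp (pi * cmod (lat c x))))"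
  \<comment> \<open>The scalar cancels the factor of \<open>gauss_shift\<close> that does not depend
    on \<open>x\<close>; the coefficients become \<open>exp (pi t x)\<close> times those of
    \<open>H w\<close>.\<close>
  define A where "A t = scal (of_real (exp (pi / 2 * (2 * t * Re w + t\<^sup>2)))) * H (w + of_real t)" for t
  have PA: "(1 - P) * A t = 0" for t
  proof -
    have "(1 - P) * H v = 0" for v by (simp add: left_diff_distrib P_H)
    then show ?thesis by (simp add: A_def scal_commute[of "1 - P"] mult.assoc flip: mult.assoc[of "1 - P"])
  qed
  have A: "((\<lambda>x. scal (exp (pi * t * lat c x) * ?g x) * W x) has_sum A t) UNIV" for t :: real
  proof -
    have "((\<lambda>x. scal (of_real (exp (pi / 2 * (2 * t * Re w + t\<^sup>2)))) * (scal (gauss c (w + of_real t) (lat c x)) * W x)) has_sum A t) UNIV"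
      unfolding A_def H_def
      by (rule has_sum_mult_left_bop[OF has_sum_infsum[OF abs_summable_summable[OF summable_W[OF summable_gauss[OF c_pos]]]]])
    moreover have "of_real (exp (pi / 2 * (2 * t * Re w + t\<^sup>2))) * gauss c (w + of_real t) (lat c x) = exp (pi * t * lat c x) * ?g x" for x
      unfolding gauss_shift by (simp add: exp_minus flip: mult.assoc)
    ultimately show ?thesis by (simp add: scal_mult[symmetric] flip: mult.assoc)
  qed
  have dH: "((\<lambda>x. scal (lat c x * ?g x) * W x) has_sum dH w) UNIV"
    unfolding dH_def
    by (rule has_sum_infsum[OF abs_summable_summable[OF summable_W]]) (use summable_gauss_cmod_lat[of w] in \<open>simp add: norm_mult mult.commute\<close>)
  have bound: "norm (A t - A 0 - scal (pi * t) * dH w) \<le> t\<^sup>2 * S" if t: "0 < t" "t \<le> 1" for t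
  proof (rule norm_infsum_le)
    have "((\<lambda>x. scal (exp (pi * t * lat c x) * ?g x) * W x - scal (exp (pi * 0 * lat c x) * ?g x) * W x
        - scal (pi * t) * (scal (lat c x * ?g x) * W x)) has_sum A t - A 0 - scal (pi * t) * dH w) UNIV"
      using A[of 0] by (intro has_sum_diff_bop A has_sum_mult_left_bop dH) 
    moreover have "scal (exp (pi * t * lat c x) * ?g x) * W x - scal (exp (pi * 0 * lat c x) * ?g x) * W x
        - scal (pi * t) * (scal (lat c x * ?g x) * W x) = scal ((exp (pi * t * lat c x) - 1 - pi * t * lat c x) * ?g x) * W x" for x
    proof -
      have "scal (pi * t) * (scal (lat c x * ?g x) * W x) = scal (pi * t * lat c x * ?g x) * W x"
        by (simp only: scal_mult mult.assoc)
      then show ?thesis by (simp only: left_diff_distrib scal_diff) simp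
    qed
    ultimately show "((\<lambda>x. scal ((exp (pi * t * lat c x) - 1 - pi * t * lat c x) * ?g x) * W x) has_sum A t - A 0 - scal (pi * t) * dH w) UNIV"
      by (simp only:)
    show "((\<lambda>x. t\<^sup>2 * (cmod (?g x) * ((pi * cmod (lat c x))\<^sup>2 * exp (pi * cmod (lat c x))))) has_sum t\<^sup>2 * S) UNIV"
      unfolding S_def by (intro has_sum_cmult_right has_sum_infsum summable_gauss_exp)
    fix x
    let ?z = "complex_of_real (pi * t) * lat c x"
    have "cmod (exp ?z - (\<Sum>k\<le>1. ?z ^ k / fact k)) \<le> exp \<bar>Re ?z\<bar> * cmod ?z ^ Suc 1 / fact 1"
      by (rule Taylor_exp)
    then have 1: "cmod (exp ?z - 1 - ?z) \<le> exp \<bar>Re ?z\<bar> * (cmod ?z)\<^sup>2"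
      by (simp add: diff_diff_eq power2_eq_square)
    have nz: "cmod ?z = t * (pi * cmod (lat c x))" using t by (simp add: norm_mult)
    have "\<bar>Re ?z\<bar> \<le> cmod ?z" by (rule abs_Re_le_cmod)
    also have "\<dots> \<le> 1 * (pi * cmod (lat c x))" unfolding nz using t by (intro mult_right_mono) auto
    finally have "exp \<bar>Re ?z\<bar> \<le> exp (pi * cmod (lat c x))" by simp
    then have "exp \<bar>Re ?z\<bar> * (cmod ?z)\<^sup>2 \<le> exp (pi * cmod (lat c x)) * (cmod ?z)\<^sup>2" by (rule mult_right_mono) simp
    with 1 have 2: "cmod (exp ?z - 1 - ?z) \<le> exp (pi * cmod (lat c x)) * (t * (pi * cmod (lat c x)))\<^sup>2"
      unfolding nz by linarith
    have "norm (scal ((exp ?z - 1 - ?z) * ?g x) * W x) \<le> cmod (exp ?z - 1 - ?z) * cmod (?g x)"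
      using norm_W[of x] by (simp add: norm_mult mult_left_le)
    also have "\<dots> \<le> exp (pi * cmod (lat c x)) * (t * (pi * cmod (lat c x)))\<^sup>2 * cmod (?g x)"
      by (rule mult_right_mono[OF 2]) simp
    also have "\<dots> = t\<^sup>2 * (cmod (?g x) * ((pi * cmod (lat c x))\<^sup>2 * exp (pi * cmod (lat c x))))"
      by (simp only: power_mult_distrib mult_ac)
    finally show "norm (scal ((exp ?z - 1 - ?z) * ?g x) * W x) \<le> \<dots>" .
  qed
  \<comment> \<open>\<open>1 - P\<close> kills \<open>A t\<close> and \<open>A 0\<close>, so
    \<open>t N\<close> is bounded by the remainder of order \<open>t^2\<close>; letting
    \<open>t\<close> tend to 0 gives \<open>N = 0\<close>.\<close>
  define N where "N = pi * norm ((1 - P) * dH w)"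
  have S0: "0 \<le> S" unfolding S_def by (intro infsum_nonneg) auto
  have "N \<le> t * (norm (1 - P) * S)" if t: "0 < t" "t \<le> 1" for t
  proof -
    have "(1 - P) * (A t - A 0 - scal (pi * t) * dH w) = - (scal (pi * t) * ((1 - P) * dH w))"
      by (simp only: right_diff_distrib PA) (simp add: scal_commute flip: mult.assoc)
    then have "norm (scal (pi * t) * ((1 - P) * dH w)) = norm ((1 - P) * (A t - A 0 - scal (pi * t) * dH w))"
      by (metis norm_minus_cancel)
    also have "\<dots> \<le> norm (1 - P) * (t\<^sup>2 * S)"
      by (rule norm_mult_ineq[THEN order_trans], rule mult_left_mono[OF bound[OF t]]) simp
    finally have "t * N \<le> t * (t * (norm (1 - P) * S))"
      using t by (simp add: N_def norm_mult power2_eq_square mult_ac del: of_real_mult)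
    then show ?thesis using t by simp
  qed
  moreover have "((\<lambda>t. t * (norm (1 - P) * S)) \<longlongrightarrow> 0 * (norm (1 - P) * S)) (at_right 0)"
    by (intro tendsto_intros)
  ultimately have "N \<le> 0 * (norm (1 - P) * S)"
    by (intro tendsto_lowerbound[of _ _ "at_right 0"]) (auto simp: eventually_at_right_field intro!: exI[of _ 1])
  then have "norm ((1 - P) * dH w) \<le> 0" using pi_gt_zero by (simp add: N_def mult_le_0_iff)
  then show ?thesis by (simp add: left_diff_distrib)
qed

lemma commutator_bound_H:
  assumes W: "\<And>x. commutator_bound f 0 (W x) (L * cmod (lat c x))" and L: "0 \<le> L"
  shows "commutator_bound f 0 (H w) (L * gauss_const c * (1 + cmod w))"
proof -
  have s: "(\<lambda>x. cmod (gauss c w (lat c x)) * (L * cmod (lat c x))) summable_on UNIV"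
    using summable_on_cmult_right[OF summable_gauss_cmod_lat, of L w] by (simp add: mult.left_commute)
  have "commutator_bound f 0 (H w) (\<Sum>\<^sub>\<infinity>x. cmod (gauss c w (lat c x)) * (L * cmod (lat c x)))"
    unfolding H_def by (rule commutator_bound_infsum[OF W s summable_W[OF summable_gauss[OF c_pos]]])
  moreover have "(\<Sum>\<^sub>\<infinity>x. cmod (gauss c w (lat c x)) * (L * cmod (lat c x))) \<le> L * gauss_const c * (1 + cmod w)"
    using mult_left_mono[OF infsum_gauss_cmod_lat[of w] L] by (simp add: mult.left_commute[of _ L] infsum_cmult_right' mult.assoc)
  ultimately show ?thesis by (rule commutator_bound_mono)
qed

lemma commutator_bound_dH:
  assumes W: "\<And>x. commutator f (W x) (scal (lat c x) * W x)"
  shows "commutator_bound f (1 - P) (H w) (gauss_const c * (1 + cmod w))"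
proof -
  have s: "(\<lambda>x. cmod (lat c x * gauss c w (lat c x))) summable_on UNIV"
    using summable_gauss_cmod_lat[of w] by (simp add: norm_mult mult.commute)
  have "commutator f (H w) (dH w)"
  proof (rule commutator_infsum)
    show "((\<lambda>x. scal (gauss c w (lat c x)) * W x) has_sum H w) UNIV"
      unfolding H_def by (rule has_sum_infsum[OF abs_summable_summable[OF summable_W[OF summable_gauss[OF c_pos]]]])
    show "((\<lambda>x. scal (lat c x * gauss c w (lat c x)) * W x) has_sum dH w) UNIV"
      unfolding dH_def by (rule has_sum_infsum[OF abs_summable_summable[OF summable_W[OF s]]])
    show "commutator f (scal (gauss c w (lat c x)) * W x) (scal (lat c x * gauss c w (lat c x)) * W x)" for x
      using commutator_scal[OF W, of "gauss c w (lat c x)" x] by (simp add: scal_mult[symmetric] mult.commute flip: mult.assoc)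
  qed
  moreover have "norm (dH w) \<le> gauss_const c * (1 + cmod w)"
  proof -
    have "norm (dH w) \<le> (\<Sum>\<^sub>\<infinity>x. cmod (lat c x * gauss c w (lat c x)))"
      unfolding dH_def using norm_W
      by (intro norm_infsum_bop_le summable_W s) (simp add: mult_left_le)
    also have "\<dots> \<le> gauss_const c * (1 + cmod w)"
      using infsum_gauss_cmod_lat[of w] by (simp add: norm_mult mult.commute)
    finally show ?thesis .
  qed
  ultimately show ?thesis unfolding commutator_bound_def by (auto simp: left_diff_distrib P_dH)
qed

text \<open>The coefficient at \<open>\<o>\<close> acts like the trace of the torus: it kills
  \<open>W x\<close> for nonzero \<open>x\<close>. So \<open>T_induct\<close> runs with the constant
  \<open>1/8\<close>, a bound for \<open>c^2\<close>, and the geometric series doubles it. As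
  \<open>1/4 < 1\<close>, the vector \<open>ket \<o>\<close> cannot be fixed by
  \<open>P\<close>.\<close>

lemma
  assumes W: "\<And>x. coord (app (W x) (ket \<o>)) \<o> = (if x = (0, 0) then 1 else 0)"
  shows coord_H: "coord (app (H w) (ket \<o>)) \<o> = gauss c w 0"
    and coord_P: "cmod (coord (app P (ket \<o>)) \<o>) \<le> 1 / 4"
proof -
  have bl: "bounded_linear (\<lambda>A. coord (app A (ket \<o>)) \<o>)"
    by (rule bounded_linear_compose[OF bounded_linear_coord bounded_linear_app_left])
  show coord_H: "coord (app (H w) (ket \<o>)) \<o> = gauss c w 0" for w
  proof -
    have "((\<lambda>x. coord (app (scal (gauss c w (lat c x)) * W x) (ket \<o>)) \<o>) has_sum coord (app (H w) (ket \<o>)) \<o>) UNIV"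
      unfolding H_def
      by (rule has_sum_bounded_linear[OF bl has_sum_infsum[OF abs_summable_summable[OF summable_W[OF summable_gauss[OF c_pos]]]]])
    moreover have "((\<lambda>x. coord (app (scal (gauss c w (lat c x)) * W x) (ket \<o>)) \<o>) has_sum gauss c w 0) UNIV"
      by (rule has_sum_finite_neutralI[of "{(0, 0)}"]) (auto simp: W)
    ultimately show ?thesis by (rule has_sum_unique)
  qed
  have T: "cmod (coord (app (T n w) (ket \<o>)) \<o>) \<le> 1 / 8 * (1 / 2) ^ n * (1 + cmod w)" for n w
  proof (rule T_induct)
    show "cmod (coord (app (\<Sum>\<^sub>\<infinity>x\<in>I. scal (a x) * X x) (ket \<o>)) \<o>) \<le> (\<Sum>\<^sub>\<infinity>x\<in>I. cmod (a x) * B x)"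
      if X: "\<And>x. x \<in> I \<Longrightarrow> cmod (coord (app (X x) (ket \<o>)) \<o>) \<le> B x" "(\<lambda>x. cmod (a x) * B x) summable_on I"
        "(\<lambda>x. norm (scal (a x) * X x)) summable_on I" for I and X :: "int \<times> int \<Rightarrow> 'i bop" and a B
    proof (rule norm_infsum_le)
      show "((\<lambda>x. coord (app (scal (a x) * X x) (ket \<o>)) \<o>) has_sum coord (app (\<Sum>\<^sub>\<infinity>x\<in>I. scal (a x) * X x) (ket \<o>)) \<o>) I"
        by (rule has_sum_bounded_linear[OF bl has_sum_infsum[OF abs_summable_summable[OF X(3)]]])
      show "((\<lambda>x. cmod (a x) * B x) has_sum (\<Sum>\<^sub>\<infinity>x\<in>I. cmod (a x) * B x)) I" by (rule has_sum_infsum[OF X(2)])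
    qed (auto simp: norm_mult intro!: mult_left_mono X(1))
    show "cmod (coord (app (H w) (ket \<o>)) \<o>) \<le> 1 / 8 * (1 + cmod w)" for w
    proof -
      have "cmod (coord (app (H w) (ket \<o>)) \<o>) \<le> c\<^sup>2 * 1"
        unfolding coord_H norm_gauss by (intro mult_left_mono) auto
      also have "\<dots> \<le> 1 / 8 * (1 + cmod w)" using c_small norm_ge_zero[of w] by (simp del: norm_ge_zero)
      finally show ?thesis .
    qed
  qed auto
  have "(\<lambda>n. coord (app (T n 0) (ket \<o>)) \<o>) sums coord (app P (ket \<o>)) \<o>"
    by (rule bounded_linear.sums[OF bl sums_P])
  moreover have g: "(\<lambda>n. 1 / 8 * (1 / 2) ^ n :: real) sums (1 / 8 * (1 / (1 - 1 / 2)))"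
    by (intro sums_mult geometric_sums) auto
  ultimately have "cmod (coord (app P (ket \<o>)) \<o>) \<le> 1 / 8 * (1 / (1 - 1 / 2))"
    using norm_suminf_le[of "\<lambda>n. coord (app (T n 0) (ket \<o>)) \<o>" "\<lambda>n. 1 / 8 * (1 / 2) ^ n"] T[of _ 0]
    by (simp add: sums_iff)
  then show "cmod (coord (app P (ket \<o>)) \<o>) \<le> 1 / 4" by simp
qed

lemma compression_P:
  assumes u: "\<And>i. cmod (u i) = 1" and m: "m \<o> = 0" "\<And>i. i \<noteq> \<o> \<Longrightarrow> 0 < Re (m i)" "\<And>N. finite {i. cmod (m i) \<le> N}"
    and Wm: "\<And>x. commutator_bound m 0 (W x) (L * cmod (lat c x))" and L: "0 \<le> L"
    and Wz: "\<And>x. commutator (\<lambda>i. u i * m i) (W x) (scal (lat c x) * W x)"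
    and W: "\<And>x. coord (app (W x) (ket \<o>)) \<o> = (if x = (0, 0) then 1 else 0)"
  shows "\<exists>Y Yz. compression P Y Yz u m \<o>"
proof -
  obtain Y where Y: "commutator m P Y"
    using commutator_bound_P[OF commutator_bound_H[OF Wm L]] L gauss_const_nonneg[OF c_pos] by auto
  obtain Yz where Yz: "commutator (\<lambda>i. u i * m i) P Yz" "(1 - P) * Yz = 0"
    using commutator_bound_P[OF commutator_bound_dH[OF Wz]] gauss_const_nonneg[OF c_pos] by auto
  have "compression P Y Yz u m \<o>"
  proof
    show "P * Yz = Yz" using Yz(2) by (simp add: left_diff_distrib)
    show "app P (ket \<o>) \<noteq> ket \<o>"
    proof
      assume "app P (ket \<o>) = ket \<o>"
      then show False using coord_P[OF W] by (simp add: coord_ket)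
    qed
    have "app P (app (H 0) (ket \<o>)) = app (H 0) (ket \<o>)"
      using arg_cong[OF P_H[of 0], of "\<lambda>A. app A (ket \<o>)"] by simp
    moreover have "gauss c 0 0 \<noteq> 0" using c_pos by (simp add: gauss_def)
    ultimately show "\<exists>r. coord (app P r) \<o> \<noteq> 0" using coord_H[OF W, of 0] by metis
  qed (use P_idem P_self u m Y Yz in auto)
  then show ?thesis by blast
qed

end

section \<open>Weyl systems in representations of \<open>C(U\<^sub>q(2))\<close>\<close>

lemma scal_mult_scal: "scal a * X * (scal b * Y) = scal (a * b) * (X * Y)"
  by (rule bop_eqI) (simp add: scal_mult)

lemma qcomm_power_left:
  assumes "X * Y = scal a * (Y * X)"
  shows "X ^ n * Y = scal (a ^ n) * (Y * X ^ n)"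
proof (induction n)
  case (Suc n)
  have "X ^ Suc n * Y = X * (X ^ n * Y)" by (simp add: mult.assoc)
  also have "\<dots> = scal (a ^ n) * (X * Y) * X ^ n"
    unfolding Suc by (simp only: mult.assoc[symmetric] scal_commute[of X])
  also have "\<dots> = scal (a ^ Suc n) * (Y * X ^ Suc n)"
    unfolding assms by (simp only: mult.assoc power_Suc2 scal_mult) (simp add: mult.assoc power_commutes)
  finally show ?case .
qed simp

lemma qcomm_power:
  assumes "X * Y = scal a * (Y * X)"
  shows "X ^ n * Y ^ k = scal (a ^ (n * k)) * (Y ^ k * X ^ n)"
proof (induction k)
  case (Suc k)
  have "X ^ n * Y ^ Suc k = (X ^ n * Y) * Y ^ k" by (simp add: mult.assoc)
  also have "\<dots> = scal (a ^ n) * (Y * (X ^ n * Y ^ k))"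
    unfolding qcomm_power_left[OF assms] by (simp only: mult.assoc)
  also have "\<dots> = scal (a ^ n) * (scal (a ^ (n * k)) * (Y * (Y ^ k * X ^ n)))"
    unfolding Suc by (simp only: mult.assoc[symmetric] scal_commute[of Y])
  also have "\<dots> = scal (a ^ (n * Suc k)) * (Y ^ Suc k * X ^ n)"
    by (simp add: power_add scal_mult mult.assoc)
  finally show ?case .
qed simp

text \<open>Integer powers with \<open>X'\<close> in the role of the inverse, which it need only be
  on a corner: \<open>X * X' * e = e\<close>. In the application \<open>e\<close> is the projection
  \<open>p\<close>.\<close>

definition ipow :: "'a::monoid_mult \<Rightarrow> 'a \<Rightarrow> int \<Rightarrow> 'a" where
  "ipow X X' j = (if 0 \<le> j then X ^ nat j else X' ^ nat (- j))"

lemma ipow_0 [simp]: "ipow X X' 0 = 1"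
  by (simp add: ipow_def)

lemma ipow_commute: "X * E = E * X \<Longrightarrow> X' * E = E * X' \<Longrightarrow> ipow X X' j * E = E * ipow X X' j"
  for X :: "'a::monoid_mult"
  by (auto simp: ipow_def power_commuting_commutes)

lemma ipow_qcomm:
  assumes "X * Y = scal (cis \<phi>) * (Y * X)" "X * Y' = scal (cis (- \<phi>)) * (Y' * X)"
    "X' * Y = scal (cis (- \<phi>)) * (Y * X')" "X' * Y' = scal (cis \<phi>) * (Y' * X')"
  shows "ipow X X' j * ipow Y Y' k = scal (cis (\<phi> * j * k)) * (ipow Y Y' k * ipow X X' j)"
  using qcomm_power[OF assms(1), of "nat j" "nat k"] qcomm_power[OF assms(2), of "nat j" "nat (- k)"]
    qcomm_power[OF assms(3), of "nat (- j)" "nat k"] qcomm_power[OF assms(4), of "nat (- j)" "nat (- k)"]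
  by (auto simp: ipow_def Complex.DeMoivre mult_ac)

lemma
  fixes X X' e :: "'a::monoid_mult"
  assumes comm: "X * X' = X' * X" and unit: "X * X' * e = e" and Xe: "X * e = e * X" "X' * e = e * X'"
  shows ipow_step: "X * (ipow X X' j * e) = ipow X X' (j + 1) * e"
    and ipow_step': "X' * (ipow X X' j * e) = ipow X X' (j - 1) * e"
    and ipow_add: "e * e = e \<Longrightarrow> ipow X X' i * (ipow X X' j * e) = ipow X X' (i + j) * e"
proof -
  have N: "X * X' * X ^ n = X ^ n * (X * X')" "X * X' * X' ^ n = X' ^ n * (X * X')" for n
    by (rule power_commuting_commutes[symmetric], metis comm mult.assoc)+
  have 1: "X * (X' ^ Suc n * e) = X' ^ n * e" for n
  proof -
    have "X * (X' ^ Suc n * e) = (X * X' * X' ^ n) * e" by (simp add: mult.assoc)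
    also have "\<dots> = X' ^ n * (X * X' * e)" unfolding N by (simp add: mult.assoc)
    finally show ?thesis unfolding unit .
  qed
  have 2: "X' * (X ^ Suc n * e) = X ^ n * e" for n
  proof -
    have "X' * (X ^ Suc n * e) = (X * X' * X ^ n) * e" unfolding comm by (simp add: mult.assoc)
    also have "\<dots> = X ^ n * (X * X' * e)" unfolding N by (simp add: mult.assoc)
    finally show ?thesis unfolding unit .
  qed
  show step: "X * (ipow X X' j * e) = ipow X X' (j + 1) * e" for j
  proof (cases "0 \<le> j")
    case True
    then have "nat (j + 1) = Suc (nat j)" by simp
    then show ?thesis using True by (simp add: ipow_def mult.assoc)
  next
    case False
    then have "0 < nat (- j)" by simp
    then obtain n where n: "nat (- j) = Suc n" using gr0_conv_Suc by auto
    then have j: "j = - 1 - int n" using False by linarith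
    then show ?thesis using 1[of n] by (cases n) (auto simp: ipow_def n nat_add_distrib)
  qed
  show step': "X' * (ipow X X' j * e) = ipow X X' (j - 1) * e" for j
  proof (cases "0 < j")
    case True
    then have "0 < nat j" by simp
    then obtain n where n: "nat j = Suc n" using gr0_conv_Suc by auto
    then have "j = int n + 1" using True by linarith
    then show ?thesis using 2[of n] by (simp add: ipow_def nat_add_distrib)
  next
    case False
    then have "nat (- (j - 1)) = Suc (nat (- j))" by simp
    then show ?thesis using False by (cases "j = 0") (auto simp: ipow_def mult.assoc)
  qed
  have pe: "ipow X X' j * e = e * ipow X X' j" for j by (rule ipow_commute) (use Xe in auto)
  show "ipow X X' i * (ipow X X' j * e) = ipow X X' (i + j) * e" if "e * e = e"
  proof -
    have ee: "ipow X X' j * e = e * (ipow X X' j * e)" for j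
      using that pe[of j] by (metis mult.assoc)
    show ?thesis
    proof (induction i rule: int_induct[of _ 0])
      case base show ?case by simp
    next
      case (step1 i)
      have "ipow X X' (i + 1) * (ipow X X' j * e) = (ipow X X' (i + 1) * e) * (ipow X X' j * e)"
        using ee[of j] by (simp add: mult.assoc)
      also have "\<dots> = X * (ipow X X' i * (e * (ipow X X' j * e)))" unfolding step[symmetric] by (simp add: mult.assoc)
      also have "\<dots> = ipow X X' (i + 1 + j) * e" unfolding ee[symmetric] step1 step by (simp add: algebra_simps)
      finally show ?case .
    next
      case (step2 i)
      have "ipow X X' (i - 1) * (ipow X X' j * e) = (ipow X X' (i - 1) * e) * (ipow X X' j * e)"
        using ee[of j] by (simp add: mult.assoc)
      also have "\<dots> = X' * (ipow X X' i * (e * (ipow X X' j * e)))" unfolding step'[symmetric] by (simp add: mult.assoc)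
      also have "\<dots> = ipow X X' (i - 1 + j) * e" unfolding ee[symmetric] step2 step' by (simp add: algebra_simps)
      finally show ?case .
    qed
  qed
qed

lemma norm_power_le_1: "norm (X ^ n) \<le> 1" if "norm X \<le> 1" for X :: "'a::real_normed_algebra_1"
  using norm_power_ineq[of X n] power_le_one[of "norm X" n] that by simp

lemma norm_ipow_le_1: "norm X \<le> 1 \<Longrightarrow> norm X' \<le> 1 \<Longrightarrow> norm (ipow X X' j) \<le> 1"
  for X :: "'a::real_normed_algebra_1"
  by (simp add: ipow_def norm_power_le_1)

lemma adjoint_pair_ipow: "adjoint_pair X X' \<Longrightarrow> adjoint_pair (ipow X X' j) (ipow X X' (- j))"
  by (cases j "0 :: int" rule: linorder_cases)
    (auto simp: ipow_def adjoint_pair_one intro: adjoint_pair_power adjoint_pair_sym)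

section \<open>The corner projection and the Weyl operators of one representation\<close>

locale uq2_rep =
  fixes q :: complex and A A' B B' V V' :: "'i bop" and \<phi> :: real
  assumes q: "0 < cmod q" "cmod q < 1"
    and adj_A: "adjoint_pair A A'" and adj_B: "adjoint_pair B B'" and adj_V: "adjoint_pair V V'"
    and BA: "B * A = scal q * (A * B)" and A'B: "A' * B = scal q * (B * A')"
    and BB': "B * B' = B' * B" and AA': "A * A' + B * B' = 1"
    and BV: "B * V = scal (cis \<phi>) * (V * B)" and VV': "V * V' = 1" "V' * V = 1"
begin

definition N :: "'i bop" where "N = B * B'"

lemma B'A: "B' * A = scal (cnj q) * (A * B')"
proof -
  have "adjoint_pair (A' * B) (B' * A)"
    by (rule adjoint_pair_mult[OF adjoint_pair_sym[OF adj_A] adj_B])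
  moreover have "adjoint_pair (scal q * (B * A')) (A * B' * scal (cnj q))"
    by (intro adjoint_pair_mult adjoint_pair_scal adj_B adjoint_pair_sym[OF adj_A])
  ultimately show ?thesis
    unfolding A'B by (metis adjoint_pair_unique scal_commute)
qed

lemma NA: "N * A = scal (of_real ((cmod q)\<^sup>2)) * (A * N)"
proof -
  have "N * A = B * (scal (cnj q) * (A * B'))" unfolding N_def by (simp add: mult.assoc B'A)
  also have "\<dots> = scal (cnj q) * (B * A) * B'" by (simp only: mult.assoc[symmetric] scal_commute[of B])
  also have "\<dots> = scal (q * cnj q) * (A * N)" by (simp add: BA N_def scal_mult mult.assoc mult.commute[of q])
  finally show ?thesis unfolding complex_norm_square by simp
qed

lemma V'B: "V' * B = scal (cis \<phi>) * (B * V')"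
proof -
  have "V' * B = V' * (B * V) * V'" by (simp add: mult.assoc VV')
  also have "\<dots> = scal (cis \<phi>) * (V' * V) * B * V'"
    unfolding BV by (simp only: mult.assoc[symmetric] scal_commute[of V'])
  finally show ?thesis by (simp add: VV' mult.assoc)
qed

lemma cis_cancel: "scal (cis (- t)) * (scal (cis t) * X) = X" "scal (cis t) * (scal (cis (- t)) * X) = X"
  by (simp_all add: cis_mult flip: scal_mult mult.assoc)

lemma BV': "B * V' = scal (cis (- \<phi>)) * (V' * B)"
  unfolding V'B cis_cancel ..

lemma B'V: "B' * V = scal (cis (- \<phi>)) * (V * B')"
proof -
  have "adjoint_pair (V' * B) (B' * V)"
    by (rule adjoint_pair_mult[OF adjoint_pair_sym[OF adj_V] adj_B])
  moreover have "adjoint_pair (scal (cis \<phi>) * (B * V')) (V * B' * scal (cnj (cis \<phi>)))"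
    by (intro adjoint_pair_mult adjoint_pair_scal adj_B adjoint_pair_sym[OF adj_V])
  ultimately show ?thesis
    unfolding V'B by (metis adjoint_pair_unique scal_commute cis_cnj)
qed

lemma B'V': "B' * V' = scal (cis \<phi>) * (V' * B')"
proof -
  have "adjoint_pair (V * B) (B' * V')" by (rule adjoint_pair_mult[OF adj_V adj_B])
  moreover have "V * B = scal (cis (- \<phi>)) * (B * V)" unfolding BV cis_cancel ..
  moreover have "adjoint_pair (scal (cis (- \<phi>)) * (B * V)) (V' * B' * scal (cnj (cis (- \<phi>))))"
    by (intro adjoint_pair_mult adjoint_pair_scal adj_B adj_V)
  ultimately show ?thesis by (metis adjoint_pair_unique scal_commute cis_cnj minus_minus)
qed

lemma norm_le_1: "norm A \<le> 1" "norm A' \<le> 1" "norm B \<le> 1" "norm B' \<le> 1" "norm V \<le> 1" "norm V' \<le> 1"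
proof -
  have "cinner (app (A * A' + B * B') x) x = cinner x x" for x unfolding AA' by simp
  then have "cinner (app A' x) (app A' x) + cinner (app B' x) (app B' x) = cinner x x" for x
    using adjoint_pairD[OF adj_A] adjoint_pairD[OF adj_B] by simp
  then have "complex_of_real ((norm (app A' x))\<^sup>2 + (norm (app B' x))\<^sup>2) = of_real ((norm x)\<^sup>2)" for x
    unfolding cinner_self by simp
  then have s: "(norm (app A' x))\<^sup>2 + (norm (app B' x))\<^sup>2 = (norm x)\<^sup>2" for x
    using of_real_eq_iff by blast
  have "norm (app A' x) \<le> 1 * norm x" "norm (app B' x) \<le> 1 * norm x" for x
  proof -
    have "(norm (app A' x))\<^sup>2 \<le> (norm x)\<^sup>2" "(norm (app B' x))\<^sup>2 \<le> (norm x)\<^sup>2"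
      using s[of x] zero_le_power2[of "norm (app A' x)"] zero_le_power2[of "norm (app B' x)"] by linarith+
    then show "norm (app A' x) \<le> 1 * norm x" "norm (app B' x) \<le> 1 * norm x"
      by (auto dest: power2_le_imp_le)
  qed
  then show 1: "norm A' \<le> 1" "norm B' \<le> 1" using norm_bop_le[of 1] by auto
  show "norm A \<le> 1" "norm B \<le> 1"
    using adjoint_pair_norm_le[OF adjoint_pair_sym[OF adj_A]] adjoint_pair_norm_le[OF adjoint_pair_sym[OF adj_B]] 1
    by linarith+
  have "norm (app V x) \<le> 1 * norm x" for x
  proof -
    have "cinner (app V x) (app V x) = cinner x (app (V' * V) x)" by (simp add: adjoint_pairD[OF adj_V])
    then have "(norm (app V x))\<^sup>2 = (norm x)\<^sup>2" unfolding VV' cinner_self by (simp only: app_simps cinner_self of_real_eq_iff)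
    then show ?thesis by simp
  qed
  then show "norm V \<le> 1" using norm_bop_le[of 1] by auto
  then show "norm V' \<le> 1" using adjoint_pair_norm_le[OF adj_V] by simp
qed

lemma norm_N: "norm N \<le> 1"
  unfolding N_def by (rule norm_mult_ineq[THEN order_trans]) (intro mult_le_one norm_le_1 norm_ge_zero)

text \<open>\<open>1 - N\<close> is \<open>A A'\<close>, and moving \<open>N^n\<close> past
  \<open>A\<close> yields the scalar \<open>|q|^(2n)\<close>. The rate depends on \<open>q\<close>
  only, not on the representation.\<close>

lemma N_power_diff: "norm (N ^ n * (1 - N)) \<le> ((cmod q)\<^sup>2) ^ n"
proof -
  have "1 - N = A * A'" using AA' by (simp add: N_def algebra_simps)
  then have "N ^ n * (1 - N) = (N ^ n * A) * A'" by (simp add: mult.assoc)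
  also have "\<dots> = scal (of_real ((cmod q)\<^sup>2) ^ n) * (A * N ^ n * A')"
    unfolding qcomm_power_left[OF NA] by (simp only: mult.assoc)
  finally have e: "N ^ n * (1 - N) = scal (of_real ((cmod q)\<^sup>2) ^ n) * (A * N ^ n * A')" .
  have "norm (A * N ^ n * A') \<le> norm A * norm (N ^ n) * norm A'"
    by (intro norm_mult_ineq[THEN order_trans] mult_right_mono norm_mult_ineq norm_ge_zero)
  also have "\<dots> \<le> 1" by (intro mult_le_one norm_le_1 norm_power_le_1 norm_N mult_nonneg_nonneg norm_ge_zero)
  finally show ?thesis unfolding e by (simp add: norm_power mult_left_le)
qed

text \<open>The limit of \<open>N^n\<close> as a telescoping series: its terms have the uniform
  majorant \<open>|q|^(2n)\<close>, which places the family of these \<open>p\<close> in the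
  algebra.\<close>

definition p :: "'i bop" where "p = 1 - (\<Sum>\<^sub>\<infinity>n. N ^ n * (1 - N))"

lemma N_tendsto: "(\<lambda>n. N ^ n) \<longlonglongrightarrow> p"
proof -
  have q2: "(cmod q)\<^sup>2 < 1" using q power_strict_mono[of "cmod q" 1 2] by simp
  have "summable (\<lambda>n. norm (N ^ n * (1 - N)))"
    by (rule summable_comparison_test'[of "\<lambda>n. ((cmod q)\<^sup>2) ^ n" 0])
      (use q2 N_power_diff in \<open>auto intro: summable_geometric\<close>)
  from norm_summable_imp_has_sum[OF this summable_sums[OF summable_norm_cancel[OF this]]]
  have "((\<lambda>n. N ^ n * (1 - N)) has_sum (\<Sum>\<^sub>\<infinity>n. N ^ n * (1 - N))) UNIV"
    by (simp add: has_sum_imp_summable)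
  then have "(\<lambda>n. \<Sum>k<n. N ^ k * (1 - N)) \<longlonglongrightarrow> (\<Sum>\<^sub>\<infinity>n. N ^ n * (1 - N))"
    using has_sum_imp_sums by (auto simp: sums_def)
  moreover have "(\<Sum>k<n. N ^ k * (1 - N)) = 1 - N ^ n" for n
    by (induction n) (simp_all add: power_Suc2 algebra_simps del: power_Suc)
  ultimately have "(\<lambda>n. 1 - N ^ n) \<longlonglongrightarrow> 1 - p" by (simp add: p_def)
  from tendsto_diff[OF tendsto_const[of 1] this] show ?thesis by simp
qed

lemma norm_p: "norm p \<le> 1"
  by (rule LIMSEQ_le_const2[OF tendsto_norm[OF N_tendsto]]) (use norm_power_le_1[OF norm_N] in auto)

lemma p_commute:
  assumes "X * N = N * X" shows "X * p = p * X"
proof (rule LIMSEQ_unique)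
  show "(\<lambda>n. X * N ^ n) \<longlonglongrightarrow> X * p" by (intro tendsto_intros N_tendsto)
  have "N ^ n * X = X * N ^ n" for n using assms by (intro power_commuting_commutes) simp
  then show "(\<lambda>n. X * N ^ n) \<longlonglongrightarrow> p * X"
    using tendsto_mult[OF N_tendsto tendsto_const[of X]] by simp
qed

lemma p_B: "B * p = p * B" "B' * p = p * B'" and p_V: "V * p = p * V" "V' * p = p * V'"
proof -
  show "B * p = p * B" "B' * p = p * B'"
    by (rule p_commute, simp add: N_def mult.assoc BB'[symmetric])
      (rule p_commute, simp add: N_def mult.assoc BB')
  have "V * N = (V * B) * B'" by (simp add: N_def mult.assoc)
  also have "V * B = scal (cis (- \<phi>)) * (B * V)" unfolding BV cis_cancel ..
  also have "\<dots> * B' = scal (cis (- \<phi>)) * (B * (V * B'))" by (simp only: mult.assoc)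
  also have "V * B' = scal (cis \<phi>) * (B' * V)" unfolding B'V cis_cancel ..
  also have "scal (cis (- \<phi>)) * (B * \<dots>) = N * V"
    by (simp only: mult.assoc[symmetric] scal_commute[of B]) (simp add: N_def cis_mult flip: scal_mult)
  finally show V: "V * p = p * V" by (rule p_commute)
  have "V' * p = V' * (p * V) * V'" by (simp add: mult.assoc VV')
  also have "\<dots> = (V' * V) * p * V'" unfolding V[symmetric] by (simp only: mult.assoc)
  finally show "V' * p = p * V'" by (simp add: VV')
qed

lemma N_p: "N * p = p"
  by (rule LIMSEQ_unique[of "\<lambda>n. N ^ Suc n"])
    (use tendsto_mult[OF tendsto_const[of N] N_tendsto] LIMSEQ_Suc[OF N_tendsto] in simp_all)

lemma p_idem: "p * p = p"
proof -
  have "N ^ n * p = p" for n by (induction n) (simp_all add: N_p mult.assoc)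
  then have "(\<lambda>n. p) \<longlonglongrightarrow> p * p" using tendsto_mult[OF N_tendsto tendsto_const[of p]] by simp
  then show ?thesis by (simp add: LIMSEQ_const_iff)
qed

lemma p_self: "adjoint_pair p p"
proof -
  have "adjoint_pair N N" unfolding N_def by (intro adjoint_pair_mult adj_B adjoint_pair_sym[OF adj_B])
  then have "adjoint_pair (N ^ n) (N ^ n)" for n by (rule adjoint_pair_power)
  then show ?thesis by (intro adjoint_pair_tendsto[OF always_eventually N_tendsto N_tendsto]) auto
qed

text \<open>The scalar is the symmetric ordering of the two generators of the torus: it turns the
  commutation phase into the antisymmetric \<open>twist\<close> and makes \<open>- x\<close>
  correspond to the adjoint.\<close>

definition weyl :: "nat \<Rightarrow> real \<Rightarrow> int \<times> int \<Rightarrow> 'i bop" where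
  "weyl m \<alpha> = (\<lambda>(j, k). scal (cis (pi * \<alpha> * j * k)) * (ipow B B' j * (ipow V V' (int m * k) * p)))"

lemma weyl_system_weyl:
  assumes c: "0 < c" "c\<^sup>2 \<le> 1 / 8" and \<phi>: "\<And>n :: int. cis (\<phi> * m * n) = cis (- 2 * pi * c\<^sup>2 * n)"
  shows "weyl_system (weyl m (c\<^sup>2)) c"
proof
  let ?b = "ipow B B'" and ?v = "\<lambda>k. ipow V V' (int m * k)"
  note pb = ipow_commute[OF p_B] and pv = ipow_commute[OF p_V]
  have badd: "?b i * (?b j * p) = ?b (i + j) * p" for i j
    using N_p by (intro ipow_add[OF BB' _ p_B p_idem]) (simp add: N_def)
  have vadd: "?v i * (?v j * p) = ?v (i + j) * p" for i j
    using ipow_add[where i = "int m * i" and j = "int m * j", OF _ _ p_V p_idem] by (simp add: VV' distrib_left)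
  have bv: "?b j * ?v k = scal (cis (- 2 * pi * c\<^sup>2 * j * k)) * (?v k * ?b j)" for j k
  proof -
    have "cis (\<phi> * j * (int m * k)) = cis (\<phi> * m * (j * k))"
      by (rule arg_cong[of _ _ cis]) simp
    also have "\<dots> = cis (- 2 * pi * c\<^sup>2 * j * k)" using \<phi>[of "j * k"] by (simp add: mult_ac)
    finally show ?thesis using ipow_qcomm[OF BV BV' B'V B'V', of j "int m * k"] by simp
  qed
  have vb: "?v k * ?b j = scal (cis (2 * pi * c\<^sup>2 * j * k)) * (?b j * ?v k)" for j k
    unfolding bv by (simp add: cis_cancel)
  show "weyl m (c\<^sup>2) x * weyl m (c\<^sup>2) y = scal (twist (lat c x) (lat c y)) * weyl m (c\<^sup>2) (x + y)" for x y
  proof -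
    obtain j k where x: "x = (j, k)" by (cases x)
    obtain j' k' where y: "y = (j', k')" by (cases y)
    have "?b j * (?v k * p) * (?b j' * (?v k' * p)) = ?b j * (?v k * (p * (?b j' * ?v k'))) * p"
      by (simp only: mult.assoc)
    also have "p * (?b j' * ?v k') = ?b j' * ?v k' * p"
      by (simp only: mult.assoc[symmetric] pb[symmetric]) (simp only: mult.assoc pv)
    also have "?b j * (?v k * (?b j' * ?v k' * p)) * p = ?b j * ((?v k * ?b j') * (?v k' * (p * p)))"
      by (simp only: mult.assoc)
    also have "\<dots> = ?b j * (scal (cis (2 * pi * c\<^sup>2 * j' * k)) * (?b j' * (?v k * (?v k' * p))))"
      unfolding vb p_idem by (simp only: mult.assoc)
    also have "\<dots> = scal (cis (2 * pi * c\<^sup>2 * j' * k)) * (?b j * (?b j' * (?v (k + k') * p)))"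
      unfolding vadd by (simp only: mult.assoc[symmetric] scal_commute[of "?b j"])
    also have "?b j * (?b j' * (?v (k + k') * p)) = ?b j * (?b j' * p) * ?v (k + k')"
      by (simp only: mult.assoc pv)
    also have "\<dots> = ?b (j + j') * (?v (k + k') * p)" unfolding badd by (simp only: mult.assoc pv)
    finally have 1: "?b j * (?v k * p) * (?b j' * (?v k' * p))
        = scal (cis (2 * pi * c\<^sup>2 * j' * k)) * (?b (j + j') * (?v (k + k') * p))" .
    have "weyl m (c\<^sup>2) x * weyl m (c\<^sup>2) y = scal (cis (pi * c\<^sup>2 * j * k) * cis (pi * c\<^sup>2 * j' * k')) *
        (?b j * (?v k * p) * (?b j' * (?v k' * p)))"
      unfolding weyl_def x y split
      by (rule scal_mult_scal)
    also have "\<dots> = scal (cis (pi * c\<^sup>2 * j * k) * cis (pi * c\<^sup>2 * j' * k') * cis (2 * pi * c\<^sup>2 * j' * k)) * (?b (j + j') * (?v (k + k') * p))"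
      unfolding 1 scal_mult by (simp only: mult.assoc)
    also have "cis (pi * c\<^sup>2 * j * k) * cis (pi * c\<^sup>2 * j' * k') * cis (2 * pi * c\<^sup>2 * j' * k)
        = twist (lat c x) (lat c y) * cis (pi * c\<^sup>2 * (j + j') * (k + k'))"
      unfolding twist_def cis_mult x y lat_def by (rule arg_cong[of _ _ cis]) (simp add: power2_eq_square algebra_simps)
    finally show ?thesis by (simp add: weyl_def x y scal_mult mult.assoc)
  qed
  show "norm (weyl m (c\<^sup>2) x) \<le> 1" for x
  proof -
    have "norm (?b j * (?v k * p)) \<le> norm (?b j) * (norm (?v k) * norm p)" for j k
      by (intro norm_mult_ineq[THEN order_trans] mult_left_mono norm_mult_ineq norm_ge_zero)
    also have "\<dots> j k \<le> 1" for j k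
      by (intro mult_le_one norm_ipow_le_1 norm_le_1 norm_p mult_nonneg_nonneg norm_ge_zero)
    finally show ?thesis by (simp add: weyl_def split_beta)
  qed
  show "adjoint_pair (weyl m (c\<^sup>2) x) (weyl m (c\<^sup>2) (- x))" for x
  proof -
    obtain j k where x: "x = (j, k)" by (cases x)
    have "adjoint_pair (weyl m (c\<^sup>2) x) (p * ?v (- k) * ?b (- j) * scal (cnj (cis (pi * c\<^sup>2 * j * k))))"
      unfolding weyl_def x split
      using adjoint_pair_mult[OF adjoint_pair_scal adjoint_pair_mult[OF adjoint_pair_ipow[OF adj_B] adjoint_pair_mult[OF adjoint_pair_ipow[OF adj_V, of "int m * k"] p_self]]]
      by simp
    also have "p * ?v (- k) * ?b (- j) = ?v (- k) * ?b (- j) * p"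
      by (simp only: pv[symmetric] mult.assoc pb)
    also have "\<dots> = scal (cis (2 * pi * c\<^sup>2 * j * k)) * (?b (- j) * (?v (- k) * p))"
      unfolding vb by (simp add: mult.assoc)
    also have "scal (cis (2 * pi * c\<^sup>2 * j * k)) * (?b (- j) * (?v (- k) * p)) * scal (cnj (cis (pi * c\<^sup>2 * j * k))) = weyl m (c\<^sup>2) (- x)"
    proof -
      have "cis (2 * pi * c\<^sup>2 * j * k) * cnj (cis (pi * c\<^sup>2 * j * k)) = cis (pi * c\<^sup>2 * of_int (- j) * of_int (- k))"
        unfolding cis_cnj cis_mult by (rule arg_cong[of _ _ cis]) simp
      moreover have "scal a * X * scal b = scal (a * b) * X" for a b and X :: "'i bop"
        using scal_mult_scal[of a X b 1] by simp
      ultimately show ?thesis by (simp only: x weyl_def uminus_Pair split mult_minus_right)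
    qed
    finally show ?thesis .
  qed
qed (use c in auto)

end

section \<open>Operator families in \<open>C(U\<^sub>q(2))\<close>\<close>

type_synonym family = "hop \<times> hop \<times> hop \<Rightarrow> idx bop"

text \<open>Elements of the algebra carried by values in \<open>bop\<close>, where sums and limits
  are available. The uniform bound is what makes multiplication continuous in
  \<open>lim_family_mult\<close>.\<close>

definition fin_family :: "complex \<Rightarrow> family \<Rightarrow> bool" where
  "fin_family q X \<longleftrightarrow> uq2_elem q (\<lambda>t. app (X t)) \<in> uq2_fin q \<and> (\<exists>K. \<forall>t\<in>uq2_reps q. norm (X t) \<le> K)"

definition lim_family :: "complex \<Rightarrow> family \<Rightarrow> bool" where
  "lim_family q X \<longleftrightarrow> (\<forall>\<epsilon>>0. \<exists>Y. fin_family q Y \<and> (\<forall>t\<in>uq2_reps q. norm (X t - Y t) \<le> \<epsilon>))"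

lemma lim_familyE:
  assumes "lim_family q X" "0 < \<epsilon>"
  obtains Y where "fin_family q Y" "\<And>t. t \<in> uq2_reps q \<Longrightarrow> norm (X t - Y t) \<le> \<epsilon>"
  using assms unfolding lim_family_def by blast

lemma fin_familyE:
  assumes "fin_family q X"
  obtains K where "\<And>t. t \<in> uq2_reps q \<Longrightarrow> norm (X t) \<le> K"
  using assms unfolding fin_family_def by blast

lemma lim_family_C_uq2: "lim_family q X \<Longrightarrow> uq2_elem q (\<lambda>t. app (X t)) \<in> C_uq2 q"
  unfolding C_uq2_def
proof (intro CollectI conjI allI impI)
  fix \<epsilon> :: real assume "lim_family q X" "0 < \<epsilon>"
  then obtain Y where Y: "fin_family q Y" "\<And>t. t \<in> uq2_reps q \<Longrightarrow> norm (X t - Y t) \<le> \<epsilon>"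
    by (rule lim_familyE) blast
  have "norm (app (X t) v - app (Y t) v) \<le> \<epsilon> * norm v" if "t \<in> uq2_reps q" for t v
    using norm_app[of "X t - Y t" v] mult_right_mono[OF Y(2)[OF that], of "norm v"] by simp
  then show "\<exists>y\<in>uq2_fin q. \<forall>t\<in>uq2_reps q. \<forall>v. norm (uq2_elem q (\<lambda>t. app (X t)) t v - y t v) \<le> \<epsilon> * norm v"
    using Y(1) unfolding fin_family_def
    by (intro bexI[of _ "uq2_elem q (\<lambda>t. app (Y t))"]) (auto simp: uq2_elem_def)
qed (simp add: uq2_elem_def)

lemma lim_familyI_fin: "fin_family q X \<Longrightarrow> lim_family q X"
  unfolding lim_family_def by (intro allI impI exI[of _ X]) auto

lemma lim_family_bounded:
  assumes "lim_family q X" shows "\<exists>K\<ge>0. \<forall>t\<in>uq2_reps q. norm (X t) \<le> K"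
proof -
  obtain Y where Y: "fin_family q Y" "\<And>t. t \<in> uq2_reps q \<Longrightarrow> norm (X t - Y t) \<le> 1"
    using lim_familyE[OF assms zero_less_one] by blast
  obtain K where K: "\<And>t. t \<in> uq2_reps q \<Longrightarrow> norm (Y t) \<le> K"
    using fin_familyE[OF Y(1)] by blast
  have "norm (X t) \<le> \<bar>K\<bar> + 1" if "t \<in> uq2_reps q" for t
    using norm_triangle_sub[of "X t" "Y t"] Y(2)[OF that] K[OF that] by linarith
  then show ?thesis by (intro exI[of _ "\<bar>K\<bar> + 1"]) auto
qed

lemma lim_family_closed:
  assumes "\<And>\<epsilon>. 0 < \<epsilon> \<Longrightarrow> \<exists>Y. lim_family q Y \<and> (\<forall>t\<in>uq2_reps q. norm (X t - Y t) \<le> \<epsilon>)"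
  shows "lim_family q X"
  unfolding lim_family_def
proof (intro allI impI)
  fix \<epsilon> :: real assume "0 < \<epsilon>"
  then obtain Y where Y: "lim_family q Y" "\<And>t. t \<in> uq2_reps q \<Longrightarrow> norm (X t - Y t) \<le> \<epsilon> / 2"
    using assms[of "\<epsilon> / 2"] by auto
  obtain Y' where Y': "fin_family q Y'" "\<And>t. t \<in> uq2_reps q \<Longrightarrow> norm (Y t - Y' t) \<le> \<epsilon> / 2"
    using lim_familyE[OF Y(1) half_gt_zero[OF \<open>0 < \<epsilon>\<close>]] by blast
  have "norm (X t - Y' t) \<le> \<epsilon>" if "t \<in> uq2_reps q" for t
    using norm_triangle_ineq[of "X t - Y t" "Y t - Y' t"] Y(2)[OF that] Y'(2)[OF that] by simp
  then show "\<exists>Y. fin_family q Y \<and> (\<forall>t\<in>uq2_reps q. norm (X t - Y t) \<le> \<epsilon>)" using Y'(1) by blast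
qed

lemma lim_family_cong:
  assumes "lim_family q Y" "\<And>t. t \<in> uq2_reps q \<Longrightarrow> X t = Y t" shows "lim_family q X"
  using assms unfolding lim_family_def by (metis (no_types, lifting))

lemma fin_family_add:
  assumes X: "fin_family q X" and Y: "fin_family q Y" shows "fin_family q (\<lambda>t. X t + Y t)"
proof -
  have "uq2_elem q (\<lambda>t. app (X t + Y t)) = uq2_elem q (\<lambda>t. app (X t)) + uq2_elem q (\<lambda>t. app (Y t))"
    by (auto simp: uq2_elem_def fun_eq_iff)
  moreover obtain K where "\<And>t. t \<in> uq2_reps q \<Longrightarrow> norm (X t) \<le> K" using fin_familyE[OF X] by blast
  moreover obtain L where "\<And>t. t \<in> uq2_reps q \<Longrightarrow> norm (Y t) \<le> L" using fin_familyE[OF Y] by blast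
  ultimately have "\<forall>t\<in>uq2_reps q. norm (X t + Y t) \<le> K + L"
    "uq2_elem q (\<lambda>t. app (X t + Y t)) \<in> uq2_fin q"
    using X Y by (auto simp: fin_family_def simp del: app_simps split_paired_All split_paired_Ball_Sigma intro!: uq2_fin.add norm_triangle_le add_mono)
  then show ?thesis unfolding fin_family_def by blast
qed

lemma fin_family_mult:
  assumes X: "fin_family q X" and Y: "fin_family q Y" shows "fin_family q (\<lambda>t. X t * Y t)"
proof -
  have "uq2_elem q (\<lambda>t. app (X t * Y t)) = uq2_mult (uq2_elem q (\<lambda>t. app (X t))) (uq2_elem q (\<lambda>t. app (Y t)))"
    by (auto simp: uq2_elem_def uq2_mult_def fun_eq_iff)
  then have 1: "uq2_elem q (\<lambda>t. app (X t * Y t)) \<in> uq2_fin q"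
    using X Y unfolding fin_family_def by (simp only: uq2_fin.mult)
  obtain K where K: "\<And>t. t \<in> uq2_reps q \<Longrightarrow> norm (X t) \<le> K" using fin_familyE[OF X] by blast
  obtain L where L: "\<And>t. t \<in> uq2_reps q \<Longrightarrow> norm (Y t) \<le> L" using fin_familyE[OF Y] by blast
  have "norm (X t * Y t) \<le> \<bar>K\<bar> * \<bar>L\<bar>" if "t \<in> uq2_reps q" for t
    using K[OF that] L[OF that] by (intro norm_mult_ineq[THEN order_trans] mult_mono) auto
  with 1 show ?thesis unfolding fin_family_def by blast
qed

lemma lim_family_one: "lim_family q (\<lambda>_. 1)"
proof (rule lim_familyI_fin)
  have "uq2_elem q (\<lambda>t. app 1) = uq2_elem q (\<lambda>_. id)" by (auto simp: uq2_elem_def fun_eq_iff)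
  then show "fin_family q (\<lambda>_. 1)" unfolding fin_family_def by (metis uq2_fin.unit norm_one order_refl)
qed

lemma lim_family_scal_const: "lim_family q (\<lambda>_. scal a)"
proof (rule lim_familyI_fin)
  have "uq2_elem q (\<lambda>t. app (scal a)) = a *\<^sub>C uq2_elem q (\<lambda>_. id)"
    by (auto simp: uq2_elem_def fun_eq_iff)
  then show "fin_family q (\<lambda>_. scal a)"
    unfolding fin_family_def by (metis uq2_fin.unit uq2_fin.scale order_refl)
qed

lemma lim_family_add:
  assumes X: "lim_family q X" and Y: "lim_family q Y" shows "lim_family q (\<lambda>t. X t + Y t)"
  unfolding lim_family_def
proof (intro allI impI)
  fix \<epsilon> :: real assume "0 < \<epsilon>"
  obtain X' where X': "fin_family q X'" "\<And>t. t \<in> uq2_reps q \<Longrightarrow> norm (X t - X' t) \<le> \<epsilon> / 2"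
    using lim_familyE[OF X half_gt_zero[OF \<open>0 < \<epsilon>\<close>]] by blast
  obtain Y' where Y': "fin_family q Y'" "\<And>t. t \<in> uq2_reps q \<Longrightarrow> norm (Y t - Y' t) \<le> \<epsilon> / 2"
    using lim_familyE[OF Y half_gt_zero[OF \<open>0 < \<epsilon>\<close>]] by blast
  have "norm (X t + Y t - (X' t + Y' t)) \<le> \<epsilon>" if "t \<in> uq2_reps q" for t
    using norm_triangle_ineq[of "X t - X' t" "Y t - Y' t"] X'(2)[OF that] Y'(2)[OF that] by (simp add: algebra_simps)
  then show "\<exists>Z. fin_family q Z \<and> (\<forall>t\<in>uq2_reps q. norm (X t + Y t - Z t) \<le> \<epsilon>)"
    using fin_family_add[OF X'(1) Y'(1)] by blast
qed

lemma lim_family_mult: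
  assumes X: "lim_family q X" and Y: "lim_family q Y" shows "lim_family q (\<lambda>t. X t * Y t)"
  unfolding lim_family_def
proof (intro allI impI)
  fix \<epsilon> :: real assume e: "0 < \<epsilon>"
  obtain K where K: "0 \<le> K" "\<And>t. t \<in> uq2_reps q \<Longrightarrow> norm (X t) \<le> K" using lim_family_bounded[OF X] by blast
  define \<delta>' where "\<delta>' = \<epsilon> / (2 * (K + 1))"
  have "0 < \<delta>'" using e K by (simp add: \<delta>'_def)
  then obtain Y' where Y': "fin_family q Y'" "\<And>t. t \<in> uq2_reps q \<Longrightarrow> norm (Y t - Y' t) \<le> \<delta>'"
    using lim_familyE[OF Y] by blast
  obtain L where L: "0 \<le> L" "\<And>t. t \<in> uq2_reps q \<Longrightarrow> norm (Y' t) \<le> L"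
    using lim_family_bounded[OF lim_familyI_fin[OF Y'(1)]] by blast
  define \<delta> where "\<delta> = \<epsilon> / (2 * (L + 1))"
  have "0 < \<delta>" using e L by (simp add: \<delta>_def)
  then obtain X' where X': "fin_family q X'" "\<And>t. t \<in> uq2_reps q \<Longrightarrow> norm (X t - X' t) \<le> \<delta>"
    using lim_familyE[OF X] by blast
  have "norm (X t * Y t - X' t * Y' t) \<le> \<epsilon>" if t: "t \<in> uq2_reps q" for t
  proof -
    have "X t * Y t - X' t * Y' t = X t * (Y t - Y' t) + (X t - X' t) * Y' t" by (simp add: algebra_simps)
    also have "norm \<dots> \<le> norm (X t) * norm (Y t - Y' t) + norm (X t - X' t) * norm (Y' t)"
      by (intro norm_triangle_le add_mono norm_mult_ineq)
    also have "\<dots> \<le> K * \<delta>' + \<delta> * L"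
      using K(1) L(1) K(2)[OF t] L(2)[OF t] X'(2)[OF t] Y'(2)[OF t] \<open>0 < \<delta>\<close> by (intro add_mono mult_mono) auto
    also have "\<dots> \<le> (K + 1) * \<delta>' + \<delta> * (L + 1)"
      using \<open>0 < \<delta>\<close> \<open>0 < \<delta>'\<close> by (intro add_mono mult_mono) (use K L in auto)
    also have "\<dots> = \<epsilon>"
    proof -
      have "(K + 1) * \<delta>' = \<epsilon> / 2" "\<delta> * (L + 1) = \<epsilon> / 2"
        using K(1) L(1) by (simp_all add: \<delta>_def \<delta>'_def divide_simps)
      then show ?thesis by simp
    qed
    finally show ?thesis .
  qed
  then show "\<exists>Z. fin_family q Z \<and> (\<forall>t\<in>uq2_reps q. norm (X t * Y t - Z t) \<le> \<epsilon>)"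
    using fin_family_mult[OF X'(1) Y'(1)] by blast
qed

lemma lim_family_scal: "lim_family q X \<Longrightarrow> lim_family q (\<lambda>t. scal a * X t)"
  by (rule lim_family_mult[OF lim_family_scal_const])

lemma lim_family_diff: "lim_family q X \<Longrightarrow> lim_family q Y \<Longrightarrow> lim_family q (\<lambda>t. X t - Y t)"
  using lim_family_add[of q X "\<lambda>t. scal (- 1) * Y t"] lim_family_scal[of q Y "- 1"] by (simp add: scal_minus)

lemma lim_family_power: "lim_family q X \<Longrightarrow> lim_family q (\<lambda>t. X t ^ n)"
  by (induction n) (auto intro: lim_family_one lim_family_mult)

lemma lim_family_ipow: "lim_family q X \<Longrightarrow> lim_family q Y \<Longrightarrow> lim_family q (\<lambda>t. ipow (X t) (Y t) j)"
  by (cases "0 \<le> j") (simp_all add: ipow_def lim_family_power)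

lemma lim_family_sum: "finite F \<Longrightarrow> (\<And>x. x \<in> F \<Longrightarrow> lim_family q (X x)) \<Longrightarrow> lim_family q (\<lambda>t. \<Sum>x\<in>F. X x t)"
proof (induction F rule: finite_induct)
  case empty then show ?case using lim_family_scal_const[of q 0] by simp
next
  case (insert x F) then show ?case by (simp add: lim_family_add)
qed

text \<open>The Weierstrass test over the set of all representations; this is why every majorant has
  to be independent of \<open>t\<close>.\<close>

lemma lim_family_infsum:
  assumes X: "\<And>x. lim_family q (X x)" and le: "\<And>x t. t \<in> uq2_reps q \<Longrightarrow> norm (X x t) \<le> M x"
    and M: "M summable_on UNIV"
  shows "lim_family q (\<lambda>t. \<Sum>\<^sub>\<infinity>x. X x t)"
proof (rule lim_family_closed)
  fix \<epsilon> :: real assume "0 < \<epsilon>"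
  have "uniform_limit (uq2_reps q) (\<lambda>F t. \<Sum>x\<in>F. X x t) (\<lambda>t. \<Sum>\<^sub>\<infinity>x. X x t) (finite_subsets_at_top UNIV)"
    by (rule Weierstrass_m_test_general[OF le M])
  from uniform_limitD[OF this \<open>0 < \<epsilon>\<close>]
  obtain F where F0: "finite F \<and> F \<subseteq> UNIV \<and> (\<forall>Y. finite Y \<and> F \<subseteq> Y \<and> Y \<subseteq> UNIV \<longrightarrow>
      (\<forall>t\<in>uq2_reps q. dist (\<Sum>x\<in>Y. X x t) (\<Sum>\<^sub>\<infinity>x. X x t) < \<epsilon>))"
    unfolding eventually_finite_subsets_at_top by (rule exE)
  have F: "finite F" "\<And>t. t \<in> uq2_reps q \<Longrightarrow> dist (\<Sum>x\<in>F. X x t) (\<Sum>\<^sub>\<infinity>x. X x t) < \<epsilon>"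
    using F0 F0[THEN conjunct2, THEN conjunct2, THEN spec, of F] by simp_all
  have "norm ((\<Sum>\<^sub>\<infinity>x. X x t) - (\<Sum>x\<in>F. X x t)) \<le> \<epsilon>" if "t \<in> uq2_reps q" for t
    using F(2)[OF that] by (simp add: dist_norm norm_minus_commute)
  then show "\<exists>Y. lim_family q Y \<and> (\<forall>t\<in>uq2_reps q. norm ((\<Sum>\<^sub>\<infinity>x. X x t) - Y t) \<le> \<epsilon>)"
    by (intro exI[of _ "\<lambda>t. \<Sum>x\<in>F. X x t"] conjI ballI lim_family_sum[OF F(1) X])
qed

lemma app_bop_of_adj: "bounded_clinear f \<Longrightarrow> app (bop_of (adj f)) = adj f"
  by (metis adjoint_pair_adj adjoint_pair_adj_app app_bop_of)

abbreviation "gA t \<equiv> bop_of (fst t)"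
abbreviation "gB t \<equiv> bop_of (fst (snd t))"
abbreviation "gV t \<equiv> bop_of (snd (snd t))"
abbreviation "gA' t \<equiv> bop_of (adj (fst t))"
abbreviation "gB' t \<equiv> bop_of (adj (fst (snd t)))"
abbreviation "gV' t \<equiv> bop_of (adj (snd (snd t)))"

lemma q_phase:
  assumes "0 < cmod q"
  shows "q\<^sup>2 / complex_of_real ((cmod q)\<^sup>2) = cis (2 * pi * uq2_theta q)"
proof -
  have "q = of_real (cmod q) * cis (Arg q)" by (metis rcis_cmod_Arg rcis_def)
  then have "q\<^sup>2 = of_real ((cmod q)\<^sup>2) * cis (2 * Arg q)"
    by (metis Complex.DeMoivre of_nat_numeral of_real_power power_mult_distrib)
  then show ?thesis using assms by (simp add: uq2_theta_def)
qed

lemma uq2_rep_reps: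
  assumes q: "0 < cmod q" "cmod q < 1" and t: "t \<in> uq2_reps q"
  shows "uq2_rep q (gA t) (gA' t) (gB t) (gB' t) (gV t) (gV' t) (2 * pi * uq2_theta q)"
proof -
  obtain a b D where abD: "t = (a, b, D)" by (cases t)
  have cl: "bounded_clinear a" "bounded_clinear b" "bounded_clinear D" and rel: "uq2_relations q a b D"
    using t by (auto simp: uq2_reps_def abD)
  note ap = cl[THEN app_bop_of] cl[THEN app_bop_of_adj]
  have adj: "adjoint_pair (bop_of f) (bop_of (adj f))" if "bounded_clinear f" for f :: hop
    using adjoint_pair_adj_app[of "bop_of f"] by (simp add: app_bop_of[OF that])
  note r = rel[unfolded uq2_relations_def fun_eq_iff q_phase[OF q(1)], simplified]
  show ?thesis
    unfolding abD fst_conv snd_conv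
    by (intro uq2_rep.intro q adj cl) (use r in \<open>auto intro!: bop_eqI simp: ap\<close>)
qed

lemma lim_family_generators:
  assumes q: "0 < cmod q" "cmod q < 1"
  shows "lim_family q gB" "lim_family q gB'" "lim_family q gV" "lim_family q gV'"
proof -
  have adj0: "adj (0 :: hop) = 0" by (rule adj_eqI) simp
  have e: "uq2_elem q (\<lambda>t. app (gB t)) = uq2_elem q (\<lambda>(a, b, D). b)" "uq2_elem q (\<lambda>t. app (gV t)) = uq2_elem q (\<lambda>(a, b, D). D)"
    "uq2_elem q (\<lambda>t. app (gB' t)) = uq2_star (uq2_elem q (\<lambda>(a, b, D). b))"
    "uq2_elem q (\<lambda>t. app (gV' t)) = uq2_star (uq2_elem q (\<lambda>(a, b, D). D))"
    by (auto simp: uq2_elem_def uq2_star_def fun_eq_iff uq2_reps_def app_bop_of app_bop_of_adj adj0)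
  have n: "norm (gB t) \<le> 1 \<and> norm (gB' t) \<le> 1 \<and> norm (gV t) \<le> 1 \<and> norm (gV' t) \<le> 1" if "t \<in> uq2_reps q" for t
    using uq2_rep.norm_le_1[OF uq2_rep_reps[OF q that]] by blast
  show "lim_family q gB" "lim_family q gB'" "lim_family q gV" "lim_family q gV'"
    using n unfolding fin_family_def by (auto intro!: lim_familyI_fin exI[of _ 1] simp: fin_family_def e uq2_fin.gen_b uq2_fin.gen_D uq2_fin.star)
qed

section \<open>The projection as an element of the algebra\<close>

definition weyl_family :: "nat \<Rightarrow> real \<Rightarrow> int \<times> int \<Rightarrow> family" where
  "weyl_family m c x t = uq2_rep.weyl (gB t) (gB' t) (gV t) (gV' t) m (c\<^sup>2) x"

definition proj_family :: "nat \<Rightarrow> real \<Rightarrow> family" where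
  "proj_family m c t = weyl_system.P (\<lambda>x. weyl_family m c x t) c"

locale uq2_weyl =
  fixes q :: complex and m :: nat and c :: real
  assumes q: "0 < cmod q" "cmod q < 1" and c: "0 < c" "c\<^sup>2 \<le> 1 / 8" and m: "0 < m"
    and phase: "\<And>n :: int. cis (2 * pi * uq2_theta q * m * n) = cis (- 2 * pi * c\<^sup>2 * n)"
begin

lemma weyl_system_family:
  assumes "t \<in> uq2_reps q" shows "weyl_system (\<lambda>x. weyl_family m c x t) c"
  using uq2_rep.weyl_system_weyl[OF uq2_rep_reps[OF q assms] c phase]
  by (simp add: weyl_family_def[abs_def])

lemma lim_family_weyl: "lim_family q (weyl_family m c x)"
proof -
  obtain j k where x: "x = (j, k)" by (cases x)
  let ?N = "\<lambda>t. gB t * gB' t"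
  have N: "lim_family q ?N" by (intro lim_family_mult lim_family_generators q)
  have q2: "(cmod q)\<^sup>2 < 1" using q power_strict_mono[of "cmod q" 1 2] by simp
  have "lim_family q (\<lambda>t. \<Sum>\<^sub>\<infinity>n. ?N t ^ n * (1 - ?N t))"
  proof (rule lim_family_infsum)
    show "lim_family q (\<lambda>t. ?N t ^ n * (1 - ?N t))" for n
      by (intro lim_family_mult[of q "\<lambda>t. ?N t ^ n"] lim_family_power lim_family_diff lim_family_one N)
    show "norm (?N t ^ n * (1 - ?N t)) \<le> ((cmod q)\<^sup>2) ^ n" if "t \<in> uq2_reps q" for n t
      using uq2_rep.N_power_diff[OF uq2_rep_reps[OF q that]] unfolding uq2_rep.N_def[OF uq2_rep_reps[OF q that]] .
    show "(\<lambda>n. ((cmod q)\<^sup>2) ^ n) summable_on UNIV"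
      using q2 by (intro norm_summable_imp_summable_on) (auto intro: summable_geometric simp: norm_power)
  qed
  then have "lim_family q (\<lambda>t. 1 - (\<Sum>\<^sub>\<infinity>n. ?N t ^ n * (1 - ?N t)))"
    by (rule lim_family_diff[OF lim_family_one])
  then have p: "lim_family q (\<lambda>t. uq2_rep.p (gB t) (gB' t))"
    by (rule lim_family_cong)
      (simp add: uq2_rep.p_def[OF uq2_rep_reps[OF q]] uq2_rep.N_def[OF uq2_rep_reps[OF q]])
  have "lim_family q (\<lambda>t. scal (cis (pi * c\<^sup>2 * j * k)) * (ipow (gB t) (gB' t) j * (ipow (gV t) (gV' t) (int m * k) * uq2_rep.p (gB t) (gB' t))))"
    by (intro lim_family_scal lim_family_mult[of q "\<lambda>t. ipow (gB t) (gB' t) j"] lim_family_mult[of q "\<lambda>t. ipow (gV t) (gV' t) (int m * k)"]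
        lim_family_ipow lim_family_generators q p)
  then show ?thesis
    by (rule lim_family_cong) (simp add: x weyl_family_def uq2_rep.weyl_def[OF uq2_rep_reps[OF q]])
qed

text \<open>The series of \<open>H 0\<close> and of \<open>P\<close> have majorants free of
  \<open>t\<close>: the moduli of the Gaussian coefficients, and
  \<open>gauss_const c / 2^n\<close>.\<close>

lemma lim_family_proj: "lim_family q (proj_family m c)"
proof -
  let ?W = "\<lambda>t x. weyl_family m c x t"
  note ws = weyl_system_family
  have H: "lim_family q (\<lambda>t. weyl_system.H (?W t) c 0)"
  proof -
    have "lim_family q (\<lambda>t. \<Sum>\<^sub>\<infinity>x. scal (gauss c 0 (lat c x)) * weyl_family m c x t)"
    proof (rule lim_family_infsum)
      show "lim_family q (\<lambda>t. scal (gauss c 0 (lat c x)) * weyl_family m c x t)" for x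
        by (intro lim_family_scal lim_family_weyl)
      show "norm (scal (gauss c 0 (lat c x)) * weyl_family m c x t) \<le> cmod (gauss c 0 (lat c x))"
        if "t \<in> uq2_reps q" for x t
        using weyl_system.norm_W[OF ws[OF that], of x] by (simp add: mult_left_le)
    qed (rule summable_gauss[OF c(1)])
    then show ?thesis by (rule lim_family_cong) (simp add: weyl_system.H_def[OF ws])
  qed
  have T: "lim_family q (\<lambda>t. weyl_system.T (?W t) c n 0)" for n
  proof -
    have "lim_family q (\<lambda>t. (1 - weyl_system.H (?W t) c 0) ^ n * weyl_system.H (?W t) c 0)"
      by (intro lim_family_mult[of q "\<lambda>t. (1 - weyl_system.H (?W t) c 0) ^ n"] lim_family_power lim_family_diff lim_family_one H)
    then show ?thesis by (rule lim_family_cong) (simp add: weyl_system.T_def[OF ws])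
  qed
  have "lim_family q (\<lambda>t. \<Sum>\<^sub>\<infinity>n. weyl_system.T (?W t) c n 0)"
  proof (rule lim_family_infsum[OF T])
    show "norm (weyl_system.T (?W t) c n 0) \<le> gauss_const c * (1 / 2) ^ n" if "t \<in> uq2_reps q" for n t
      using weyl_system.norm_T[OF ws[OF that], of n 0] by simp
    show "(\<lambda>n. gauss_const c * (1 / 2) ^ n) summable_on UNIV"
      using gauss_const_nonneg[OF c(1)]
      by (intro norm_summable_imp_summable_on) (auto intro!: summable_mult summable_geometric simp: abs_mult)
  qed
  then show ?thesis
    by (rule lim_family_cong) (simp add: proj_family_def infsumI[OF weyl_system.has_sum_P[OF ws]])
qed

definition proj :: uq2 where "proj = uq2_elem q (\<lambda>t. app (proj_family m c t))"

lemma uq2_projection_proj: "uq2_projection q 1 (\<lambda>_ _. proj)"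
proof -
  have "proj \<in> C_uq2 q" unfolding proj_def by (rule lim_family_C_uq2[OF lim_family_proj])
  moreover have "uq2_mult proj proj = proj"
  proof
    fix t
    show "uq2_mult proj proj t = proj t"
    proof (cases "t \<in> uq2_reps q")
      case True
      have "app (proj_family m c t) \<circ> app (proj_family m c t) = app (proj_family m c t * proj_family m c t)" by auto
      then show ?thesis
        using True weyl_system.P_idem[OF weyl_system_family[OF True]]
        by (simp add: proj_def uq2_elem_def uq2_mult_def proj_family_def)
    qed (auto simp: proj_def uq2_elem_def uq2_mult_def)
  qed
  moreover have "uq2_star proj = proj"
  proof
    fix t
    have adj0: "adj (0 :: hop) = 0" by (rule adj_eqI) simp
    show "uq2_star proj t = proj t"
    proof (cases "t \<in> uq2_reps q")
      case True
      then show ?thesis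
        using adjoint_pair_adj[OF weyl_system.P_self[OF weyl_system_family[OF True]]]
        by (simp add: proj_def uq2_elem_def uq2_star_def proj_family_def)
    qed (simp add: proj_def uq2_elem_def uq2_star_def adj0)
  qed
  ultimately show ?thesis by (simp add: uq2_projection_def)
qed

end

lemma theta_approx:
  assumes "\<theta> \<notin> \<rat>"
  obtains m :: nat and c :: real where "0 < m" "0 < c" "c\<^sup>2 \<le> 1 / 8"
    "\<And>n :: int. cis (2 * pi * \<theta> * m * n) = cis (- 2 * pi * c\<^sup>2 * n)"
proof -
  \<comment> \<open>The fractional part is aimed at the interval from \<open>7/8\<close> to 1, so
    that \<open>\<alpha>\<close> is positive, hence a square \<open>c^2\<close>, and at most the
    \<open>1/8\<close> demanded by \<open>dual_sum\<close>.\<close>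
  obtain k where k: "0 < k" "\<bar>frac (real k * \<theta>) - 15 / 16\<bar> < 1 / 16"
    by (rule Kronecker_approx_1_explicit[OF assms, of "15 / 16" "1 / 16"]) auto
  define \<alpha> where "\<alpha> = 1 - frac (real k * \<theta>)"
  have \<alpha>: "0 < \<alpha>" "\<alpha> \<le> 1 / 8" using k(2) frac_lt_1[of "real k * \<theta>"] unfolding \<alpha>_def abs_less_iff by linarith+
  have "cis (2 * pi * \<theta> * k * n) = cis (- 2 * pi * \<alpha> * n)" for n :: int
  proof -
    have "2 * pi * \<theta> * k * n = - 2 * pi * \<alpha> * n + 2 * pi * of_int ((\<lfloor>real k * \<theta>\<rfloor> + 1) * n)"
      by (simp add: \<alpha>_def frac_def algebra_simps)
    then have "cis (2 * pi * \<theta> * k * n) = cis (- 2 * pi * \<alpha> * n) * cis (2 * pi * of_int ((\<lfloor>real k * \<theta>\<rfloor> + 1) * n))"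
      by (simp only: cis_mult)
    also have "cis (2 * pi * of_int ((\<lfloor>real k * \<theta>\<rfloor> + 1) * n)) = 1"
      by (rule cis_multiple_2pi) (rule Ints_of_int)
    finally show ?thesis by simp
  qed
  then show ?thesis using that[of k "sqrt \<alpha>"] k(1) \<alpha> by simp
qed

section \<open>The standard representation\<close>

context uq2_weyl
begin

definition t\<^sub>0 :: "hop \<times> hop \<times> hop" where "t\<^sub>0 = (pi_a q, pi_b q, pi_D q)"

lemma t\<^sub>0: "t\<^sub>0 \<in> uq2_reps q"
  unfolding t\<^sub>0_def by (rule uq2_pi_rep[OF q])

lemma coord_gens:
  "coord (app (gB t\<^sub>0) x) (i, j, k) = q ^ i * coord x (i, j - 1, k)"
  "coord (app (gB' t\<^sub>0) x) (i, j, k) = cnj q ^ i * coord x (i, j + 1, k)"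
  "coord (app (gV t\<^sub>0) x) (i, j, k) = cis (- 2 * pi * uq2_theta q * j) * coord x (i, j, k - 1)"
  "coord (app (gV' t\<^sub>0) x) (i, j, k) = cis (2 * pi * uq2_theta q * j) * coord x (i, j, k + 1)"
  by (simp_all only: t\<^sub>0_def fst_conv snd_conv app_bop_of app_bop_of_adj coord_pi_b[OF q(2)] coord_pi_D)

abbreviation "rep_p \<equiv> uq2_rep.p (gB t\<^sub>0) (gB' t\<^sub>0)"

lemma coord_p: "coord (app rep_p x) (i, j, k) = (if i = 0 then coord x (i, j, k) else 0)"
proof (rule LIMSEQ_unique)
  note R = uq2_rep_reps[OF q t\<^sub>0]
  let ?N = "uq2_rep.N (gB t\<^sub>0) (gB' t\<^sub>0)"
  show "(\<lambda>n. coord (app (?N ^ n) x) (i, j, k)) \<longlonglongrightarrow> coord (app rep_p x) (i, j, k)"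
    by (intro bounded_linear.tendsto[OF bounded_linear_coord] bounded_linear.tendsto[OF bounded_linear_app_left] uq2_rep.N_tendsto[OF R])
  have N: "coord (app ?N y) (i, j, k) = of_real ((cmod q ^ (2 * i))) * coord y (i, j, k)" for y
  proof -
    have "q ^ i * cnj q ^ i = of_real (cmod q ^ (2 * i))"
      by (metis complex_norm_square power_mult_distrib of_real_power power_mult)
    then show ?thesis by (simp add: uq2_rep.N_def[OF R] coord_gens flip: mult.assoc)
  qed
  have "coord (app (?N ^ n) x) (i, j, k) = of_real ((cmod q ^ (2 * i)) ^ n) * coord x (i, j, k)" for n
    by (induction n) (simp_all add: N)
  moreover have "(\<lambda>n. of_real ((cmod q ^ (2 * i)) ^ n) * coord x (i, j, k)) \<longlonglongrightarrow> (if i = 0 then coord x (i, j, k) else 0)"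
  proof (cases "i = 0")
    case False
    then have "cmod q ^ (2 * i) < 1" using q power_less_one_iff[of "cmod q" "2 * i"] by simp
    then have "(\<lambda>n. (cmod q ^ (2 * i)) ^ n) \<longlonglongrightarrow> 0" using q by (intro LIMSEQ_realpow_zero) auto
    then have "(\<lambda>n. complex_of_real ((cmod q ^ (2 * i)) ^ n) * coord x (i, j, k)) \<longlonglongrightarrow> of_real 0 * coord x (i, j, k)"
      by (intro tendsto_mult tendsto_of_real tendsto_const)
    then show ?thesis using False by simp
  qed simp
  ultimately show "(\<lambda>n. coord (app (?N ^ n) x) (i, j, k)) \<longlonglongrightarrow> (if i = 0 then coord x (i, j, k) else 0)"
    by simp
qed

lemma coord_ipow_B: "coord (app (ipow (gB t\<^sub>0) (gB' t\<^sub>0) a) x) (0, j, k) = coord x (0, j - a, k)"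
proof -
  have "coord (app (gB t\<^sub>0 ^ n) x) (0, j, k) = coord x (0, j - int n, k)"
    "coord (app (gB' t\<^sub>0 ^ n) x) (0, j, k) = coord x (0, j + int n, k)" for n
    by (induction n arbitrary: j) (simp_all add: coord_gens algebra_simps)
  then show ?thesis by (auto simp: ipow_def)
qed

lemma coord_ipow_V: "coord (app (ipow (gV t\<^sub>0) (gV' t\<^sub>0) b) x) (i, j, k) = cis (- 2 * pi * uq2_theta q * j * b) * coord x (i, j, k - b)"
proof -
  have step: "cis s * (cis (s * real n) * y) = cis (s * real (Suc n)) * y" for s n y
    by (simp add: cis_mult distrib_left flip: mult.assoc)
  define s where "s = - 2 * pi * uq2_theta q * j"
  have "coord (app (gV t\<^sub>0 ^ n) x) (i, j, k) = cis (s * real n) * coord x (i, j, k - int n)" for n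
  proof (induction n arbitrary: k)
    case (Suc n)
    have "coord (app (gV t\<^sub>0 ^ Suc n) x) (i, j, k) = cis s * coord (app (gV t\<^sub>0 ^ n) x) (i, j, k - 1)"
      by (simp add: coord_gens(3) s_def)
    moreover have "k - 1 - int n = k - int (Suc n)" by simp
    ultimately show ?case by (simp only: Suc step)
  qed simp
  moreover have "coord (app (gV' t\<^sub>0 ^ n) x) (i, j, k) = cis (- s * real n) * coord x (i, j, k + int n)" for n
  proof (induction n arbitrary: k)
    case (Suc n)
    have "coord (app (gV' t\<^sub>0 ^ Suc n) x) (i, j, k) = cis (- s) * coord (app (gV' t\<^sub>0 ^ n) x) (i, j, k + 1)"
      by (simp add: coord_gens(4) s_def)
    moreover have "k + 1 + int n = k + int (Suc n)" by simp
    ultimately show ?case by (simp only: Suc step)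
  qed simp
  ultimately show ?thesis by (auto simp: ipow_def s_def)
qed

abbreviation "W \<equiv> \<lambda>x. weyl_family m c x t\<^sub>0"

definition \<omega> :: "int \<times> int \<Rightarrow> int \<Rightarrow> complex" where
  "\<omega> = (\<lambda>(a, b) j. cis (pi * c\<^sup>2 * a * b) * cis (- 2 * pi * uq2_theta q * (j - a) * of_int (int m * b)))"

lemma coord_W: "coord (app (W (a, b)) x) (i, j, k) = (if i = 0 then \<omega> (a, b) j * coord x (0, j - a, k - int m * b) else 0)"
proof (cases "i = 0")
  case True
  then show ?thesis
    by (simp add: weyl_family_def uq2_rep.weyl_def[OF uq2_rep_reps[OF q t\<^sub>0]] coord_ipow_B coord_ipow_V coord_p \<omega>_def
        del: of_int_mult)
next
  case False
  note R = uq2_rep_reps[OF q t\<^sub>0]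
  let ?b = "ipow (gB t\<^sub>0) (gB' t\<^sub>0) a" and ?v = "ipow (gV t\<^sub>0) (gV' t\<^sub>0) (int m * b)"
  have "?b * (?v * rep_p) = (?b * rep_p) * ?v"
    by (simp only: ipow_commute[OF uq2_rep.p_V[OF R]] mult.assoc)
  also have "\<dots> = rep_p * (?b * ?v)"
    by (simp only: ipow_commute[OF uq2_rep.p_B[OF R]] mult.assoc)
  finally have "?b * (?v * rep_p) = rep_p * (?b * ?v)" .
  then have "W (a, b) = scal (cis (pi * c\<^sup>2 * a * b)) * (rep_p * (?b * ?v))"
    by (simp add: weyl_family_def uq2_rep.weyl_def[OF R])
  then show ?thesis using False by (simp add: coord_p)
qed

section \<open>The phase and the holomorphic coordinate in the standard representation\<close>

definition d' :: "idx \<Rightarrow> complex" where "d' = uq2_d((0, 0, 0) := 1)"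

definition u :: "idx \<Rightarrow> complex" where "u i = sgn (d' i)"

text \<open>The Weyl operator at \<open>(a, b)\<close> shifts \<open>k\<close> by
  \<open>m b\<close>; dividing by \<open>m\<close> in the second component makes \<open>z\<close>
  grow by exactly \<open>lat c (a, b)\<close>.\<close>

definition z :: "int \<Rightarrow> int \<Rightarrow> complex" where
  "z j k = Complex (c * j) (c / m * k)"

text \<open>The projection only sees the indices with \<open>i = 0\<close>; elsewhere \<open>zm\<close> merely has to be proper
  and accretive.\<close>

definition zm :: "idx \<Rightarrow> complex" where
  "zm = (\<lambda>(i, j, k). if i = 0 then z j k * cnj (u (0, j, k)) else of_real (real i + \<bar>of_int j\<bar> + \<bar>of_int k\<bar>))"

lemma d'_neq_0: "d' i \<noteq> 0"
  using uq2_d_ge1[of i] by (auto simp: d'_def)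

lemma d'_0: "(j, k) \<noteq> (0, 0) \<Longrightarrow> d' (0, j, k) = Complex (of_int j) (of_int k)"
  by (auto simp: d'_def uq2_d_def complex_eq_iff)

lemma d'_origin: "d' (0, 0, 0) = 1"
  by (simp add: d'_def)

lemma u_unit: "cmod (u i) = 1"
  by (simp add: u_def norm_sgn d'_neq_0)

lemma u_zm: "u (0, j, k) * zm (0, j, k) = z j k"
proof -
  have "u (0, j, k) * cnj (u (0, j, k)) = 1"
    using complex_norm_square[of "u (0, j, k)"] by (simp add: u_unit)
  then show ?thesis by (simp add: zm_def mult.left_commute)
qed

text \<open>For \<open>i = 0\<close> the real part of \<open>z\<close> times the conjugate of
  \<open>j + \<i> k\<close> is \<open>c j^2 + (c / m) k^2\<close>: the stretching of the second
  coordinate keeps the two numbers in one open half plane.\<close>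

lemma zm_pos:
  assumes "i \<noteq> (0, 0, 0)" shows "0 < Re (zm i)"
proof -
  obtain l j k where i: "i = (l, j, k)" by (cases i)
  show ?thesis
  proof (cases "l = 0")
    case True
    then have jk: "(j, k) \<noteq> (0, 0)" using assms i by auto
    have "Re (zm i) = (c * j * j + c / m * k * k) / cmod (d' (0, j, k))"
      using True by (simp add: i zm_def z_def u_def sgn_eq d'_0[OF jk] add_divide_distrib)
    moreover have "0 < c * j * j + c / m * k * k"
    proof (cases "j = 0")
      case True
      then have "k \<noteq> 0" using jk by simp
      then have "0 < c / m * (of_int k)\<^sup>2" using c m by (intro mult_pos_pos) auto
      then show ?thesis using True by (simp add: power2_eq_square)
    next
      case False
      then have "0 < c * (of_int j)\<^sup>2" using c by (intro mult_pos_pos) auto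
      moreover have "0 \<le> c / m * (of_int k)\<^sup>2" using c by simp
      ultimately have "0 < c * (of_int j)\<^sup>2 + c / m * (of_int k)\<^sup>2" by (rule add_pos_nonneg)
      then show ?thesis by (simp add: power2_eq_square mult.assoc)
    qed
    ultimately show ?thesis using d'_neq_0 by simp
  next
    case False
    then show ?thesis by (simp add: i zm_def add_pos_nonneg)
  qed
qed

lemma zm_proper: "finite {i. cmod (zm i) \<le> N}"
proof -
  define R where "R = \<lceil>max N (max (N / c) (N * m / c))\<rceil>"
  have R: "N \<le> R" "N / c \<le> R" "N * m / c \<le> R" unfolding R_def by linarith+
  have "{i. cmod (zm i) \<le> N} \<subseteq> {..nat R} \<times> {- R..R} \<times> {- R..R}"
  proof
    fix i assume "i \<in> {i. cmod (zm i) \<le> N}"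
    then obtain l j k where i: "i = (l, j, k)" "cmod (zm (l, j, k)) \<le> N" by (cases i) auto
    have "real l \<le> R \<and> \<bar>real_of_int j\<bar> \<le> R \<and> \<bar>real_of_int k\<bar> \<le> R"
    proof (cases "l = 0")
      case True
      have n: "cmod (z j k) \<le> N" using i(2) True by (simp add: zm_def norm_mult u_unit)
      have "c * \<bar>real_of_int j\<bar> \<le> N" "c / m * \<bar>real_of_int k\<bar> \<le> N"
        using abs_Re_le_cmod[of "z j k"] abs_Im_le_cmod[of "z j k"] n c by (simp_all add: z_def abs_mult)
      then have "\<bar>real_of_int j\<bar> \<le> N / c" "\<bar>real_of_int k\<bar> \<le> N * m / c"
        using c m by (simp_all add: field_simps)
      then show ?thesis using R True by linarith
    next
      case False
      have "real l + \<bar>of_int j\<bar> + \<bar>of_int k\<bar> \<le> N" using i(2) False by (simp add: zm_def del: of_real_add)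
      then show ?thesis using R(1) by linarith
    qed
    then have "int l \<le> R \<and> \<bar>j\<bar> \<le> R \<and> \<bar>k\<bar> \<le> R" by linarith
    then show "i \<in> {..nat R} \<times> {- R..R} \<times> {- R..R}" by (auto simp: i)
  qed
  then show ?thesis by (rule finite_subset) auto
qed

lemma z_diff: "z j k - z (j - a) (k - int m * b) = lat c (a, b)"
  using m by (simp add: z_def lat_def complex_eq_iff field_simps)

text \<open>Phases vary at the rate \<open>1 / |y|\<close>, which compensates the linear growth of
  \<open>z\<close> in \<open>zm_lipschitz\<close>.\<close>

lemma sgn_lipschitz: "cmod y * cmod (sgn x - sgn y) \<le> 2 * cmod (x - y)" for x y :: complex
proof (cases "x = 0 \<or> y = 0")
  case False
  have "of_real (cmod y) * (sgn x - sgn y) = (of_real (cmod y) - of_real (cmod x)) * sgn x + (x - y)"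
    using False by (simp add: sgn_eq field_simps)
  then have "cmod y * cmod (sgn x - sgn y) = cmod ((of_real (cmod y) - of_real (cmod x)) * sgn x + (x - y))"
    by (metis norm_mult norm_of_real abs_norm_cancel)
  also have "\<dots> \<le> \<bar>cmod y - cmod x\<bar> * cmod (sgn x) + cmod (x - y)"
    by (rule norm_triangle_le) (simp add: norm_mult flip: of_real_diff)
  also have "\<dots> \<le> 2 * cmod (x - y)"
    using False norm_triangle_ineq3[of y x] by (simp add: norm_sgn norm_minus_commute)
  finally show ?thesis .
qed (auto simp: norm_sgn)

text \<open>In \<open>1 + 4 m\<close> the 1 is the increment of \<open>z\<close>. The rest is the
  increment of the phase: 2 from \<open>sgn_lipschitz\<close>, 2 from the modified value of
  \<open>d'\<close> at the origin, and \<open>m\<close> because a lattice step moves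
  \<open>k\<close> by \<open>m b\<close>.\<close>

lemma zm_lipschitz:
  "cmod (zm (0, j, k) - zm (0, j - a, k - int m * b)) \<le> (1 + 4 * m) * cmod (lat c (a, b))"
proof -
  define j' where "j' = j - a"
  define k' where "k' = k - int m * b"
  have lat: "cmod (Complex (of_int (j - j')) (of_int (k - k'))) \<le> m / c * cmod (lat c (a, b))"
  proof -
    have "(real_of_int a)\<^sup>2 + (real m * b)\<^sup>2 \<le> (real m * a)\<^sup>2 + (real m * b)\<^sup>2"
    proof -
      have "1 * (real_of_int a)\<^sup>2 \<le> (real m)\<^sup>2 * (real_of_int a)\<^sup>2"
        using m by (intro mult_right_mono) (auto simp: one_le_power)
      then show ?thesis by (simp add: power_mult_distrib)
    qed
    also have "\<dots> = (real m / c * cmod (lat c (a, b)))\<^sup>2"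
      using c by (simp add: lat_def power_mult_distrib cmod_power2 power_divide field_simps)
    finally have "(cmod (Complex (of_int (j - j')) (of_int (k - k'))))\<^sup>2 \<le> (real m / c * cmod (lat c (a, b)))\<^sup>2"
      by (simp add: j'_def k'_def cmod_power2)
    then show ?thesis using c by (auto intro: power2_le_imp_le)
  qed
  have zle: "cmod (z j' k') \<le> c * cmod (Complex (of_int j') (of_int k'))"
  proof -
    have "(c / m * k')\<^sup>2 \<le> (c * k')\<^sup>2"
    proof -
      have "(c / m)\<^sup>2 \<le> c\<^sup>2" using c m by (intro power_mono) (auto simp: divide_le_eq)
      from mult_right_mono[OF this, of "(real_of_int k')\<^sup>2", OF zero_le_power2] show ?thesis by (simp only: power_mult_distrib)
    qed
    then have "(cmod (z j' k'))\<^sup>2 \<le> (c * cmod (Complex (of_int j') (of_int k')))\<^sup>2"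
      by (simp add: z_def cmod_power2 power_mult_distrib distrib_left)
    then show ?thesis using c by (auto intro: power2_le_imp_le)
  qed
  have key: "cmod (z j' k') * cmod (u (0, j, k) - u (0, j', k')) \<le> 4 * m * cmod (lat c (a, b))"
  proof (cases "(j', k') = (0, 0)")
    case True
    then have "z j' k' = 0" by (simp add: z_def complex_eq_iff)
    then show ?thesis by simp
  next
    case False
    let ?x = "d' (0, j, k)" and ?y = "d' (0, j', k')"
    have y: "?y = Complex (of_int j') (of_int k')" by (rule d'_0[OF False])
    \<comment> \<open>The factor 2 serves the origin, where \<open>d'\<close> is 1 instead of 0:
      there \<open>|1 - y| <= 1 + |y| <= 2 |y|\<close>, as \<open>|y| >= 1\<close>.\<close>
    have xy: "cmod (?x - ?y) \<le> 2 * cmod (Complex (of_int (j - j')) (of_int (k - k')))"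
    proof (cases "(j, k) = (0, 0)")
      case True
      have "1 \<le> cmod ?y" using uq2_d_ge1[of "(0, j', k')"] by (simp add: d'_def)
      moreover have "cmod (1 - ?y) \<le> 1 + cmod ?y" using norm_triangle_ineq4[of 1 ?y] by simp
      moreover have "cmod (Complex (of_int (j - j')) (of_int (k - k'))) = cmod ?y"
        using True unfolding y by (simp add: cmod_def)
      ultimately show ?thesis using True by (simp add: d'_origin)
    next
      case False
      have "?x - ?y = Complex (of_int (j - j')) (of_int (k - k'))"
        unfolding y d'_0[OF False] by (simp add: complex_eq_iff)
      then show ?thesis by simp
    qed
    have "cmod (z j' k') * cmod (u (0, j, k) - u (0, j', k')) \<le> c * (cmod ?y * cmod (u (0, j, k) - u (0, j', k')))"
      using mult_right_mono[OF zle, of "cmod (u (0, j, k) - u (0, j', k'))"] by (simp add: y mult.assoc)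
    also have "\<dots> \<le> c * (2 * cmod (?x - ?y))"
      unfolding u_def using c by (intro mult_left_mono sgn_lipschitz) auto
    also have "\<dots> \<le> c * (2 * (2 * (m / c * cmod (lat c (a, b)))))"
      using c xy lat by (intro mult_left_mono) auto
    also have "\<dots> = 4 * m * cmod (lat c (a, b))" using c by simp
    finally show ?thesis .
  qed
  have "zm (0, j, k) - zm (0, j', k') = (z j k - z j' k') * cnj (u (0, j, k)) + z j' k' * cnj (u (0, j, k) - u (0, j', k'))"
    by (simp add: zm_def algebra_simps)
  also have "cmod \<dots> \<le> cmod (z j k - z j' k') * 1 + cmod (z j' k') * cmod (u (0, j, k) - u (0, j', k'))"
    by (rule norm_triangle_le) (simp only: norm_mult complex_mod_cnj u_unit order_refl)
  also have "\<dots> \<le> (1 + 4 * m) * cmod (lat c (a, b))"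
    using key z_diff[of j k a b] by (simp add: j'_def k'_def distrib_right)
  finally show ?thesis by (simp add: j'_def k'_def)
qed

lemma commutator_bound_W: "commutator_bound zm 0 (W x) ((1 + 4 * m) * cmod (lat c x))"
proof -
  obtain a b where x: "x = (a, b)" by (cases x)
  define g where "g = (\<lambda>(i :: nat, j, k). if i = 0 then zm (0, j, k) - zm (0, j - a, k - int m * b) else 0)"
  have g: "cmod (g i) \<le> (1 + 4 * m) * cmod (lat c x)" for i
    using zm_lipschitz by (auto simp: g_def x split: prod.split)
  have cg: "coord (app (mulop g) y) i = g i * coord y i" for y i
    by (rule coord_mulop[OF g])
  have gi: "g (i, j, k) = (if i = 0 then zm (0, j, k) - zm (0, j - a, k - int m * b) else 0)" for i j k
    by (simp add: g_def)
  have "commutator zm (W x) (mulop g * W x)"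
    unfolding commutator_def
  proof (intro allI impI)
    fix v w :: hilb and i :: idx
    assume vw: "\<forall>i. coord w i = zm i * coord v i"
    obtain l j k where i: "i = (l, j, k)" by (cases i)
    show "zm i * coord (app (W x) v) i = coord (app (W x) w) i + coord (app (mulop g * W x) v) i"
      using vw by (cases "l = 0") (simp_all add: i x coord_W cg gi algebra_simps)
  qed
  moreover have "norm (mulop g * W x) \<le> (1 + 4 * m) * cmod (lat c x)"
  proof -
    have "norm (mulop g * W x) \<le> norm (mulop g) * norm (W x)" by (rule norm_mult_ineq)
    also have "\<dots> \<le> ((1 + 4 * m) * cmod (lat c x)) * 1"
      by (intro mult_mono norm_mulop_le[OF g] weyl_system.norm_W[OF weyl_system_family[OF t\<^sub>0]]) auto
    finally show ?thesis by simp
  qed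
  ultimately show ?thesis unfolding commutator_bound_def by auto
qed

lemma commutator_W: "commutator (\<lambda>i. u i * zm i) (W x) (scal (lat c x) * W x)"
  unfolding commutator_def
proof (intro allI impI)
  obtain a b where x: "x = (a, b)" by (cases x)
  fix v w :: hilb and i :: idx
  assume vw: "\<forall>i. coord w i = u i * zm i * coord v i"
  obtain l j k where i: "i = (l, j, k)" by (cases i)
  have "z j k = z (j - a) (k - int m * b) + lat c (a, b)"
    using z_diff[of j k a b] by (simp add: algebra_simps)
  then show "u i * zm i * coord (app (W x) v) i = coord (app (W x) w) i + coord (app (scal (lat c x) * W x) v) i"
    using vw by (cases "l = 0") (simp_all add: i x coord_W u_zm algebra_simps)
qed

lemma coord_W_ket: "coord (app (W x) (ket (0, 0, 0))) (0, 0, 0) = (if x = (0, 0) then 1 else 0)"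
proof -
  obtain a b where x: "x = (a, b)" by (cases x)
  show ?thesis using m by (auto simp: x coord_W coord_ket \<omega>_def)
qed

lemma index_proj:
  "pairing_fredholm (uq2_pi_eq q) uq2_F uq2_gamma 1 (\<lambda>_ _. proj)"
  "index_pairing (uq2_pi_eq q) uq2_F uq2_gamma 1 (\<lambda>_ _. proj) \<noteq> 0"
proof -
  have z0: "zm (0, 0, 0) = 0" by (simp add: zm_def z_def complex_eq_iff)
  obtain Y Yz where C: "compression (proj_family m c t\<^sub>0) Y Yz u zm (0, 0, 0)"
    using weyl_system.compression_P[OF weyl_system_family[OF t\<^sub>0] u_unit z0 zm_pos zm_proper commutator_bound_W _ commutator_W coord_W_ket]
    unfolding proj_family_def by fastforce
  have u: "u i = sgn ((uq2_d((0, 0, 0) := 1)) i)" for i by (simp add: u_def d'_def)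
  have p: "uq2_pi q proj = app (proj_family m c t\<^sub>0)"
    using t\<^sub>0 by (simp add: uq2_pi_def proj_def uq2_elem_def t\<^sub>0_def)
  show "pairing_fredholm (uq2_pi_eq q) uq2_F uq2_gamma 1 (\<lambda>_ _. proj)"
    "index_pairing (uq2_pi_eq q) uq2_F uq2_gamma 1 (\<lambda>_ _. proj) \<noteq> 0"
    by (rule index_pairing_compression[OF C u p])+
qed

end

theorem theorem5p9:
  fixes q :: complex
  assumes "0 < cmod q" and "cmod q < 1" and "uq2_theta q \<notin> \<rat>"
  shows "\<exists>n P. uq2_projection q n P \<and>
    pairing_fredholm (uq2_pi_eq q) uq2_F uq2_gamma n P \<and>
    index_pairing (uq2_pi_eq q) uq2_F uq2_gamma n P \<noteq> 0"
proof -
  obtain m :: nat and c :: real where mc: "0 < m" "0 < c" "c\<^sup>2 \<le> 1 / 8"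
    "\<And>n :: int. cis (2 * pi * uq2_theta q * m * n) = cis (- 2 * pi * c\<^sup>2 * n)"
    using theta_approx[OF assms(3)] by blast
  interpret uq2_weyl q m c
    by (rule uq2_weyl.intro) (use assms mc in auto)
  show ?thesis using uq2_projection_proj index_proj by blast
qed

end
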